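(* Fix $t\in(0,1)$. For each $p$ let $(Z_1,\dots,Z_p)^T\sim N((\mu_1,\dots,\mu_p)^T,\boldsymbol\Sigma)$ with $\boldsymbol\Sigma=(\sigma_{ij})$ and $\sigma_{jj}=1$ for $j=1,\dots,p$ (the means and covariances may depend on $p$). Assume: (i) (weak dependence) $\sum_{i,j}|\sigma_{ij}|=O(p^{2-\delta})$ as $p\to\infty$ for some $\delta>0$; (ii) $\limsup_{p\to\infty} p_0t/(p_1\bar\xi)<1$; (iii) there is a universal constant $C>0$ such that for all sufficiently large $p$, $$\sum_{i\ne j;\, i,j\in\mathcal H_0}\sigma_{ij}^2\ \ge\ \frac{C_t^{\max}}{\phi(z_{t/2})|z_{t/2}|}\sum_{i\in\mathcal H_1,\, j\in\mathcal H_0,\, \mu_i\in[-\mu_t,\mu_t]}\sigma_{ij}^2,$$ $$\sum_{i\ne j;\, i,j\in\mathcal H_0}\sigma_{ij}^2+p\ \ge\ C\sum_{i\ne j;\, i,j\in\mathcal H_1}\sigma_{ij}^2;$$ (iv) as $p\to\infty$, $$\sum_{i\ne j}\sigma_{ij}^4=o\Big(\sum_{i\ne j;\, i,j\in\mathcal H_0}\sigma_{ij}^2+p_0\Big).$$ Then $$\mathrm{FDP}(t)=\frac{E(\bar V)}{E(\bar R)}+m(\bar V,\bar R)+r(\bar V,\bar R),$$ where $\bar V=V(t)/p$, $\bar R=R(t)/p$, $$m(\bar V,\bar R)=\frac{\bar V}{E(\bar R)}-\frac{E(\bar V)}{\{E(\bar R)\}^2}\bar R,$$ and the remainder $r(\bar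 V,\bar R)$ satisfies, as $p\to\infty$, $$E\{r^2(\bar V,\bar R)\}=o\big[\mathrm{Var}\{m(\bar V,\bar R)\}\big].$$
   Context: $\phi$ and $\Phi$ are the standard normal density and distribution function, and $z_{t/2}=\Phi^{-1}(t/2)$ (so $z_{t/2}<0$). $\mathcal H_0=\{j:\mu_j=0\}$ (true nulls), $\mathcal H_1=\{j:\mu_j\neq0\}$ (false nulls), with cardinalities $p_0,p_1$, $p_0+p_1=p$; $p_1\ge1$ so that $\bar\xi$ below is defined. All of these depend on $p$. The $j$th test is $t_j=\mathbf 1(|Z_j|>|z_{t/2}|)$. $V(t)=\sum_{j\in\mathcal H_0}t_j$, $R(t)=\sum_{j=1}^p t_j$, and $\mathrm{FDP}(t)=V(t)/R(t)$, with $\mathrm{FDP}(t)=0$ if $R(t)=0$. $\xi_j=\Phi(z_{t/2}+\mu_j)+\Phi(z_{t/2}-\mu_j)$ and $\bar\xi=\frac1{p_1}\sum_{j\in\mathcal H_1}\xi_j$. Let $H(\mu)=\phi(|z_{t/2}|+\mu)(|z_{t/2}|+\mu)+\phi(|z_{t/2}|-\mu)(|z_{t/2}|-\mu)$. This function has a unique root in the interval $(|z_{t/2}|,|z_{t/2}|+1)$, denoted $\mu_t$; and $C_t^{\max}=\sup_{\mu\in(-\mu_t,\mu_t)}H(\mu)$. Sums over $i\neq j$ are over ordered pairs of distinct indices in $\{1,\dots,p\}$ (restricted as indicated). *)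

theory Defs
  imports "HOL-Probability.Probability" "HOL-Library.Landau_Symbols"
begin

definition Phi :: "real \<Rightarrow> real" where
  "Phi = cdf std_normal_distribution"

text \<open>\<open>Phi\<close> is a strictly increasing bijection onto the open unit interval, so that
  \<open>inv Phi u\<close> is the usual quantile for \<open>0 < u < 1\<close>.\<close>

definition zq :: "real \<Rightarrow> real" where
  "zq u = inv Phi u"

text \<open>The normal law with mean \<open>m\<close> and variance \<open>v\<close>, including the point mass at \<open>m\<close>
  for \<open>v = 0\<close>.\<close>

definition normal_rv :: "'a measure \<Rightarrow> ('a \<Rightarrow> real) \<Rightarrow> real \<Rightarrow> real \<Rightarrow> bool" where
  "normal_rv M X m v \<longleftrightarrow>
     X \<in> borel_measurable M \<and>
     (if v = 0 then AE \<omega> in M. X \<omega> = m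
      else v > 0 \<and> distributed M lborel X (normal_density m (sqrt v)))"

text \<open>A finite family is \<open>N(\<mu>, \<Sigma>)\<close> iff every linear combination of its components is
  normal with the corresponding mean and variance (possibly zero, as \<open>\<Sigma>\<close> may be singular).
  Positive semidefiniteness of \<open>\<Sigma>\<close> is implied; symmetry is not, because only the
  symmetric part of \<open>\<Sigma>\<close> enters the variances.\<close>

definition multivariate_normal ::
  "'a measure \<Rightarrow> 'i set \<Rightarrow> ('i \<Rightarrow> 'a \<Rightarrow> real) \<Rightarrow> ('i \<Rightarrow> real) \<Rightarrow> ('i \<Rightarrow> 'i \<Rightarrow> real) \<Rightarrow> bool" where
  "multivariate_normal M I X \<mu> \<sigma> \<longleftrightarrow>
     finite I \<and>
     (\<forall>i\<in>I. X i \<in> borel_measurable M) \<and>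
     (\<forall>i\<in>I. \<forall>j\<in>I. \<sigma> i j = \<sigma> j i) \<and>
     (\<forall>a. normal_rv M (\<lambda>\<omega>. \<Sum>i\<in>I. a i * X i \<omega>)
            (\<Sum>i\<in>I. a i * \<mu> i) (\<Sum>i\<in>I. \<Sum>j\<in>I. a i * a j * \<sigma> i j))"

definition true_nulls :: "nat \<Rightarrow> (nat \<Rightarrow> real) \<Rightarrow> nat set" where
  "true_nulls p \<mu> = {j\<in>{1..p}. \<mu> j = 0}"

definition false_nulls :: "nat \<Rightarrow> (nat \<Rightarrow> real) \<Rightarrow> nat set" where
  "false_nulls p \<mu> = {j\<in>{1..p}. \<mu> j \<noteq> 0}"

definition test :: "real \<Rightarrow> real \<Rightarrow> real" where
  "test t x = of_bool (\<bar>x\<bar> > \<bar>zq (t / 2)\<bar>)"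

definition V :: "real \<Rightarrow> nat \<Rightarrow> (nat \<Rightarrow> real) \<Rightarrow> (nat \<Rightarrow> 'a \<Rightarrow> real) \<Rightarrow> 'a \<Rightarrow> real" where
  "V t p \<mu> Z \<omega> = (\<Sum>j\<in>true_nulls p \<mu>. test t (Z j \<omega>))"

definition R :: "real \<Rightarrow> nat \<Rightarrow> (nat \<Rightarrow> 'a \<Rightarrow> real) \<Rightarrow> 'a \<Rightarrow> real" where
  "R t p Z \<omega> = (\<Sum>j\<in>{1..p}. test t (Z j \<omega>))"

definition FDP :: "real \<Rightarrow> nat \<Rightarrow> (nat \<Rightarrow> real) \<Rightarrow> (nat \<Rightarrow> 'a \<Rightarrow> real) \<Rightarrow> 'a \<Rightarrow> real" where
  "FDP t p \<mu> Z \<omega> = (if R t p Z \<omega> = 0 then 0 else V t p \<mu> Z \<omega> / R t p Z \<omega>)"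

definition Vbar :: "real \<Rightarrow> nat \<Rightarrow> (nat \<Rightarrow> real) \<Rightarrow> (nat \<Rightarrow> 'a \<Rightarrow> real) \<Rightarrow> 'a \<Rightarrow> real" where
  "Vbar t p \<mu> Z \<omega> = V t p \<mu> Z \<omega> / real p"

definition Rbar :: "real \<Rightarrow> nat \<Rightarrow> (nat \<Rightarrow> 'a \<Rightarrow> real) \<Rightarrow> 'a \<Rightarrow> real" where
  "Rbar t p Z \<omega> = R t p Z \<omega> / real p"

definition xi :: "real \<Rightarrow> real \<Rightarrow> real" where
  "xi t m = Phi (zq (t / 2) + m) + Phi (zq (t / 2) - m)"

definition xi_bar :: "real \<Rightarrow> nat \<Rightarrow> (nat \<Rightarrow> real) \<Rightarrow> real" where
  "xi_bar t p \<mu> =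
     (\<Sum>j\<in>false_nulls p \<mu>. xi t (\<mu> j)) / real (card (false_nulls p \<mu>))"

definition H :: "real \<Rightarrow> real \<Rightarrow> real" where
  "H t m = (let a = \<bar>zq (t / 2)\<bar> in
     std_normal_density (a + m) * (a + m) + std_normal_density (a - m) * (a - m))"

definition mu_root :: "real \<Rightarrow> real" where
  "mu_root t = (THE m. m \<in> {\<bar>zq (t / 2)\<bar><..<\<bar>zq (t / 2)\<bar> + 1} \<and> H t m = 0)"

definition C_max :: "real \<Rightarrow> real" where
  "C_max t = (SUP m\<in>{- mu_root t<..<mu_root t}. H t m)"

definition lin_part :: "'a measure \<Rightarrow> ('a \<Rightarrow> real) \<Rightarrow> ('a \<Rightarrow> real) \<Rightarrow> 'a \<Rightarrow> real" where
  "lin_part M X Y \<omega> =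
     X \<omega> / prob_space.expectation M Y
     - prob_space.expectation M X / (prob_space.expectation M Y)\<^sup>2 * Y \<omega>"

end

theory Submission
  imports Defs
begin

text \<open>Write \<open>\<rho>\<close> for the mean of \<open>Rbar\<close>, \<open>v\<close> for that of \<open>Vbar\<close> and \<open>m\<close> for the linear part. The remainder is
  \<open>(1 - Rbar / \<rho>) (FDP - v / \<rho>)\<close>, and \<open>FDP - v / \<rho> = m \<rho> / Rbar\<close>; so its square is at most
  \<open>4 \<epsilon>\<^sup>2 m\<^sup>2\<close> unless \<open>Rbar\<close> deviates from \<open>\<rho>\<close> by a constant. Such deviations are negligible: bracketing
  the indicators by smooth ramps, Gaussian concentration bounds their probability by any power of
  \<open>p\<^sup>-\<^sup>2 \<Sum>|\<sigma> i j|\<close>, hence by \<open>O(p\<^sup>-\<^sup>3)\<close>. On the other side the variance of \<open>m\<close> is at least a constant times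
  \<open>(\<Sum>\<sigma>\<^sup>2 + p\<^sub>0) / p\<^sup>2\<close>, with the sum over ordered pairs of distinct true nulls: Plackett's identity
  gives the covariance of the test of a true null with another test, up to an error of order
  \<open>\<sigma>\<^sup>4\<close>, as \<open>a \<phi>(a) H(\<mu>) \<sigma>\<^sup>2\<close> with \<open>a = |z\<^sub>t\<^sub>/\<^sub>2|\<close>; as \<open>H(0) = 2 a \<phi>(a)\<close>, hypothesis (iii) leaves the null-null
  covariances at least twice the positive part of the null-nonnull ones, and the limsup condition
  makes \<open>v / \<rho>\<close> stay below \<open>1 / 2\<close>. If there are no true nulls, the remainder vanishes.\<close>

section \<open>Laws determined by linear combinations\<close>

text \<open>The tail of \<open>Rbar\<close> competes with a variance that is only known to exceed a
  constant over \<open>p\<^sup>2\<close> when few nulls are true. Under weak dependence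
  \<open>p\<^sup>-\<^sup>2 \<Sum>|\<sigma> i j|\<close> decays like \<open>p\<close> to the power
  \<open>- \<delta>\<close>, with \<delta> possibly tiny, so a variance bound for
  \<open>Rbar\<close> does not suffice; moments of order \<open>2 * k\<close> with
  \<open>\<delta> * k \<ge> 3\<close> do, and leave one power of \<open>p\<close> to absorb
  constants. Gaussian concentration reaches such moments but needs differentiable Lipschitz
  functionals, hence the ramps, whose bias is small uniformly in the means. The value 1/2 for
  \<open>q = v / \<rho>\<close> comes from a weight. If \<open>U0\<close> and \<open>U1\<close> are
  the centred sums over true and false nulls, the linear part is proportional to
  \<open>(1 - q) * U0 - q * U1\<close>; the second moment of \<open>U1\<close> is dropped as
  nonnegative, and the other two terms leave \<open>2 * (1 - q) * (1 - 2 * q)\<close> in front of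
  the squared correlations. The test of a true null is even in a centred variable, so its covariance
  with another test is even in \<sigma>; the error is therefore of order four, not three. The
  covariance matrix may be singular, so joint laws are handled by characteristic functions rather
  than densities.\<close>

lemma weighted_law_unique:
  fixes u X :: "'a \<Rightarrow> real" and v Y :: "'b \<Rightarrow> real" and B :: real
  assumes "prob_space M" "prob_space N"
    and [measurable]: "u \<in> borel_measurable M" "X \<in> borel_measurable M"
      "v \<in> borel_measurable N" "Y \<in> borel_measurable N"
    and u: "\<And>\<omega>. 0 \<le> u \<omega>" "\<And>\<omega>. u \<omega> \<le> B" and v: "\<And>\<omega>. 0 \<le> v \<omega>" "\<And>\<omega>. v \<omega> \<le> B"
    and eq: "\<And>\<tau> \<theta>. (\<integral>\<omega>. u \<omega> * cos (\<tau> * X \<omega> + \<theta>) \<partial>M) = (\<integral>\<omega>. v \<omega> * cos (\<tau> * Y \<omega> + \<theta>) \<partial>N)"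
    and A [measurable]: "A \<in> sets borel"
  shows "(\<integral>\<omega>. u \<omega> * indicator A (X \<omega>) \<partial>M) = (\<integral>\<omega>. v \<omega> * indicator A (Y \<omega>) \<partial>N)"
proof -
  interpret M: prob_space M by fact
  interpret N: prob_space N by fact
  define c where "c = (\<integral>\<omega>. u \<omega> \<partial>M)"
  have cv: "c = (\<integral>\<omega>. v \<omega> \<partial>N)"
    using eq[of 0 0] by (simp add: c_def)
  have iu: "integrable M u"
    by (rule M.integrable_const_bound[of _ B]) (use u in auto)
  have iv: "integrable N v"
    by (rule N.integrable_const_bound[of _ B]) (use v in auto)
  have iuA: "integrable M (\<lambda>\<omega>. u \<omega> * indicator A (X \<omega>))"
    by (rule Bochner_Integration.integrable_bound[OF iu]) (auto simp: indicator_def u)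
  have ivA: "integrable N (\<lambda>\<omega>. v \<omega> * indicator A (Y \<omega>))"
    by (rule Bochner_Integration.integrable_bound[OF iv]) (auto simp: indicator_def v)
  have "c \<ge> 0" unfolding c_def using u by (simp add: integral_nonneg)
  show ?thesis
  proof (cases "c = 0")
    case True
    have "(\<integral>\<omega>. u \<omega> * indicator A (X \<omega>) \<partial>M) \<le> c"
      unfolding c_def by (rule integral_mono[OF iuA iu]) (auto simp: indicator_def u)
    moreover have "(\<integral>\<omega>. v \<omega> * indicator A (Y \<omega>) \<partial>N) \<le> c"
      unfolding cv by (rule integral_mono[OF ivA iv]) (auto simp: indicator_def v)
    moreover have "0 \<le> (\<integral>\<omega>. u \<omega> * indicator A (X \<omega>) \<partial>M)" "0 \<le> (\<integral>\<omega>. v \<omega> * indicator A (Y \<omega>) \<partial>N)"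
      using u v by (simp_all add: integral_nonneg)
    ultimately show ?thesis using True by linarith
  next
    case False
    with \<open>c \<ge> 0\<close> have c: "c > 0" by simp
    \<comment> \<open>Divided by its mass \<open>c\<close>, the weight becomes a probability
      density, and the law of \<open>W\<close> under the tilted measure is an ordinary distribution
      on the line. The phases \<open>0\<close> and \<open>- pi/2\<close> give the real and the
      imaginary part of its characteristic function, so the cosine hypothesis is what Levy
      uniqueness needs.\<close>
    have law: "real_distribution (distr (density K (\<lambda>\<omega>. ennreal (w \<omega> / c))) borel W)
        \<and> (\<forall>\<tau>. char (distr (density K (\<lambda>\<omega>. ennreal (w \<omega> / c))) borel W) \<tau> =
            Complex ((\<integral>\<omega>. w \<omega> * cos (\<tau> * W \<omega> + 0) \<partial>K) / c) ((\<integral>\<omega>. w \<omega> * cos (\<tau> * W \<omega> + (- pi/2)) \<partial>K) / c))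
        \<and> measure (distr (density K (\<lambda>\<omega>. ennreal (w \<omega> / c))) borel W) A = (\<integral>\<omega>. w \<omega> * indicator A (W \<omega>) \<partial>K) / c"
      if "prob_space K" and [measurable]: "w \<in> borel_measurable K" "W \<in> borel_measurable K"
        and w: "\<And>\<omega>. 0 \<le> w \<omega>" "\<And>\<omega>. w \<omega> \<le> B" and cw: "c = (\<integral>\<omega>. w \<omega> \<partial>K)"
      for K :: "'c measure" and w W
    proof -
      interpret K: prob_space K by fact
      have iw: "integrable K w"
        by (rule K.integrable_const_bound[of _ B]) (use w in auto)
      let ?D = "density K (\<lambda>\<omega>. ennreal (w \<omega> / c))"
      have "emeasure ?D (space ?D) = (\<integral>\<^sup>+\<omega>. ennreal (w \<omega> / c) \<partial>K)"
        by (simp add: emeasure_density)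
      also have "\<dots> = ennreal (\<integral>\<omega>. w \<omega> / c \<partial>K)"
        using iw w c by (intro nn_integral_eq_integral) auto
      also have "\<dots> = 1" using c cw by simp
      finally interpret D: prob_space ?D by (rule prob_spaceI)
      have 1: "real_distribution (distr ?D borel W)"
        by (rule D.real_distribution_distr) simp
      have 2: "char (distr ?D borel W) \<tau> =
            Complex ((\<integral>\<omega>. w \<omega> * cos (\<tau> * W \<omega> + 0) \<partial>K) / c) ((\<integral>\<omega>. w \<omega> * cos (\<tau> * W \<omega> + (- pi/2)) \<partial>K) / c)" for \<tau>
      proof -
        have "char (distr ?D borel W) \<tau> = (\<integral>\<omega>. (w \<omega> / c) *\<^sub>R iexp (\<tau> * W \<omega>) \<partial>K)"
          unfolding char_def using w c
          by (subst integral_distr) (auto simp: integral_density)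
        moreover have "integrable K (\<lambda>\<omega>. (w \<omega> / c) *\<^sub>R iexp (\<tau> * W \<omega>))"
          by (rule Bochner_Integration.integrable_bound[OF iw[THEN integrable_divide[of _ _ c]]])
             (auto simp: norm_mult)
        ultimately show ?thesis
          by (auto simp: complex_eq_iff simp flip: integral_Re integral_Im integral_divide_zero
               intro!: Bochner_Integration.integral_cong)
             (auto simp: Re_exp Im_exp cos_add cos_diff)
      qed
      have "measure (distr ?D borel W) A = (\<integral>x. indicator A x \<partial>distr ?D borel W)"
        by simp
      also have "\<dots> = (\<integral>\<omega>. indicator A (W \<omega>) \<partial>?D)"
        by (rule integral_distr) auto
      also have "\<dots> = (\<integral>\<omega>. (w \<omega> / c) *\<^sub>R indicator A (W \<omega>) \<partial>K)"
        by (rule integral_density) (use w c in auto)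
      finally show ?thesis using 1 2 by simp
    qed
    note l1 = law[OF \<open>prob_space M\<close> assms(3,4) u c_def] and l2 = law[OF \<open>prob_space N\<close> assms(5,6) v cv]
    have "distr (density M (\<lambda>\<omega>. ennreal (u \<omega> / c))) borel X = distr (density N (\<lambda>\<omega>. ennreal (v \<omega> / c))) borel Y"
      by (rule Levy_uniqueness) (use l1 l2 eq[of _ 0] eq[of _ "- pi / 2"] in \<open>auto simp: fun_eq_iff\<close>)
    then show ?thesis using l1 l2 c by auto
  qed
qed

text \<open>A Cramer-Wold argument resting on uniqueness on the line alone: coordinates are turned
  into indicators one at a time. Those already treated form a nonnegative weight, under which
  \<open>weighted_law_unique\<close> handles the next one; the cosine of a general linear
  combination stays in the integrand so that the induction can continue. In the end the two laws
  agree on boxes.\<close>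

lemma cos_law_unique:
  fixes X :: "'i \<Rightarrow> 'a \<Rightarrow> real" and Y :: "'i \<Rightarrow> 'b \<Rightarrow> real"
  assumes "prob_space M" "prob_space N" and "finite I"
    and X: "\<And>i. i \<in> I \<Longrightarrow> X i \<in> borel_measurable M"
    and Y: "\<And>i. i \<in> I \<Longrightarrow> Y i \<in> borel_measurable N"
    and eq: "\<And>s \<theta>. (\<integral>\<omega>. cos ((\<Sum>i\<in>I. s i * X i \<omega>) + \<theta>) \<partial>M) = (\<integral>\<omega>. cos ((\<Sum>i\<in>I. s i * Y i \<omega>) + \<theta>) \<partial>N)"
  shows "distr M (PiM I (\<lambda>_. borel)) (\<lambda>\<omega>. \<lambda>i\<in>I. X i \<omega>) = distr N (PiM I (\<lambda>_. borel)) (\<lambda>\<omega>. \<lambda>i\<in>I. Y i \<omega>)"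
proof -
  interpret M: prob_space M by fact
  interpret N: prob_space N by fact
  have claim: "(\<integral>\<omega>. (\<Prod>i\<in>J. indicator (A i) (X i \<omega>)) * cos ((\<Sum>i\<in>I. s i * X i \<omega>) + \<theta>) \<partial>M)
      = (\<integral>\<omega>. (\<Prod>i\<in>J. indicator (A i) (Y i \<omega>)) * cos ((\<Sum>i\<in>I. s i * Y i \<omega>) + \<theta>) \<partial>N)"
    if "finite J" "J \<subseteq> I" "\<And>i. i \<in> J \<Longrightarrow> A i \<in> sets borel" for A :: "'i \<Rightarrow> real set" and s \<theta> J
    using that
  proof (induction J arbitrary: s \<theta> rule: finite_induct)
    case empty
    show ?case using eq by simp
  next
    case (insert j J)
    have j: "j \<in> I" and J: "J \<subseteq> I" using insert by auto
    have mX [measurable]: "X i \<in> borel_measurable M" if "i \<in> I" for i using X that .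
    have mY [measurable]: "Y i \<in> borel_measurable N" if "i \<in> I" for i using Y that .
    have mA [measurable]: "A i \<in> sets borel" if "i \<in> insert j J" for i using insert that by auto
    define wX where "wX \<omega> = (\<Prod>i\<in>J. indicator (A i) (X i \<omega>) :: real)" for \<omega>
    define wY where "wY \<omega> = (\<Prod>i\<in>J. indicator (A i) (Y i \<omega>) :: real)" for \<omega>
    define SX where "SX s \<omega> = (\<Sum>i\<in>I. s i * X i \<omega>)" for s \<omega>
    define SY where "SY s \<omega> = (\<Sum>i\<in>I. s i * Y i \<omega>)" for s \<omega>
    have [measurable]: "wX \<in> borel_measurable M"
    proof -
      have "(\<lambda>\<omega>. indicator (A i) (X i \<omega>) :: real) \<in> borel_measurable M" if "i \<in> J" for i
      proof -
        have [measurable]: "X i \<in> borel_measurable M" "A i \<in> sets borel"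
          using that J mA mX by auto
        show ?thesis by measurable
      qed
      then show ?thesis unfolding wX_def by (rule borel_measurable_prod)
    qed
    have [measurable]: "wY \<in> borel_measurable N"
    proof -
      have "(\<lambda>\<omega>. indicator (A i) (Y i \<omega>) :: real) \<in> borel_measurable N" if "i \<in> J" for i
      proof -
        have [measurable]: "Y i \<in> borel_measurable N" "A i \<in> sets borel"
          using that J mA mY by auto
        show ?thesis by measurable
      qed
      then show ?thesis unfolding wY_def by (rule borel_measurable_prod)
    qed
    have [measurable]: "SX s \<in> borel_measurable M" "SY s \<in> borel_measurable N" for s
      unfolding SX_def SY_def by (auto intro!: borel_measurable_sum borel_measurable_times X Y)
    have w01: "0 \<le> wX \<omega>" "wX \<omega> \<le> 1" "0 \<le> wY \<omega>'" "wY \<omega>' \<le> 1" for \<omega> \<omega>'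
      unfolding wX_def wY_def by (auto intro!: prod_nonneg prod_le_1)
    have IH: "(\<integral>\<omega>. wX \<omega> * cos (SX s \<omega> + \<theta>) \<partial>M) = (\<integral>\<omega>. wY \<omega> * cos (SY s \<omega> + \<theta>) \<partial>N)" for s \<theta>
      unfolding wX_def wY_def SX_def SY_def using insert J by auto
    have intX: "integrable M (\<lambda>\<omega>. wX \<omega> * f \<omega>)" if [measurable]: "f \<in> borel_measurable M" and "\<And>\<omega>. \<bar>f \<omega>\<bar> \<le> 2" for f
    proof (rule M.integrable_const_bound[of _ 2])
      show "AE \<omega> in M. norm (wX \<omega> * f \<omega>) \<le> 2"
        using mult_mono[OF w01(2) that(2)] w01 by (auto simp: abs_mult)
    qed measurable
    have intY: "integrable N (\<lambda>\<omega>. wY \<omega> * f \<omega>)" if [measurable]: "f \<in> borel_measurable N" and "\<And>\<omega>. \<bar>f \<omega>\<bar> \<le> 2" for f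
    proof (rule N.integrable_const_bound[of _ 2])
      show "AE \<omega> in N. norm (wY \<omega> * f \<omega>) \<le> 2"
        using mult_mono[OF w01(4) that(2)] w01 by (auto simp: abs_mult)
    qed measurable
    have upd: "SX (s(j := s j + \<tau>)) \<omega> = SX s \<omega> + \<tau> * X j \<omega>" "SY (s(j := s j + \<tau>)) \<omega>' = SY s \<omega>' + \<tau> * Y j \<omega>'" for s \<tau> \<omega> \<omega>'
      unfolding SX_def SY_def using j \<open>finite I\<close>
      by (simp_all add: sum.remove[of I j] algebra_simps)
    \<comment> \<open>Weights must be nonnegative, so \<open>1 + cos\<close> stands in for
      \<open>cos\<close>. The product-to-sum formula moves \<open>\<tau> * X j\<close> into the
      coefficient of coordinate \<open>j\<close>, where the induction hypothesis applies.\<close>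
    have key: "(\<integral>\<omega>. wX \<omega> * (1 + cos (SX s \<omega> + \<theta>)) * cos (\<tau> * X j \<omega> + \<theta>') \<partial>M)
       = (\<integral>\<omega>. wY \<omega> * (1 + cos (SY s \<omega> + \<theta>)) * cos (\<tau> * Y j \<omega> + \<theta>') \<partial>N)" for s \<theta> \<tau> \<theta>'
    proof -
      define z where "z = (\<lambda>_::'i. 0 :: real)"
      have z0: "SX z \<omega> = 0" "SY z \<omega>' = 0" for \<omega> \<omega>'
        by (auto simp: SX_def SY_def z_def)
      have *: "(1 + cos a) * cos b = cos b + (cos (a + b) + cos (a - b)) / 2" for a b :: real
        by (simp add: cos_add cos_diff algebra_simps)
      have "(\<integral>\<omega>. wX \<omega> * (1 + cos (SX s \<omega> + \<theta>)) * cos (\<tau> * X j \<omega> + \<theta>') \<partial>M)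
        = (\<integral>\<omega>. wX \<omega> * cos (SX (z(j := z j + \<tau>)) \<omega> + \<theta>') + (wX \<omega> * cos (SX (s(j := s j + \<tau>)) \<omega> + (\<theta> + \<theta>')) + wX \<omega> * cos (SX (s(j := s j + - \<tau>)) \<omega> + (\<theta> - \<theta>'))) / 2 \<partial>M)"
        unfolding upd mult.assoc * by (intro Bochner_Integration.integral_cong) (auto simp: z0 algebra_simps)
      also have "\<dots> = (\<integral>\<omega>. wX \<omega> * cos (SX (z(j := z j + \<tau>)) \<omega> + \<theta>') \<partial>M) + ((\<integral>\<omega>. wX \<omega> * cos (SX (s(j := s j + \<tau>)) \<omega> + (\<theta> + \<theta>')) \<partial>M) + (\<integral>\<omega>. wX \<omega> * cos (SX (s(j := s j + - \<tau>)) \<omega> + (\<theta> - \<theta>')) \<partial>M)) / 2"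
        by (subst Bochner_Integration.integral_add Bochner_Integration.integral_divide_zero | (intro integrable_divide Bochner_Integration.integrable_add intX; (measurable; fail)?; (simp add: order_trans[OF abs_cos_le_one])?))+ simp
      also have "\<dots> = (\<integral>\<omega>. wY \<omega> * cos (SY (z(j := z j + \<tau>)) \<omega> + \<theta>') \<partial>N) + ((\<integral>\<omega>. wY \<omega> * cos (SY (s(j := s j + \<tau>)) \<omega> + (\<theta> + \<theta>')) \<partial>N) + (\<integral>\<omega>. wY \<omega> * cos (SY (s(j := s j + - \<tau>)) \<omega> + (\<theta> - \<theta>')) \<partial>N)) / 2"
        unfolding IH ..
      also have "\<dots> = (\<integral>\<omega>. wY \<omega> * cos (SY (z(j := z j + \<tau>)) \<omega> + \<theta>') + (wY \<omega> * cos (SY (s(j := s j + \<tau>)) \<omega> + (\<theta> + \<theta>')) + wY \<omega> * cos (SY (s(j := s j + - \<tau>)) \<omega> + (\<theta> - \<theta>'))) / 2 \<partial>N)"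
        by (subst Bochner_Integration.integral_add Bochner_Integration.integral_divide_zero | (intro integrable_divide Bochner_Integration.integrable_add intY; (measurable; fail)?; (simp add: order_trans[OF abs_cos_le_one])?))+ simp
      also have "\<dots> = (\<integral>\<omega>. wY \<omega> * (1 + cos (SY s \<omega> + \<theta>)) * cos (\<tau> * Y j \<omega> + \<theta>') \<partial>N)"
        unfolding upd mult.assoc * by (intro Bochner_Integration.integral_cong) (auto simp: z0 algebra_simps)
      finally show ?thesis .
    qed
    have step: "(\<integral>\<omega>. wX \<omega> * (1 + cos (SX s \<omega> + \<theta>)) * indicator (A j) (X j \<omega>) \<partial>M)
       = (\<integral>\<omega>. wY \<omega> * (1 + cos (SY s \<omega> + \<theta>)) * indicator (A j) (Y j \<omega>) \<partial>N)" for s \<theta>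
    proof (rule weighted_law_unique[where B=2, OF \<open>prob_space M\<close> \<open>prob_space N\<close>])
      have c: "0 \<le> 1 + cos x" "1 + cos x \<le> 2" for x :: real
        using cos_ge_minus_one[of x] cos_le_one[of x] by linarith+
      show "wX \<omega> * (1 + cos (SX s \<omega> + \<theta>)) \<le> 2" "wY \<omega>' * (1 + cos (SY s \<omega>' + \<theta>)) \<le> 2"
         "0 \<le> wX \<omega> * (1 + cos (SX s \<omega> + \<theta>))" "0 \<le> wY \<omega>' * (1 + cos (SY s \<omega>' + \<theta>))" for \<omega> \<omega>'
        using mult_mono[OF w01(2) c(2), of "SX s \<omega> + \<theta>" \<omega>] mult_mono[OF w01(4) c(2), of "SY s \<omega>' + \<theta>" \<omega>']
          w01 c by auto
    qed (use key j in \<open>auto intro: mX mY mA\<close>)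
    have c2: "\<bar>1 + cos x\<bar> \<le> 2" "\<bar>cos x\<bar> \<le> 2" for x :: real
      using cos_ge_minus_one[of x] cos_le_one[of x] by linarith+
    have z: "SX (\<lambda>_. 0) \<omega> = 0" "SY (\<lambda>_. 0) \<omega>' = 0" for \<omega> \<omega>' by (auto simp: SX_def SY_def)
    \<comment> \<open>For zero coefficients and zero phase the weight \<open>1 + cos\<close> is the
      constant 2; subtracting this instance removes the 1 that was added for positivity.\<close>
    have step0: "(\<integral>\<omega>. wX \<omega> * indicator (A j) (X j \<omega>) \<partial>M) = (\<integral>\<omega>. wY \<omega> * indicator (A j) (Y j \<omega>) \<partial>N)"
      using step[of "\<lambda>_. 0" 0] by (simp add: z mult.assoc mult.left_commute[of _ 2])
    have "(\<integral>\<omega>. wX \<omega> * (indicator (A j) (X j \<omega>) * cos (SX s \<omega> + \<theta>)) \<partial>M)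
      = (\<integral>\<omega>. wX \<omega> * (1 + cos (SX s \<omega> + \<theta>)) * indicator (A j) (X j \<omega>) - wX \<omega> * indicator (A j) (X j \<omega>) \<partial>M)"
      by (intro Bochner_Integration.integral_cong) (auto simp: algebra_simps)
    also have "\<dots> = (\<integral>\<omega>. wX \<omega> * (1 + cos (SX s \<omega> + \<theta>)) * indicator (A j) (X j \<omega>) \<partial>M) - (\<integral>\<omega>. wX \<omega> * indicator (A j) (X j \<omega>) \<partial>M)"
      unfolding mult.assoc using j mA c2 by (intro Bochner_Integration.integral_diff intX) (auto simp: indicator_def)
    also have "\<dots> = (\<integral>\<omega>. wY \<omega> * (1 + cos (SY s \<omega> + \<theta>)) * indicator (A j) (Y j \<omega>) \<partial>N) - (\<integral>\<omega>. wY \<omega> * indicator (A j) (Y j \<omega>) \<partial>N)"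
      unfolding step step0 ..
    also have "\<dots> = (\<integral>\<omega>. wY \<omega> * (1 + cos (SY s \<omega> + \<theta>)) * indicator (A j) (Y j \<omega>) - wY \<omega> * indicator (A j) (Y j \<omega>) \<partial>N)"
      unfolding mult.assoc using j mA c2 by (intro Bochner_Integration.integral_diff[symmetric] intY) (auto simp: indicator_def)
    also have "\<dots> = (\<integral>\<omega>. wY \<omega> * (indicator (A j) (Y j \<omega>) * cos (SY s \<omega> + \<theta>)) \<partial>N)"
      by (intro Bochner_Integration.integral_cong) (auto simp: algebra_simps)
    finally show ?case
      unfolding SX_def[symmetric] SY_def[symmetric]
      using insert(1,2) by (simp add: wX_def[symmetric] wY_def[symmetric] mult_ac)
  qed
  have [measurable]: "(\<lambda>\<omega>. \<lambda>i\<in>I. X i \<omega>) \<in> M \<rightarrow>\<^sub>M PiM I (\<lambda>_. borel)"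
    using X by (rule measurable_restrict)
  have [measurable]: "(\<lambda>\<omega>. \<lambda>i\<in>I. Y i \<omega>) \<in> N \<rightarrow>\<^sub>M PiM I (\<lambda>_. borel)"
    using Y by (rule measurable_restrict)
  let ?P = "distr M (PiM I (\<lambda>_. borel)) (\<lambda>\<omega>. \<lambda>i\<in>I. X i \<omega>)" and ?Q = "distr N (PiM I (\<lambda>_. borel)) (\<lambda>\<omega>. \<lambda>i\<in>I. Y i \<omega>)"
  interpret P: prob_space ?P by (rule M.prob_space_distr) measurable
  interpret Q: prob_space ?Q by (rule N.prob_space_distr) measurable
  have prodind: "(\<Prod>i\<in>I. indicator (A i) (f i) :: real) = indicator (Pi\<^sub>E I A) (\<lambda>i\<in>I. f i)" for A and f :: "'i \<Rightarrow> real"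
    using \<open>finite I\<close> by (auto simp: indicator_def PiE_iff prod_zero_iff intro!: prod.neutral)
  show ?thesis
  proof (rule measure_eqI_PiM_finite[OF \<open>finite I\<close>])
    fix A :: "'i \<Rightarrow> real set" assume A: "\<And>i. i \<in> I \<Longrightarrow> A i \<in> sets borel"
    have [measurable]: "Pi\<^sub>E I A \<in> sets (PiM I (\<lambda>_. borel))"
      using A \<open>finite I\<close> by (intro sets_PiM_I_finite) auto
    have "measure ?P (Pi\<^sub>E I A) = (\<integral>x. indicator (Pi\<^sub>E I A) x \<partial>?P)" by simp
    also have "\<dots> = (\<integral>\<omega>. indicator (Pi\<^sub>E I A) (\<lambda>i\<in>I. X i \<omega>) \<partial>M)"
      by (rule integral_distr) measurable
    also have "\<dots> = (\<integral>\<omega>. indicator (Pi\<^sub>E I A) (\<lambda>i\<in>I. Y i \<omega>) \<partial>N)"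
      using claim[of I A "\<lambda>_. 0" 0] A \<open>finite I\<close> by (simp add: prodind)
    also have "\<dots> = (\<integral>x. indicator (Pi\<^sub>E I A) x \<partial>?Q)"
      by (rule integral_distr[symmetric]) measurable
    also have "\<dots> = measure ?Q (Pi\<^sub>E I A)" by simp
    finally show "emeasure ?P (Pi\<^sub>E I A) = emeasure ?Q (Pi\<^sub>E I A)"
      by (simp add: P.emeasure_eq_measure Q.emeasure_eq_measure)
  next
    show "range (\<lambda>_::nat. Pi\<^sub>E I (\<lambda>_. UNIV)) \<subseteq> prod_algebra I (\<lambda>_. borel :: real measure)"
      using \<open>finite I\<close> by (auto intro!: prod_algebraI_finite)
    show "(\<Union>i::nat. Pi\<^sub>E I (\<lambda>_. UNIV)) = space (PiM I (\<lambda>_. borel :: real measure))"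
      by (simp add: space_PiM)
  qed (auto simp: P.emeasure_eq_measure)
qed

section \<open>Normal variables and the normal distribution function\<close>

lemma Phi_diff:
  assumes "c \<le> x"
  shows "Phi x - Phi c = integral {c..x} std_normal_density"
proof (cases "c = x")
  case False
  with assms have "c < x" by simp
  interpret S: real_distribution std_normal_distribution by (rule real_dist_normal_dist)
  have *: "set_integrable lborel {c<..x} std_normal_density" "set_integrable lborel {c..x} std_normal_density"
    unfolding set_integrable_def by (intro integrable_mult_indicator; simp)+
  have "emeasure std_normal_distribution {c<..x} = ennreal (\<integral>y. std_normal_density y * indicator {c<..x} y \<partial>lborel)"
    using * by (subst emeasure_density)
      (auto simp: set_integrable_def mult.commute indicator_mult_ennreal
            simp flip: ennreal_mult' ennreal_indicator intro!: nn_integral_eq_integral)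
  moreover have "(\<integral>y. std_normal_density y * indicator {c<..x} y \<partial>lborel)
      = (\<integral>y. std_normal_density y * indicator {c..x} y \<partial>lborel)"
    by (rule integral_cong_AE) (auto simp: indicator_def intro: AE_mp[OF AE_lborel_singleton[of c]])
  moreover have "0 \<le> (\<integral>y. std_normal_density y * indicator {c..x} y \<partial>lborel)"
    by (intro Bochner_Integration.integral_nonneg) auto
  ultimately have "measure std_normal_distribution {c<..x} = (\<integral>y. std_normal_density y * indicator {c..x} y \<partial>lborel)"
    by (simp add: measure_def)
  also have "\<dots> = set_lebesgue_integral lborel {c..x} std_normal_density"
    by (simp add: set_lebesgue_integral_def mult.commute)
  also have "\<dots> = integral {c..x} std_normal_density"
    using * by (intro set_borel_integral_eq_integral)
  finally show ?thesis
    unfolding Phi_def using S.cdf_diff_eq[OF \<open>c < x\<close>] by simp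
qed simp

lemma continuous_on_std_normal_density [continuous_intros]:
  "continuous_on S f \<Longrightarrow> continuous_on S (\<lambda>x. std_normal_density (f x))"
  unfolding normal_density_def by (intro continuous_intros) auto

lemma DERIV_Phi: "(Phi has_real_derivative std_normal_density x) (at x)"
proof -
  have "((\<lambda>y. Phi (x - 1) + integral {x-1..y} std_normal_density) has_real_derivative 0 + std_normal_density x)
      (at x within {x-1..x+1})"
    by (intro DERIV_add DERIV_const integral_has_real_derivative continuous_intros) auto
  from this[unfolded add_0_left] have "(Phi has_real_derivative std_normal_density x) (at x within {x-1..x+1})"
    by (rule has_field_derivative_transform_within[where d=1])
       (auto simp flip: Phi_diff)
  then show ?thesis by (simp add: at_within_Icc_at)
qed

lemmas DERIV_Phi_chain [derivative_intros] = DERIV_Phi[THEN DERIV_chain2]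

lemma isCont_Phi: "isCont Phi x"
  using DERIV_Phi by (rule DERIV_isCont)

lemma continuous_on_Phi [continuous_intros]:
  "continuous_on S f \<Longrightarrow> continuous_on S (\<lambda>x. Phi (f x))"
  using continuous_on_compose2[of UNIV Phi S f] isCont_Phi by (auto simp: continuous_on_eq_continuous_at)

lemma measurable_Phi [measurable]: "Phi \<in> borel_measurable borel"
  by (intro borel_measurable_continuous_onI continuous_intros)

lemma Phi_strict_mono: "x < y \<Longrightarrow> Phi x < Phi y"
  by (rule DERIV_pos_imp_increasing) (use DERIV_Phi normal_density_pos[of 1] in auto)

lemma Phi_mono: "x \<le> y \<Longrightarrow> Phi x \<le> Phi y"
  using Phi_strict_mono[of x y] by (cases "x = y") auto

lemma Phi_bounds: "0 \<le> Phi x" "Phi x \<le> 1"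
proof -
  interpret S: real_distribution std_normal_distribution by (rule real_dist_normal_dist)
  show "0 \<le> Phi x" "Phi x \<le> 1" unfolding Phi_def by (auto intro: S.cdf_bounded_prob S.cdf_nonneg)
qed

lemma measure_std_normal_singleton: "measure std_normal_distribution {x} = 0"
proof -
  interpret S: real_distribution std_normal_distribution by (rule real_dist_normal_dist)
  show ?thesis using isCont_Phi[of x] unfolding Phi_def S.isCont_cdf .
qed

lemma std_normal_distribution_uminus: "distr std_normal_distribution borel uminus = std_normal_distribution"
proof (rule measure_eqI)
  fix A :: "real set" assume "A \<in> sets (distr std_normal_distribution borel uminus)"
  then have [measurable]: "A \<in> sets borel" by simp
  have [measurable]: "uminus -` A \<in> sets borel"
    using measurable_sets[of uminus borel borel A] by simp
  have [simp]: "std_normal_density (- x) = std_normal_density x" for x by (simp add: normal_density_def)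
  have "emeasure (distr std_normal_distribution borel uminus) A = (\<integral>\<^sup>+x. std_normal_density x * indicator A (- x) \<partial>lborel)"
    by (subst emeasure_distr) (auto simp: emeasure_density indicator_def intro!: nn_integral_cong)
  also have "\<dots> = (\<integral>\<^sup>+x. std_normal_density x * indicator A x \<partial>lborel)"
    by (subst nn_integral_real_affine[where c="-1" and t=0]) auto
  also have "\<dots> = emeasure std_normal_distribution A"
    by (subst emeasure_density) (auto simp: ennreal_mult ennreal_indicator)
  finally show "emeasure (distr std_normal_distribution borel uminus) A = emeasure std_normal_distribution A" .
qed auto

lemma Phi_uminus: "Phi (- x) = 1 - Phi x"
proof -
  interpret S: real_distribution std_normal_distribution by (rule real_dist_normal_dist)
  have "Phi (- x) = measure (distr std_normal_distribution borel uminus) {..- x}"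
    unfolding Phi_def cdf_def2 std_normal_distribution_uminus ..
  also have "\<dots> = measure std_normal_distribution {x..}"
    by (subst measure_distr) (auto intro!: arg_cong[where f="measure _"])
  also have "{x..} = UNIV - {..x} \<union> {x}" by auto
  also have "measure std_normal_distribution \<dots> = measure std_normal_distribution (UNIV - {..x})"
    using S.finite_measure_Union[of "UNIV - {..x}" "{x}"] measure_std_normal_singleton by auto
  also have "\<dots> = 1 - Phi x"
    unfolding Phi_def cdf_def2 using S.prob_compl[of "{..x}"] by auto
  finally show ?thesis .
qed

text \<open>As \<open>zq\<close> is \<open>inv Phi\<close>, a preimage of \<open>u\<close> is all
  that is required; the limits at both ends and the intermediate value theorem supply it.\<close>

lemma Phi_zq:
  assumes "0 < u" "u < 1"
  shows "Phi (zq u) = u"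
proof -
  interpret S: real_distribution std_normal_distribution by (rule real_dist_normal_dist)
  have "\<forall>\<^sub>F x in at_top. u < Phi x"
    using S.cdf_lim_at_top_prob assms unfolding Phi_def by (intro order_tendstoD)
  then obtain b where b: "u < Phi b" by (auto simp: eventually_at_top_linorder)
  have "\<forall>\<^sub>F x in at_bot. Phi x < u"
    using S.cdf_lim_at_bot assms unfolding Phi_def by (intro order_tendstoD)
  then obtain c where c: "Phi c < u" by (auto simp: eventually_at_bot_linorder)
  have "c \<le> b" using b c Phi_mono[of b c] by linarith
  then obtain x where "Phi x = u"
    using IVT[of Phi c u b] b c isCont_Phi by auto
  then show ?thesis unfolding zq_def by (metis f_inv_into_f rangeI)
qed

lemma zq_half_neg:
  assumes "0 < t" "t < 1"
  shows "zq (t / 2) < 0"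
proof (rule ccontr)
  assume "\<not> ?thesis"
  then have "Phi 0 \<le> Phi (zq (t/2))" by (intro Phi_mono) simp
  moreover have "Phi 0 = 1/2" using Phi_uminus[of 0] by simp
  ultimately show False using assms Phi_zq[of "t/2"] by simp
qed

text \<open>As an affine image of the standard normal law, the point mass at \<open>v = 0\<close> is
  an ordinary case (the map is constant), so the characteristic function and the moments below need
  no case distinction for singular covariances.\<close>

lemma normal_rv_distr:
  assumes "prob_space M" "normal_rv M X m v"
  shows "v \<ge> 0" "distr M borel X = distr std_normal_distribution borel (\<lambda>x. m + sqrt v * x)"
proof -
  interpret prob_space M by fact
  show v: "v \<ge> 0" using assms(2) by (auto simp: normal_rv_def split: if_splits)
  have [measurable]: "X \<in> borel_measurable M" using assms(2) by (simp add: normal_rv_def)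
  interpret S: prob_space std_normal_distribution by (rule prob_space_normal_density) simp
  show "distr M borel X = distr std_normal_distribution borel (\<lambda>x. m + sqrt v * x)"
  proof (cases "v = 0")
    case True
    then have "AE \<omega> in M. X \<omega> = m" using assms(2) by (simp add: normal_rv_def)
    then have "distr M borel X = distr M borel (\<lambda>_. m)"
      by (intro distr_cong_AE) auto
    also have "\<dots> = distr std_normal_distribution borel (\<lambda>_. m)"
      by (rule measure_eqI) (auto simp: emeasure_distr indicator_def S.emeasure_space_1 emeasure_space_1)
    finally show ?thesis using True by simp
  next
    case False
    then have v: "v > 0" and "distributed M lborel X (normal_density m (sqrt v))"
      using assms(2) by (auto simp: normal_rv_def)
    then have d: "distributed M lborel (\<lambda>x. (X x - m) / sqrt v) std_normal_density"
      using normal_standard_normal_convert[of "sqrt v" X m] by simp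
    have "distr M borel (\<lambda>x. (X x - m) / sqrt v) = std_normal_distribution"
      using distributed_distr_eq_density[OF d] distr_cong[of M M borel lborel] by (metis sets_lborel)
    then have "distr std_normal_distribution borel (\<lambda>x. m + sqrt v * x)
        = distr (distr M borel (\<lambda>x. (X x - m) / sqrt v)) borel (\<lambda>x. m + sqrt v * x)" by simp
    also have "\<dots> = distr M borel X"
      using v by (subst distr_distr) (auto simp: o_def)
    finally show ?thesis ..
  qed
qed

lemma normal_rv_measurable: "normal_rv M X m v \<Longrightarrow> X \<in> borel_measurable M"
  by (simp add: normal_rv_def)

text \<open>The free phase \<theta> carries both parts of the characteristic function in one real
  identity, the form in which \<open>cos_law_unique\<close> takes its hypothesis.\<close>

lemma normal_rv_cos:
  assumes "prob_space M" "normal_rv M X m v"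
  shows "(\<integral>\<omega>. cos (X \<omega> + \<theta>) \<partial>M) = exp (- v / 2) * cos (m + \<theta>)"
proof -
  interpret S: prob_space std_normal_distribution by (rule prob_space_normal_density) simp
  note [measurable] = normal_rv_measurable[OF assms(2)]
  have v: "v \<ge> 0" using normal_rv_distr[OF assms] by simp
  have i: "integrable std_normal_distribution (\<lambda>x. exp (\<i> * complex_of_real (sqrt v * x)))"
    by (rule S.integrable_iexp) auto
  have "(\<integral>\<omega>. cos (X \<omega> + \<theta>) \<partial>M) = (\<integral>x. cos (x + \<theta>) \<partial>distr M borel X)"
    by (subst integral_distr) auto
  also have "\<dots> = (\<integral>x. cos (m + sqrt v * x + \<theta>) \<partial>std_normal_distribution)"
    unfolding normal_rv_distr[OF assms] by (subst integral_distr) auto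
  also have "\<dots> = (\<integral>x. Re (cis (m + \<theta>) * exp (\<i> * complex_of_real (sqrt v * x))) \<partial>std_normal_distribution)"
    by (intro Bochner_Integration.integral_cong) (auto simp: Re_exp Im_exp cos_add sin_add algebra_simps)
  also have "\<dots> = Re (cis (m + \<theta>) * char std_normal_distribution (sqrt v))"
    using i unfolding char_def by (subst integral_Re) auto
  also have "\<dots> = exp (- v / 2) * cos (m + \<theta>)"
    using v by (simp add: char_std_normal_distribution)
  finally show ?thesis .
qed

lemma normal_rv_cdf:
  assumes "prob_space M" "normal_rv M X m v" "v > 0"
  shows "measure M {\<omega>\<in>space M. X \<omega> \<le> x} = Phi ((x - m) / sqrt v)"
    and "measure M {\<omega>\<in>space M. X \<omega> < x} = Phi ((x - m) / sqrt v)"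
proof -
  interpret S: real_distribution std_normal_distribution by (rule real_dist_normal_dist)
  note [measurable] = normal_rv_measurable[OF assms(2)]
  have *: "measure M {\<omega>\<in>space M. X \<omega> \<in> A} = measure std_normal_distribution {x. m + sqrt v * x \<in> A}"
    if [measurable]: "A \<in> sets borel" for A
  proof -
    have "measure M {\<omega>\<in>space M. X \<omega> \<in> A} = measure (distr M borel X) A"
      by (subst measure_distr) (auto intro!: arg_cong[where f="measure M"])
    also have "\<dots> = measure std_normal_distribution {x. m + sqrt v * x \<in> A}"
      unfolding normal_rv_distr[OF assms(1,2)]
      by (subst measure_distr) (auto intro!: arg_cong[where f="measure _"])
    finally show ?thesis .
  qed
  have le: "{y. m + sqrt v * y \<in> {..x}} = {..(x - m) / sqrt v}"
    using assms(3) by (auto simp: field_simps)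
  have less: "{y. m + sqrt v * y \<in> {..<x}} = {..(x - m) / sqrt v} - {(x - m) / sqrt v}"
    using assms(3) by (auto simp: field_simps)
  show "measure M {\<omega>\<in>space M. X \<omega> \<le> x} = Phi ((x - m) / sqrt v)"
    using *[of "{..x}"] unfolding le Phi_def cdf_def2 by simp
  show "measure M {\<omega>\<in>space M. X \<omega> < x} = Phi ((x - m) / sqrt v)"
    using *[of "{..<x}"] S.finite_measure_Diff[of "{..(x - m) / sqrt v}" "{(x - m) / sqrt v}"]
    unfolding less Phi_def cdf_def2 by (simp add: measure_std_normal_singleton)
qed

lemma normal_rv_even_moment:
  assumes "prob_space M" "normal_rv M X 0 v"
  shows "(\<integral>\<^sup>+\<omega>. ennreal (X \<omega> ^ (2 * k)) \<partial>M) = ennreal (fact (2 * k) / (2 ^ k * fact k) * v ^ k)"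
proof -
  note [measurable] = normal_rv_measurable[OF assms(2)]
  have v: "v \<ge> 0" using normal_rv_distr[OF assms] by simp
  have "(\<integral>\<^sup>+\<omega>. ennreal (X \<omega> ^ (2 * k)) \<partial>M) = (\<integral>\<^sup>+x. ennreal (x ^ (2 * k)) \<partial>distr M borel X)"
    by (subst nn_integral_distr) auto
  also have "\<dots> = (\<integral>\<^sup>+x. ennreal ((sqrt v * x) ^ (2 * k)) \<partial>std_normal_distribution)"
    unfolding normal_rv_distr[OF assms] by (subst nn_integral_distr) auto
  also have "\<dots> = (\<integral>\<^sup>+x. ennreal (v ^ k * x ^ (2 * k)) \<partial>std_normal_distribution)"
    using v by (simp add: power_mult_distrib power_mult)
  also have "\<dots> = ennreal (\<integral>x. v ^ k * x ^ (2 * k) \<partial>std_normal_distribution)"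
    using std_normal_distribution_even_moments(2)[of k] v by (intro nn_integral_eq_integral) auto
  also have "\<dots> = ennreal (fact (2 * k) / (2 ^ k * fact k) * v ^ k)"
    by (simp only: integral_mult_right_zero std_normal_distribution_even_moments(1)) (simp add: mult.commute)
  finally show ?thesis .
qed

section \<open>Mean of a single test\<close>

lemma zq_half_cutoff:
  assumes "0 < t" "t < 1"
  shows "\<bar>zq (t / 2)\<bar> > 0" "zq (t / 2) = - \<bar>zq (t / 2)\<bar>" "Phi (- \<bar>zq (t / 2)\<bar>) = t / 2"
  using zq_half_neg[OF assms] Phi_zq[of "t / 2"] assms by auto

lemma measurable_test [measurable]: "test t \<in> borel_measurable borel"
  unfolding test_def by measurable

lemma test_bounds: "0 \<le> test t x" "test t x \<le> 1" "(test t x)\<^sup>2 = test t x"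
  by (auto simp: test_def)

lemma expectation_test:
  assumes "0 < t" "t < 1" "prob_space M" "normal_rv M X m 1"
  shows "(\<integral>\<omega>. test t (X \<omega>) \<partial>M) = xi t m"
proof -
  interpret prob_space M by fact
  let ?a = "\<bar>zq (t / 2)\<bar>"
  note a = zq_half_cutoff[OF assms(1,2)]
  note [measurable] = normal_rv_measurable[OF assms(4)]
  have "(\<integral>\<omega>. test t (X \<omega>) \<partial>M) = (\<integral>\<omega>. indicator {\<omega>\<in>space M. X \<omega> < - ?a} \<omega> + (1 - indicator {\<omega>\<in>space M. X \<omega> \<le> ?a} \<omega>) \<partial>M)"
    using a(1) by (intro Bochner_Integration.integral_cong) (auto simp: test_def indicator_def)
  also have "\<dots> = measure M {\<omega>\<in>space M. X \<omega> < - ?a} + (1 - measure M {\<omega>\<in>space M. X \<omega> \<le> ?a})"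
    by (subst Bochner_Integration.integral_add Bochner_Integration.integral_diff; (simp add: prob_space Int_absorb2 integrable_indicator_iff emeasure_eq_measure)?)+
  also have "\<dots> = Phi (- ?a - m) + Phi (- (?a - m))"
    using normal_rv_cdf[OF assms(3,4), of "- ?a"] normal_rv_cdf[OF assms(3,4), of ?a] by (simp flip: Phi_uminus)
  also have "\<dots> = xi t m"
    unfolding xi_def by (subst (1 2) a(2)) (simp add: algebra_simps)
  finally show ?thesis .
qed

lemma xi_zero: "0 < t \<Longrightarrow> t < 1 \<Longrightarrow> xi t 0 = t"
  using Phi_zq[of "t / 2"] by (simp add: xi_def)

text \<open>One of \<open>m\<close> and \<open>- m\<close> is nonnegative, so one tail alone keeps
  at least its null mass \<open>t / 2\<close>. This holds the mean of \<open>Rbar\<close> away from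
  zero for all signal strengths.\<close>

lemma xi_lower:
  assumes "0 < t" "t < 1"
  shows "t / 2 \<le> xi t m"
proof -
  have "Phi (zq (t / 2)) \<le> Phi (zq (t / 2) + m) \<or> Phi (zq (t / 2)) \<le> Phi (zq (t / 2) - m)"
    using Phi_mono[of "zq (t / 2)" "zq (t / 2) + m"] Phi_mono[of "zq (t / 2)" "zq (t / 2) - m"] by linarith
  then show ?thesis
    unfolding xi_def using Phi_zq[of "t / 2"] assms Phi_bounds(1) by (smt (verit) field_sum_of_halves)
qed

section \<open>The function H\<close>

lemma abs_mult_std_normal_density_le: "\<bar>std_normal_density x * x\<bar> \<le> 1"
proof -
  have "0 \<le> (\<bar>x\<bar> - 1)\<^sup>2" by simp
  then have "\<bar>x\<bar> \<le> 1 + x\<^sup>2 / 2" unfolding power2_diff by simp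
  also have "\<dots> \<le> exp (x\<^sup>2 / 2)" by (rule exp_ge_add_one_self)
  finally have "exp (- x\<^sup>2 / 2) * \<bar>x\<bar> \<le> 1" by (simp add: exp_minus field_simps)
  moreover have "1 / sqrt (2 * pi) \<le> 1"
    using pi_ge_two by (simp add: real_le_rsqrt)
  ultimately have "1 / sqrt (2 * pi) * (exp (- x\<^sup>2 / 2) * \<bar>x\<bar>) \<le> 1 * 1"
    by (intro mult_mono) auto
  then show ?thesis by (simp add: std_normal_density_def abs_mult mult.assoc)
qed

lemma std_normal_density_uminus: "std_normal_density (- x) = std_normal_density x"
  by (simp add: std_normal_density_def)

lemma H_bound: "\<bar>H t m\<bar> \<le> 2"
  unfolding H_def Let_def
  using abs_mult_std_normal_density_le[of "\<bar>zq (t / 2)\<bar> + m"] abs_mult_std_normal_density_le[of "\<bar>zq (t / 2)\<bar> - m"]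
  by linarith

lemma H_uminus: "H t (- m) = H t m"
  by (simp add: H_def Let_def add.commute)

text \<open>The factor in front is positive beyond the cutoff, so the sign of \<open>H\<close> is
  that of the bracket. There \<open>exp (- 2 * a * m)\<close> and \<open>1 + 2 * a / (m - a)\<close>
  both decrease in \<open>m\<close> when \<open>a > 0\<close>, which is the source of the single
  sign change.\<close>

lemma H_factor:
  fixes t m :: real
  defines "a \<equiv> \<bar>zq (t / 2)\<bar>"
  assumes "m > a"
  shows "H t m = std_normal_density (m - a) * (m - a) * (exp (- 2 * a * m) * (1 + 2 * a / (m - a)) - 1)"
proof -
  have "std_normal_density (a + m) = std_normal_density (m - a) * exp (- 2 * a * m)"
    by (simp add: std_normal_density_def flip: exp_add) (simp add: power2_eq_square field_simps)
  moreover have "std_normal_density (a - m) = std_normal_density (m - a)"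
    using std_normal_density_uminus[of "m - a"] by simp
  moreover have "(m - a) * (1 + 2 * a / (m - a)) = a + m" using assms(2) by (simp add: field_simps)
  ultimately have "H t m = std_normal_density (m - a)
      * (exp (- 2 * a * m) * ((m - a) * (1 + 2 * a / (m - a))) - (m - a))"
    unfolding H_def Let_def a_def[symmetric] by (simp only:) (simp add: algebra_simps)
  then show ?thesis by (simp add: algebra_simps)
qed

lemma H_sign:
  fixes t m m' :: real
  assumes t: "0 < t" "t < 1" and m: "\<bar>zq (t / 2)\<bar> < m" "m < m'" and "H t m \<le> 0"
  shows "H t m' < 0"
proof -
  define a where "a = \<bar>zq (t / 2)\<bar>"
  have a: "a > 0" using zq_half_cutoff[OF t] by (simp add: a_def)
  have pos: "std_normal_density (x - a) * (x - a) > 0" if "x > a" for x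
    using that normal_density_pos[of 1] by simp
  have "exp (- 2 * a * m') * (1 + 2 * a / (m' - a)) < exp (- 2 * a * m) * (1 + 2 * a / (m - a))"
    using a m by (intro mult_strict_mono) (auto simp: a_def frac_less2 add_pos_pos intro!: add_nonneg_nonneg divide_strict_left_mono)
  moreover have "exp (- 2 * a * m) * (1 + 2 * a / (m - a)) - 1 \<le> 0"
    using \<open>H t m \<le> 0\<close> H_factor[of t m] mult_le_cancel_left_pos[OF pos[of m], of _ 0] m unfolding a_def[symmetric] by simp
  ultimately show ?thesis
    using H_factor[of t m'] mult_less_cancel_left_pos[OF pos[of m'], of _ 0] m unfolding a_def[symmetric] by simp
qed

lemma H_continuous: "continuous_on S (H t)"
  unfolding H_def Let_def by (intro continuous_intros)

lemma mu_root:
  assumes t: "0 < t" "t < 1"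
  shows "\<bar>zq (t / 2)\<bar> < mu_root t" "H t (mu_root t) = 0"
proof -
  define a where "a = \<bar>zq (t / 2)\<bar>"
  have a: "a > 0" using zq_half_cutoff[OF t] by (simp add: a_def)
  have Ha: "H t a > 0"
    using a normal_density_pos[of 1 0 "a + a"] by (simp add: H_def Let_def flip: a_def)
  \<comment> \<open>At \<open>m = a + 1\<close> the bracket of \<open>H_factor\<close> is
    \<open>exp (- 2 * a * (a + 1)) * (1 + 2 * a) - 1\<close>. Its negativity is why the root lies
    within distance 1 of the cutoff.\<close>
  have "1 + 2 * a < 1 + 2 * a * (a + 1)" using a by simp
  also have "\<dots> \<le> exp (2 * a * (a + 1))" by (rule exp_ge_add_one_self)
  finally have "exp (- (2 * a * (a + 1))) * (1 + 2 * a) < exp (- (2 * a * (a + 1))) * exp (2 * a * (a + 1))"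
    by (intro mult_strict_left_mono) auto
  then have "exp (- 2 * a * (a + 1)) * (1 + 2 * a) < 1"
    by (simp flip: exp_add)
  then have H1: "H t (a + 1) < 0"
    using H_factor[of t "a + 1"] normal_density_pos[of 1 0 1] unfolding a_def[symmetric]
    by (simp add: mult_less_0_iff)
  obtain m where m: "a \<le> m" "m \<le> a + 1" "H t m = 0"
    using IVT2'[of "H t" "a + 1" 0 a] Ha H1 H_continuous by auto
  have "m \<noteq> a" "m \<noteq> a + 1" using m Ha H1 by auto
  with m have m': "m \<in> {a<..<a+1} \<and> H t m = 0" by auto
  have "\<exists>!m. m \<in> {a<..<a+1} \<and> H t m = 0"
  proof (rule ex1I[of _ m], rule m')
    fix x assume "x \<in> {a<..<a+1} \<and> H t x = 0"
    then show "x = m"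
      using H_sign[OF t, of x m] H_sign[OF t, of m x] m' unfolding a_def by (cases x m rule: linorder_cases) auto
  qed
  from theI'[OF this] show "\<bar>zq (t / 2)\<bar> < mu_root t" "H t (mu_root t) = 0"
    unfolding mu_root_def a_def[symmetric] by auto
qed

text \<open>Past its root \<open>H\<close> stays negative, and it is even. To leading order a
  nonnull test with a large mean is therefore never positively correlated with a null test, and such
  pairs can only increase the variance of the linear part.\<close>

lemma H_outside:
  assumes t: "0 < t" "t < 1" and "m \<notin> {- mu_root t..mu_root t}"
  shows "H t m \<le> 0"
proof -
  have "mu_root t < \<bar>m\<bar>" using assms(3) by auto
  then have "H t \<bar>m\<bar> < 0" using H_sign[OF t mu_root(1)[OF t]] mu_root(2)[OF t] by simp
  then show ?thesis using H_uminus[of t m] by (auto simp: abs_if split: if_splits)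
qed

lemma H_inside:
  assumes t: "0 < t" "t < 1" and "m \<in> {- mu_root t..mu_root t}"
  shows "H t m \<le> C_max t" "0 \<le> C_max t"
proof -
  have bdd: "bdd_above (H t ` {- mu_root t<..<mu_root t})"
    using H_bound by (intro bdd_aboveI2[of _ _ 2]) (metis abs_le_D1)
  have pos: "0 < \<bar>zq (t / 2)\<bar>" using zq_half_cutoff[OF t] by simp
  then have "0 \<in> {- mu_root t<..<mu_root t}" using mu_root(1)[OF t] by auto
  then have "H t 0 \<le> C_max t" unfolding C_max_def by (rule cSUP_upper[OF _ bdd])
  moreover have "0 \<le> H t 0" by (simp add: H_def Let_def)
  ultimately show C0: "0 \<le> C_max t" by simp
  show "H t m \<le> C_max t"
  proof (cases "m \<in> {- mu_root t<..<mu_root t}")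
    case True
    then show ?thesis unfolding C_max_def by (rule cSUP_upper[OF _ bdd])
  next
    case False
    \<comment> \<open>The supremum runs over the open interval, the cross-covariance condition over
      the closed one. The endpoints fit because \<open>H\<close> vanishes there and
      \<open>C_max t\<close> is nonnegative.\<close>
    then have "m = mu_root t \<or> m = - mu_root t" using assms(3) by auto
    then show ?thesis using C0 mu_root(2)[OF t] H_uminus by auto
  qed
qed

section \<open>Linearisation of the Plackett kernel in the correlation\<close>

lemma exp_odd_part_bound: "\<bar>exp y - exp (- y) - 2 * y\<bar> \<le> \<bar>y\<bar> ^ 3 * exp \<bar>y\<bar>" for y :: real
proof -
  have *: "\<bar>exp x - (1 + x + x\<^sup>2 / 2)\<bar> \<le> exp \<bar>x\<bar> * \<bar>x\<bar> ^ 3 / 2" for x :: real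
  proof -
    have "exp (complex_of_real x) - (\<Sum>i\<le>2. complex_of_real x ^ i / fact i) = complex_of_real (exp x - (1 + x + x\<^sup>2 / 2))"
      by (simp add: numeral_eq_Suc exp_of_real)
    then show ?thesis using Taylor_exp[of "complex_of_real x" 2]
      by (simp only: norm_of_real) (simp add: numeral_eq_Suc)
  qed
  have "\<bar>p - q - 2 * y\<bar> \<le> B" if "\<bar>p - (1 + y + s)\<bar> \<le> B / 2" "\<bar>q - (1 + - y + s)\<bar> \<le> B / 2" for p q s B :: real
    using that by linarith
  from this[OF *[of y], of "exp (- y)"] *[of "- y"] show ?thesis by (simp add: mult.commute)
qed

text \<open>The kernel is odd in \<sigma>, so its linear term is accurate to third order;
  integration makes this the fourth order error of the covariance. Uniformity in \<open>b\<close> is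
  essential, since \<open>b = a - m\<close> and \<open>b = - a - m\<close> range over the whole line
  with the mean \<open>m\<close>: the factor \<open>exp (- b\<^sup>2 / 2)\<close> pays for the
  powers of \<open>b\<close>, and \<open>\<bar>\<sigma>\<bar> \<le> 1 / 2\<close> keeps
  \<open>1 / \<kappa>\<close> bounded.\<close>

lemma Plackett_kernel_bound:
  fixes a b \<sigma> :: real
  assumes a: "a \<ge> 0" and \<sigma>: "\<bar>\<sigma>\<bar> \<le> 1 / 2"
  defines "\<kappa> \<equiv> sqrt (1 - \<sigma>\<^sup>2)"
  shows "\<bar>std_normal_density b / \<kappa> * (std_normal_density ((a - \<sigma> * b) / \<kappa>) - std_normal_density ((a + \<sigma> * b) / \<kappa>))
      - 2 * \<sigma> * a * b * std_normal_density a * std_normal_density b\<bar> \<le> (28 * a ^ 3 + 22 * a) * \<bar>\<sigma>\<bar> ^ 3"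
proof -
  have s2: "\<sigma>\<^sup>2 \<le> 1 / 4" using \<sigma> abs_le_square_iff[of \<sigma> "1/2"] by (simp add: power2_eq_square)
  define w where "w = 1 / \<kappa>"
  have kpos: "\<kappa> > 0" and k2: "\<kappa>\<^sup>2 = 1 - \<sigma>\<^sup>2" using s2 by (auto simp: \<kappa>_def)
  have w2: "w\<^sup>2 = 1 / (1 - \<sigma>\<^sup>2)" by (simp add: w_def power_divide k2)
  have w0: "w > 0" using kpos by (simp add: w_def)
  have w2_bounds: "1 \<le> w\<^sup>2" "w\<^sup>2 \<le> 4 / 3" and w21: "w\<^sup>2 - 1 = \<sigma>\<^sup>2 * w\<^sup>2"
    using s2 by (auto simp: w2 field_simps)
  have w1: "1 \<le> w" using w2_bounds(1) w0 by (simp add: power2_eq_square) (smt (verit) mult_le_one mult_less_cancel_left2 mult_strict_mono)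
  have wle: "w \<le> w\<^sup>2" using w1 by (simp add: power2_eq_square)
  \<comment> \<open>The cube is the power that occurs in \<open>P * (2 * y)\<close>: one factor
    \<open>w\<close> stems from \<open>1 / \<kappa>\<close>, two from \<open>y\<close>.\<close>
  have w3: "w ^ 3 - 1 \<le> 4 * \<sigma>\<^sup>2"
  proof -
    have "w ^ 3 \<le> w ^ 4" using w1 by (intro power_increasing) auto
    moreover have "w ^ 4 - 1 = (w\<^sup>2 - 1) * (w\<^sup>2 + 1)" by (simp add: algebra_simps power2_eq_square numeral_eq_Suc)
    moreover have "(w\<^sup>2 - 1) * (w\<^sup>2 + 1) \<le> (\<sigma>\<^sup>2 * (4/3)) * (7/3)"
      using w2_bounds unfolding w21 by (intro mult_mono) auto
    ultimately show ?thesis using zero_le_power2[of \<sigma>] by linarith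
  qed
  \<comment> \<open>The exponents of the two conditional densities are \<open>- A + y\<close> and
    \<open>- A - y\<close>, so the kernel is a multiple of \<open>exp y - exp (- y)\<close>, whose
    even Taylor terms cancel.\<close>
  define A where "A = (a\<^sup>2 + \<sigma>\<^sup>2 * b\<^sup>2) * w\<^sup>2 / 2"
  define y where "y = \<sigma> * a * b * w\<^sup>2"
  define c where "c = 1 / (2 * pi)"
  have c: "0 < c" "c \<le> 1" using pi_ge_two by (auto simp: c_def field_simps)
  define P where "P = w * exp (- A)"
  have P0: "P > 0" using w0 by (simp add: P_def)
  have cc: "1 / sqrt (2 * pi) * (1 / sqrt (2 * pi)) = c" by (simp add: c_def)
  have e1: "std_normal_density b / \<kappa> * (std_normal_density ((a - \<sigma> * b) / \<kappa>) - std_normal_density ((a + \<sigma> * b) / \<kappa>))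
      = c * exp (- b\<^sup>2 / 2) * (P * (exp y - exp (- y)))"
  proof -
    have "- ((a - \<sigma> * b) / \<kappa>)\<^sup>2 / 2 = - A + y" "- ((a + \<sigma> * b) / \<kappa>)\<^sup>2 / 2 = - A + - y"
      using kpos unfolding A_def y_def w_def by (simp_all add: power_divide power2_diff power2_sum power_mult_distrib add_divide_distrib diff_divide_distrib)
        (simp_all add: power2_eq_square mult_ac)
    then have "exp (- ((a - \<sigma> * b) / \<kappa>)\<^sup>2 / 2) = exp (- A) * exp y"
      "exp (- ((a + \<sigma> * b) / \<kappa>)\<^sup>2 / 2) = exp (- A) * exp (- y)"
      by (simp_all only: exp_add)
    then show ?thesis
      unfolding std_normal_density_def cc[symmetric] P_def w_def by (simp only:) (simp add: algebra_simps)
  qed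
  have e2: "2 * \<sigma> * a * b * std_normal_density a * std_normal_density b
      = c * exp (- b\<^sup>2 / 2) * (2 * \<sigma> * a * b * exp (- a\<^sup>2 / 2))"
    unfolding std_normal_density_def cc[symmetric] by (simp add: mult_ac)
  \<comment> \<open>Completing the square, \<open>- A + \<bar>y\<bar> = - ((a - \<bar>\<sigma> *
    b\<bar>)\<^sup>2 * w\<^sup>2 / 2)\<close>. So \<open>exp (- A)\<close> absorbs the growing
    factor of the Taylor remainder, however large \<open>b\<close> is.\<close>
  have PE: "P * exp \<bar>y\<bar> \<le> 2"
  proof -
    have "- A + \<bar>y\<bar> = - ((a - \<bar>\<sigma> * b\<bar>)\<^sup>2 * w\<^sup>2 / 2)"
      using a unfolding A_def y_def by (simp add: abs_mult power2_diff power_mult_distrib) (simp add: field_simps)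
    then have "- A + \<bar>y\<bar> \<le> 0" by simp
    then have "exp (- A + \<bar>y\<bar>) \<le> 1" by simp
    then have "w * exp (- A + \<bar>y\<bar>) \<le> w * 1" using w0 by (intro mult_left_mono) auto
    also have "\<dots> \<le> 2" using wle w2_bounds by linarith
    finally show ?thesis unfolding P_def exp_add by (simp add: mult_ac)
  qed
  have y3: "\<bar>y\<bar> ^ 3 \<le> 5 / 2 * (\<bar>\<sigma>\<bar> ^ 3 * a ^ 3 * \<bar>b\<bar> ^ 3)"
  proof -
    have "\<bar>y\<bar> ^ 3 = (\<bar>\<sigma>\<bar> ^ 3 * a ^ 3 * \<bar>b\<bar> ^ 3) * (w\<^sup>2) ^ 3"
      using a by (simp add: y_def abs_mult power_mult_distrib)
    also have "\<dots> \<le> (\<bar>\<sigma>\<bar> ^ 3 * a ^ 3 * \<bar>b\<bar> ^ 3) * (4 / 3) ^ 3"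
      using w2_bounds a by (intro mult_left_mono power_mono) auto
    also have "\<dots> \<le> (\<bar>\<sigma>\<bar> ^ 3 * a ^ 3 * \<bar>b\<bar> ^ 3) * (5 / 2)"
      using a by (intro mult_left_mono) (auto simp: power3_eq_cube)
    finally show ?thesis by simp
  qed
  have T1: "\<bar>P * (exp y - exp (- y)) - P * (2 * y)\<bar> \<le> 5 * (\<bar>\<sigma>\<bar> ^ 3 * a ^ 3 * \<bar>b\<bar> ^ 3)"
  proof -
    have "\<bar>P * (exp y - exp (- y)) - P * (2 * y)\<bar> = P * \<bar>exp y - exp (- y) - 2 * y\<bar>"
      using P0 by (simp add: abs_mult flip: right_diff_distrib)
    also have "\<dots> \<le> P * (\<bar>y\<bar> ^ 3 * exp \<bar>y\<bar>)"
      using P0 exp_odd_part_bound by (intro mult_left_mono) auto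
    also have "\<dots> = (P * exp \<bar>y\<bar>) * \<bar>y\<bar> ^ 3" by simp
    also have "\<dots> \<le> 2 * (5 / 2 * (\<bar>\<sigma>\<bar> ^ 3 * a ^ 3 * \<bar>b\<bar> ^ 3))"
      using PE y3 by (intro mult_mono) auto
    finally show ?thesis by (simp add: mult_ac)
  qed
  have AA: "A - a\<^sup>2 / 2 = \<sigma>\<^sup>2 * (a\<^sup>2 + b\<^sup>2) * w\<^sup>2 / 2"
  proof -
    have "A - a\<^sup>2 / 2 = (a\<^sup>2 * (w\<^sup>2 - 1) + \<sigma>\<^sup>2 * b\<^sup>2 * w\<^sup>2) / 2" by (simp add: A_def algebra_simps)
    then show ?thesis unfolding w21 by (simp add: algebra_simps)
  qed
  have AA0: "0 \<le> A - a\<^sup>2 / 2" unfolding AA by simp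
  have AA1: "A - a\<^sup>2 / 2 \<le> \<sigma>\<^sup>2 * (a\<^sup>2 + b\<^sup>2)"
  proof -
    have X: "0 \<le> \<sigma>\<^sup>2 * (a\<^sup>2 + b\<^sup>2)" by simp
    show ?thesis using mult_left_mono[OF w2_bounds(2) X] X unfolding AA by linarith
  qed
  \<comment> \<open>The linear term appears with \<open>w ^ 3 * exp (- A)\<close> in place of
    \<open>exp (- a\<^sup>2 / 2)\<close>. Both \<open>w ^ 3 - 1\<close> and
    \<open>A - a\<^sup>2 / 2\<close> are of order \<open>\<sigma>\<^sup>2\<close>, and the prefactor
    contributes the third power.\<close>
  have E: "\<bar>w ^ 3 * exp (- A) - exp (- a\<^sup>2 / 2)\<bar> \<le> \<sigma>\<^sup>2 * (4 + a\<^sup>2 + b\<^sup>2)"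
  proof -
    have "0 \<le> A" unfolding A_def by simp
    then have "exp (- A) \<le> 1" by simp
    moreover have w31: "1 \<le> w ^ 3" using w1 by simp
    ultimately have q1: "(w ^ 3 - 1) * exp (- A) \<le> w ^ 3 - 1" "0 \<le> (w ^ 3 - 1) * exp (- A)"
      by (auto simp: mult_left_le)
    have "1 - exp (- (A - a\<^sup>2 / 2)) \<le> A - a\<^sup>2 / 2"
      using exp_ge_add_one_self[of "- (A - a\<^sup>2 / 2)"] by linarith
    then have "exp (- a\<^sup>2 / 2) * (1 - exp (- (A - a\<^sup>2 / 2))) \<le> 1 * (A - a\<^sup>2 / 2)"
      using AA0 by (intro mult_mono) (auto simp del: minus_diff_eq)
    moreover have "exp (- a\<^sup>2 / 2) * exp (- (A - a\<^sup>2 / 2)) = exp (- A)" by (simp flip: exp_add)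
    ultimately have q2: "exp (- a\<^sup>2 / 2) - exp (- A) \<le> A - a\<^sup>2 / 2" by (simp add: right_diff_distrib)
    have q3: "exp (- A) \<le> exp (- a\<^sup>2 / 2)" using AA0 by simp
    have "w ^ 3 * exp (- A) - exp (- a\<^sup>2 / 2) = (w ^ 3 - 1) * exp (- A) - (exp (- a\<^sup>2 / 2) - exp (- A))"
      by (simp add: algebra_simps)
    then have "\<bar>w ^ 3 * exp (- A) - exp (- a\<^sup>2 / 2)\<bar> \<le> (w ^ 3 - 1) + (A - a\<^sup>2 / 2)"
      using q1 q2 q3 by linarith
    also have "\<dots> \<le> \<sigma>\<^sup>2 * (4 + a\<^sup>2 + b\<^sup>2)" using w3 AA1 by (simp add: algebra_simps)
    finally show ?thesis .
  qed
  have T2: "\<bar>P * (2 * y) - 2 * \<sigma> * a * b * exp (- a\<^sup>2 / 2)\<bar> \<le> \<bar>\<sigma>\<bar> ^ 3 * (2 * a * \<bar>b\<bar> * (4 + a\<^sup>2 + b\<^sup>2))"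
  proof -
    have "P * (2 * y) - 2 * \<sigma> * a * b * exp (- a\<^sup>2 / 2) = 2 * \<sigma> * a * b * (w ^ 3 * exp (- A) - exp (- a\<^sup>2 / 2))"
      by (simp add: P_def y_def algebra_simps power2_eq_square power3_eq_cube)
    then have "\<bar>P * (2 * y) - 2 * \<sigma> * a * b * exp (- a\<^sup>2 / 2)\<bar> = 2 * \<bar>\<sigma>\<bar> * a * \<bar>b\<bar> * \<bar>w ^ 3 * exp (- A) - exp (- a\<^sup>2 / 2)\<bar>"
      using a by (simp add: abs_mult)
    also have "\<dots> \<le> 2 * \<bar>\<sigma>\<bar> * a * \<bar>b\<bar> * (\<sigma>\<^sup>2 * (4 + a\<^sup>2 + b\<^sup>2))"
      using E a by (intro mult_left_mono) auto
    also have "\<sigma>\<^sup>2 = \<bar>\<sigma>\<bar>\<^sup>2" by simp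
    finally show ?thesis by (simp add: power2_eq_square power3_eq_cube mult_ac)
  qed
  define e where "e = exp (- b\<^sup>2 / 2)"
  have eb2: "e * b\<^sup>2 \<le> 2"
    using exp_ge_add_one_self[of "b\<^sup>2 / 2"] by (simp add: e_def exp_minus field_simps)
  have eb4: "e * b ^ 4 \<le> 8"
  proof -
    have "(b\<^sup>2 / 2)\<^sup>2 / 2 \<le> exp (b\<^sup>2 / 2)"
      using exp_lower_Taylor_quadratic[of "b\<^sup>2 / 2"] zero_le_power2[of b] by linarith
    then show ?thesis by (simp add: e_def exp_minus field_simps)
  qed
  have e1': "e \<le> 1" "0 \<le> e" by (simp_all add: e_def)
  have b1: "\<bar>b\<bar> \<le> (1 + b\<^sup>2) / 2" using zero_le_power2[of "\<bar>b\<bar> - 1"] by (simp add: power2_diff)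
  have b3: "\<bar>b\<bar> ^ 3 \<le> (b\<^sup>2 + b ^ 4) / 2"
    using mult_right_mono[OF b1, of "b\<^sup>2"] by (simp add: power2_eq_square power3_eq_cube abs_mult numeral_eq_Suc algebra_simps)
  have eb1: "e * \<bar>b\<bar> \<le> 3 / 2"
  proof -
    have "e * \<bar>b\<bar> \<le> e * ((1 + b\<^sup>2) / 2)" by (intro mult_left_mono b1 e1'(2))
    also have "\<dots> = (e + e * b\<^sup>2) / 2" by (simp add: algebra_simps)
    also have "\<dots> \<le> (1 + 2) / 2" by (intro divide_right_mono add_mono eb2 e1') simp
    finally show ?thesis by simp
  qed
  have eb3: "e * \<bar>b\<bar> ^ 3 \<le> 5"
  proof -
    have "e * \<bar>b\<bar> ^ 3 \<le> e * ((b\<^sup>2 + b ^ 4) / 2)" by (intro mult_left_mono b3 e1'(2))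
    also have "\<dots> = (e * b\<^sup>2 + e * b ^ 4) / 2" by (simp add: algebra_simps)
    also have "\<dots> \<le> (2 + 8) / 2" by (intro divide_right_mono add_mono eb2 eb4) simp
    finally show ?thesis by simp
  qed
  have "\<bar>p - r\<bar> \<le> B + B'" if "\<bar>p - q\<bar> \<le> B" "\<bar>q - r\<bar> \<le> B'" for p q r B B' :: real
    using that by linarith
  note T12 = this[OF T1 T2]
  have "\<bar>c * e * (P * (exp y - exp (- y))) - c * e * (2 * \<sigma> * a * b * exp (- a\<^sup>2 / 2))\<bar>
     = c * (e * \<bar>P * (exp y - exp (- y)) - 2 * \<sigma> * a * b * exp (- a\<^sup>2 / 2)\<bar>)"
    using c e1'(2) by (simp add: abs_mult flip: right_diff_distrib)
  also have "\<dots> \<le> 1 * (e * \<bar>P * (exp y - exp (- y)) - 2 * \<sigma> * a * b * exp (- a\<^sup>2 / 2)\<bar>)"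
    using c e1'(2) by (intro mult_right_mono) auto
  also have "\<dots> \<le> e * (\<bar>\<sigma>\<bar> ^ 3 * (5 * a ^ 3 * \<bar>b\<bar> ^ 3 + 2 * a * \<bar>b\<bar> * (4 + a\<^sup>2 + b\<^sup>2)))"
    unfolding mult_1 distrib_left[of "\<bar>\<sigma>\<bar> ^ 3"] using T12 e1'(2) by (intro mult_left_mono) (auto simp: mult_ac)
  also have "\<dots> = \<bar>\<sigma>\<bar> ^ 3 * (5 * a ^ 3 * (e * \<bar>b\<bar> ^ 3) + 2 * a * ((4 + a\<^sup>2) * (e * \<bar>b\<bar>) + e * \<bar>b\<bar> ^ 3))"
    by (simp add: algebra_simps power2_eq_square power3_eq_cube)
  \<comment> \<open>Multiplying out gives \<open>25 * a ^ 3 + 3 * a ^ 3 + 22 * a\<close>, the origin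
    of the constant in the statement.\<close>
  also have "\<dots> \<le> \<bar>\<sigma>\<bar> ^ 3 * (5 * a ^ 3 * 5 + 2 * a * ((4 + a\<^sup>2) * (3 / 2) + 5))"
    using a eb1 eb3 by (intro mult_left_mono add_mono) auto
  also have "\<dots> \<le> \<bar>\<sigma>\<bar> ^ 3 * (28 * a ^ 3 + 22 * a)"
    by (simp add: algebra_simps power2_eq_square power3_eq_cube)
  finally show ?thesis unfolding e1 e2 e_def[symmetric] by (simp add: mult.commute)
qed

section \<open>Covariance of two tests\<close>

text \<open>The probability of \<open>\<bar>X\<bar> \<le> a\<close> and \<open>Y \<le> b\<close> for
  a standard bivariate normal pair with correlation \<sigma>, by conditioning on \<open>X\<close>:
  given \<open>X = x\<close>, the law of \<open>Y\<close> is normal with mean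
  \<open>\<sigma> * x\<close> and variance \<open>1 - \<sigma>\<^sup>2\<close>. A one-dimensional
  integral can be differentiated in \<sigma> directly.\<close>

definition strip_prob :: "real \<Rightarrow> real \<Rightarrow> real \<Rightarrow> real" where
  "strip_prob a b \<sigma> = integral {-a..a} (\<lambda>x. std_normal_density x * Phi ((b - \<sigma> * x) / sqrt (1 - \<sigma>\<^sup>2)))"

lemma DERIV_std_normal_density:
  "(std_normal_density has_real_derivative (- x * std_normal_density x)) (at x within S)"
proof -
  have "((\<lambda>x. 1 / sqrt (2 * pi) * exp (- x\<^sup>2 / 2)) has_real_derivative 1 / sqrt (2 * pi) * (exp (- x\<^sup>2 / 2) * - x)) (at x within S)"
    by (intro DERIV_cmult) (auto intro!: derivative_eq_intros)
  then show ?thesis unfolding std_normal_density_def by (simp add: mult_ac)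
qed

lemmas DERIV_std_normal_density_chain [derivative_intros] = DERIV_std_normal_density[THEN DERIV_chain2]

text \<open>Both sides are \<kappa> times the bivariate normal density at \<open>(x, b)\<close>,
  factored through either marginal.\<close>

lemma std_normal_density_conditional_swap:
  assumes "\<kappa> > 0" "\<kappa>\<^sup>2 = 1 - \<sigma>\<^sup>2"
  shows "std_normal_density x * std_normal_density ((b - \<sigma> * x) / \<kappa>)
    = std_normal_density b * std_normal_density ((x - \<sigma> * b) / \<kappa>)"
proof -
  have "x\<^sup>2 + ((b - \<sigma> * x) / \<kappa>)\<^sup>2 = b\<^sup>2 + ((x - \<sigma> * b) / \<kappa>)\<^sup>2"
  proof -
    have "\<kappa>\<^sup>2 * x\<^sup>2 + (b - \<sigma> * x)\<^sup>2 = \<kappa>\<^sup>2 * b\<^sup>2 + (x - \<sigma> * b)\<^sup>2"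
      unfolding assms(2) by (simp add: algebra_simps power2_eq_square)
    then show ?thesis using assms(1) by (simp add: power_divide field_simps)
  qed
  then show ?thesis
    by (simp add: std_normal_density_def add_divide_distrib[symmetric] flip: exp_add)
qed

text \<open>Plackett's identity: the derivative of the bivariate normal density in \<sigma> is its
  mixed second derivative in the two arguments, so integration over the strip leaves the density at
  the corners \<open>(a, b)\<close> and \<open>(- a, b)\<close>.\<close>

lemma DERIV_strip_prob:
  fixes a b \<sigma> :: real
  assumes a: "a > 0" and \<sigma>: "\<bar>\<sigma>\<bar> \<le> 1 / 2"
  defines "\<kappa> \<equiv> sqrt (1 - \<sigma>\<^sup>2)"
  shows "(strip_prob a b has_real_derivative
     std_normal_density b / \<kappa> * (std_normal_density ((a - \<sigma> * b) / \<kappa>) - std_normal_density ((a + \<sigma> * b) / \<kappa>)))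
     (at \<sigma> within {-1/2..1/2})"
proof -
  let ?\<kappa> = "\<lambda>s::real. sqrt (1 - s\<^sup>2)"
  have kp: "1 - s\<^sup>2 > 0" if "s \<in> {-1/2..1/2}" for s :: real
  proof -
    have "\<bar>s\<bar> \<le> 1/2" using that by auto
    then have "s\<^sup>2 \<le> (1/2)\<^sup>2" using abs_le_square_iff[of s "1/2"] by simp
    then show ?thesis by (simp add: power2_eq_square)
  qed
  define D where "D s x = std_normal_density x * (std_normal_density ((b - s * x) / ?\<kappa> s) * ((s * b - x) / ?\<kappa> s ^ 3))" for s x
  have s: "\<sigma> \<in> {-1/2..1/2}" using \<sigma> by auto
  have k: "\<kappa> > 0" "\<kappa>\<^sup>2 = 1 - \<sigma>\<^sup>2" using kp[OF s] by (auto simp: \<kappa>_def)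
  have 1: "((\<lambda>s. std_normal_density x * Phi ((b - s * x) / ?\<kappa> s)) has_real_derivative D s x) (at s within {-1/2..1/2})"
    if "s \<in> {-1/2..1/2}" for s x
  proof -
    have k: "?\<kappa> s > 0" "?\<kappa> s ^ 2 = 1 - s\<^sup>2" using kp[OF that] by auto
    have e: "(- x * ?\<kappa> s - (b - s * x) * (- (2 * s) * (inverse (?\<kappa> s) / 2))) / (?\<kappa> s * ?\<kappa> s) = (s * b - x) / ?\<kappa> s ^ 3"
    proof -
      have "(- x * ?\<kappa> s - (b - s * x) * (- (2 * s) * (inverse (?\<kappa> s) / 2))) = (- x * (?\<kappa> s)\<^sup>2 + (b - s * x) * s) / ?\<kappa> s"
        using k(1) by (simp add: field_simps power2_eq_square)
      also have "- x * (?\<kappa> s)\<^sup>2 + (b - s * x) * s = s * b - x"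
        unfolding k(2) by (simp add: algebra_simps power2_eq_square)
      finally show ?thesis by (simp add: power3_eq_cube)
    qed
    have "((\<lambda>s. std_normal_density x * Phi ((b - s * x) / ?\<kappa> s)) has_real_derivative
       std_normal_density x * (std_normal_density ((b - s * x) / ?\<kappa> s) *
        ((- x * ?\<kappa> s - (b - s * x) * (- (2 * s) * (inverse (?\<kappa> s) / 2))) / (?\<kappa> s * ?\<kappa> s)))) (at s within {-1/2..1/2})"
      using k kp[OF that] by (auto intro!: derivative_eq_intros)
    then show ?thesis unfolding e D_def .
  qed
  have "((\<lambda>s. integral (cbox (-a) a) (\<lambda>x. std_normal_density x * Phi ((b - s * x) / ?\<kappa> s)))
     has_field_derivative integral (cbox (-a) a) (D \<sigma>)) (at \<sigma> within {-1/2..1/2})"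
  proof (rule leibniz_rule_field_derivative[OF 1])
    show "(\<lambda>x. std_normal_density x * Phi ((b - s * x) / ?\<kappa> s)) integrable_on cbox (-a) a"
      if "s \<in> {-1/2..1/2}" for s
      using kp[OF that] by (intro integrable_continuous continuous_intros) auto
    show "continuous_on ({-1/2..1/2} \<times> cbox (- a) a) (\<lambda>(s, x). D s x)"
      unfolding D_def case_prod_unfold using kp by (intro continuous_intros) force+
  qed (use s in auto)
  \<comment> \<open>Swapping the conditioning turns the integrand into the exact
    \<open>x\<close>-derivative of \<open>std_normal_density b * std_normal_density ((x - \<sigma> *
    b) / \<kappa>) / \<kappa>\<close>.\<close>
  moreover have "integral (cbox (-a) a) (D \<sigma>) =
     std_normal_density b * std_normal_density ((a - \<sigma> * b) / \<kappa>) / \<kappa>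
     - std_normal_density b * std_normal_density ((- a - \<sigma> * b) / \<kappa>) / \<kappa>"
  proof -
    have "(D \<sigma> has_integral std_normal_density b * std_normal_density ((a - \<sigma> * b) / \<kappa>) / \<kappa>
       - std_normal_density b * std_normal_density ((- a - \<sigma> * b) / \<kappa>) / \<kappa>) {-a..a}"
    proof (rule fundamental_theorem_of_calculus)
      fix x
      have "D \<sigma> x = std_normal_density b * std_normal_density ((x - \<sigma> * b) / \<kappa>) * ((\<sigma> * b - x) / \<kappa> ^ 3)"
        unfolding D_def \<kappa>_def[symmetric] mult.assoc[symmetric] std_normal_density_conditional_swap[OF k] ..
      moreover have "((\<lambda>x. std_normal_density b * std_normal_density ((x - \<sigma> * b) / \<kappa>) / \<kappa>) has_real_derivative
          std_normal_density b * std_normal_density ((x - \<sigma> * b) / \<kappa>) * ((\<sigma> * b - x) / \<kappa> ^ 3)) (at x within {-a..a})"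
        using k(1) by (auto intro!: derivative_eq_intros simp: field_simps power3_eq_cube)
      ultimately show "((\<lambda>x. std_normal_density b * std_normal_density ((x - \<sigma> * b) / \<kappa>) / \<kappa>) has_vector_derivative D \<sigma> x) (at x within {-a..a})"
        by (simp add: has_real_derivative_iff_has_vector_derivative)
    qed (use a in simp)
    then show ?thesis by (simp add: integral_unique)
  qed
  moreover have "std_normal_density ((- a - \<sigma> * b) / \<kappa>) = std_normal_density ((a + \<sigma> * b) / \<kappa>)"
    using std_normal_density_uminus[of "(a + \<sigma> * b) / \<kappa>"] by (simp add: minus_divide_left)
  ultimately show ?thesis
    unfolding strip_prob_def by (simp add: strip_prob_def[abs_def] right_diff_distrib diff_divide_distrib)
qed

lemma strip_prob_0: "a > 0 \<Longrightarrow> strip_prob a b 0 = (Phi a - Phi (- a)) * Phi b"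
  by (simp add: strip_prob_def Phi_diff)

text \<open>The difference of the two strips is the probability that both tests accept when the
  second mean is \<open>m\<close>; at \<sigma> = 0 it factorises. Once the quadratic term is
  subtracted, the derivative is of third order between \<open>- \<bar>\<sigma>\<bar>\<close> and
  \<open>\<bar>\<sigma>\<bar>\<close>, and the mean value inequality gains one more power.\<close>

lemma strip_prob_expansion:
  fixes t m \<sigma> :: real
  assumes t: "0 < t" "t < 1" and \<sigma>: "\<bar>\<sigma>\<bar> \<le> 1 / 2"
  defines "a \<equiv> \<bar>zq (t / 2)\<bar>"
  shows "\<bar>strip_prob a (a - m) \<sigma> - strip_prob a (- a - m) \<sigma> - (1 - t) * (1 - xi t m)
      - a * std_normal_density a * H t m * \<sigma>\<^sup>2\<bar> \<le> 2 * (28 * a ^ 3 + 22 * a) * \<sigma> ^ 4"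
proof -
  have a: "a > 0" using zq_half_cutoff[OF t] by (simp add: a_def)
  let ?K = "28 * a ^ 3 + 22 * a"
  let ?S = "{-\<bar>\<sigma>\<bar>..\<bar>\<sigma>\<bar>}"
  define g where "g s = strip_prob a (a - m) s - strip_prob a (- a - m) s - a * std_normal_density a * H t m * s\<^sup>2" for s
  define D where "D b s = std_normal_density b / sqrt (1 - s\<^sup>2) * (std_normal_density ((a - s * b) / sqrt (1 - s\<^sup>2)) - std_normal_density ((a + s * b) / sqrt (1 - s\<^sup>2)))" for b s
  \<comment> \<open>This is how \<open>H\<close> arises: the linear part of the kernel is
    proportional to \<open>b * std_normal_density b\<close>, and the two values of \<open>b\<close>
    are subtracted.\<close>
  have Heq: "H t m = (a - m) * std_normal_density (a - m) - (- a - m) * std_normal_density (- a - m)"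
    using std_normal_density_uminus[of "a + m"] by (simp add: H_def Let_def a_def[symmetric] algebra_simps)
  have main: "norm (g \<sigma> - g 0) \<le> (2 * ?K * \<bar>\<sigma>\<bar> ^ 3) * norm (\<sigma> - 0)"
  proof (rule field_differentiable_bound[of ?S])
    fix s assume s: "s \<in> ?S"
    then have s2: "\<bar>s\<bar> \<le> 1/2" and sub: "?S \<subseteq> {-1/2..1/2}" using \<sigma> by auto
    note d = DERIV_strip_prob[OF a s2, THEN DERIV_subset, OF sub, folded D_def]
    show "(g has_field_derivative (D (a - m) s - D (- a - m) s - a * std_normal_density a * H t m * (2 * s))) (at s within ?S)"
      unfolding g_def by (auto intro!: derivative_eq_intros d)
    have "\<bar>D (a - m) s - 2 * s * a * (a - m) * std_normal_density a * std_normal_density (a - m)\<bar> \<le> ?K * \<bar>s\<bar> ^ 3"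
      "\<bar>D (- a - m) s - 2 * s * a * (- a - m) * std_normal_density a * std_normal_density (- a - m)\<bar> \<le> ?K * \<bar>s\<bar> ^ 3"
      unfolding D_def using Plackett_kernel_bound[OF _ s2, of a] a by auto
    moreover have "a * std_normal_density a * H t m * (2 * s) =
        2 * s * a * (a - m) * std_normal_density a * std_normal_density (a - m)
        - 2 * s * a * (- a - m) * std_normal_density a * std_normal_density (- a - m)"
      unfolding Heq by (simp add: algebra_simps)
    moreover have "\<bar>s\<bar> ^ 3 \<le> \<bar>\<sigma>\<bar> ^ 3" using s by (intro power_mono) auto
    then have "?K * \<bar>s\<bar> ^ 3 \<le> ?K * \<bar>\<sigma>\<bar> ^ 3" using a by (intro mult_left_mono) auto
    ultimately show "norm (D (a - m) s - D (- a - m) s - a * std_normal_density a * H t m * (2 * s)) \<le> 2 * ?K * \<bar>\<sigma>\<bar> ^ 3"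
      unfolding real_norm_def by linarith
  qed auto
  have g0: "g 0 = (1 - t) * (1 - xi t m)"
  proof -
    have z: "zq (t / 2) = - a" "Phi (- a) = t / 2" using zq_half_cutoff[OF t] by (auto simp: a_def)
    have "Phi a = 1 - t / 2" using Phi_uminus[of a] z(2) by linarith
    then have "Phi a - Phi (- a) = 1 - t" using z(2) by linarith
    moreover have "1 - xi t m = Phi (a - m) - Phi (- a - m)"
      unfolding xi_def z using Phi_uminus[of "a - m"] by simp
    ultimately show ?thesis
      unfolding g_def using a by (simp add: strip_prob_0 right_diff_distrib)
  qed
  have s4: "\<bar>\<sigma>\<bar> ^ 3 * \<bar>\<sigma>\<bar> = \<sigma> ^ 4"
    by (simp flip: power_Suc2 add: power_even_abs_numeral)
  have "\<bar>g \<sigma> - g 0\<bar> \<le> 2 * ?K * (\<bar>\<sigma>\<bar> ^ 3 * \<bar>\<sigma>\<bar>)" using main by (simp add: mult.assoc)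
  then show ?thesis unfolding s4 g0 by (simp only: g_def diff_diff_eq add.commute)
qed

lemma pair_law_unique:
  fixes X Y :: "'a \<Rightarrow> real" and X' Y' :: "'b \<Rightarrow> real"
  assumes "prob_space M" "prob_space N"
    and [measurable]: "X \<in> borel_measurable M" "Y \<in> borel_measurable M" "X' \<in> borel_measurable N" "Y' \<in> borel_measurable N"
    and eq: "\<And>s u \<theta>. (\<integral>\<omega>. cos (s * X \<omega> + u * Y \<omega> + \<theta>) \<partial>M) = (\<integral>\<omega>. cos (s * X' \<omega> + u * Y' \<omega> + \<theta>) \<partial>N)"
  shows "distr M (borel \<Otimes>\<^sub>M borel) (\<lambda>\<omega>. (X \<omega>, Y \<omega>)) = distr N (borel \<Otimes>\<^sub>M borel) (\<lambda>\<omega>. (X' \<omega>, Y' \<omega>))"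
proof -
  define F where "F b = (if b then X else Y)" for b
  define F' where "F' b = (if b then X' else Y')" for b
  have [measurable]: "F b \<in> borel_measurable M" "F' b \<in> borel_measurable N" for b
    by (auto simp: F_def F'_def)
  have sums: "(\<Sum>b\<in>UNIV. s b * F b \<omega>) = s True * X \<omega> + s False * Y \<omega>"
    "(\<Sum>b\<in>UNIV. s b * F' b \<omega>') = s True * X' \<omega>' + s False * Y' \<omega>'" for s \<omega> \<omega>'
    by (simp_all add: UNIV_bool F_def F'_def)
  let ?P = "PiM UNIV (\<lambda>_::bool. borel :: real measure)"
  have "distr M ?P (\<lambda>\<omega>. \<lambda>b\<in>UNIV. F b \<omega>) = distr N ?P (\<lambda>\<omega>. \<lambda>b\<in>UNIV. F' b \<omega>)"
    by (rule cos_law_unique[OF assms(1,2)]) (simp_all add: sums eq)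
  then have "distr (distr M ?P (\<lambda>\<omega>. \<lambda>b\<in>UNIV. F b \<omega>)) (borel \<Otimes>\<^sub>M borel) (\<lambda>f. (f True, f False))
     = distr (distr N ?P (\<lambda>\<omega>. \<lambda>b\<in>UNIV. F' b \<omega>)) (borel \<Otimes>\<^sub>M borel) (\<lambda>f. (f True, f False))"
    by simp
  moreover have "(\<lambda>f. (f True, f False)) \<in> ?P \<rightarrow>\<^sub>M borel \<Otimes>\<^sub>M borel"
    by (intro measurable_Pair measurable_component_singleton) auto
  moreover have "(\<lambda>\<omega>. \<lambda>b\<in>UNIV. F b \<omega>) \<in> M \<rightarrow>\<^sub>M ?P" "(\<lambda>\<omega>. \<lambda>b\<in>UNIV. F' b \<omega>) \<in> N \<rightarrow>\<^sub>M ?P"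
    by (intro measurable_restrict; measurable)+
  ultimately show ?thesis
    by (simp add: distr_distr o_def F_def F'_def)
qed

text \<open>Only linear combinations are constrained by the definition of joint normality; comparing with
  a product space turns zero correlation into independence.\<close>

lemma normal_pair_test_covariance:
  fixes X Y :: "'a \<Rightarrow> real" and m \<sigma> t :: real
  assumes "prob_space M" and t: "0 < t" "t < 1"
    and pair: "\<And>s u. normal_rv M (\<lambda>\<omega>. s * X \<omega> + u * Y \<omega>) (u * m) (s\<^sup>2 + 2 * s * u * \<sigma> + u\<^sup>2)"
  defines "a \<equiv> \<bar>zq (t / 2)\<bar>"
  shows "\<bar>(\<integral>\<omega>. test t (X \<omega>) * test t (Y \<omega>) \<partial>M) - t * xi t m - a * std_normal_density a * H t m * \<sigma>\<^sup>2\<bar>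
    \<le> (2 * (28 * a ^ 3 + 22 * a) + 24) * \<sigma> ^ 4"
proof -
  interpret prob_space M by fact
  interpret PP: pair_prob_space M M by unfold_locales
  have a: "a > 0" using zq_half_cutoff[OF t] by (simp add: a_def)
  have X: "normal_rv M X 0 1" and Y: "normal_rv M Y m 1"
    using pair[of 1 0] pair[of 0 1] by auto
  note [measurable] = normal_rv_measurable[OF X] normal_rv_measurable[OF Y]
  have EX: "(\<integral>\<omega>. test t (X \<omega>) \<partial>M) = t" and EY: "(\<integral>\<omega>. test t (Y \<omega>) \<partial>M) = xi t m"
    using expectation_test[OF t assms(1) X] expectation_test[OF t assms(1) Y] xi_zero[OF t] by auto
  have int: "integrable M (\<lambda>\<omega>. test t (X \<omega>))" "integrable M (\<lambda>\<omega>. test t (Y \<omega>))" "integrable M (\<lambda>\<omega>. test t (X \<omega>) * test t (Y \<omega>))"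
    by (rule integrable_const_bound[of _ 1]; simp add: test_def)+
  show ?thesis
  proof (cases "\<bar>\<sigma>\<bar> \<le> 1 / 2")
    \<comment> \<open>A strong correlation needs no expansion: the left side is at most
      \<open>1 + 2 * \<sigma>\<^sup>2\<close>, and \<open>1 \<le> 4 * \<sigma>\<^sup>2\<close> turns
      this into \<open>6 * \<sigma>\<^sup>2 \<le> 24 * \<sigma> ^ 4\<close>. Hence the summand 24 in
      the constant.\<close>
    case False
    have "0 \<le> (\<integral>\<omega>. test t (X \<omega>) * test t (Y \<omega>) \<partial>M)"
      by (intro Bochner_Integration.integral_nonneg) (simp add: test_def)
    moreover have "(\<integral>\<omega>. test t (X \<omega>) * test t (Y \<omega>) \<partial>M) \<le> (\<integral>\<omega>. test t (X \<omega>) \<partial>M)"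
      using int by (intro integral_mono) (auto simp: test_def)
    moreover have "0 \<le> xi t m" "xi t m \<le> 1"
    proof -
      have "(\<integral>\<omega>. test t (Y \<omega>) \<partial>M) \<le> (\<integral>\<omega>. 1 \<partial>M)"
        using int by (intro integral_mono) (auto simp: test_def)
      then show "xi t m \<le> 1" unfolding EY by (simp add: prob_space)
      show "0 \<le> xi t m" using xi_lower[OF t, of m] t by linarith
    qed
    then have "0 \<le> t * xi t m" "t * xi t m \<le> 1" using t by (auto intro!: mult_le_one)
    moreover have "\<bar>a * std_normal_density a * H t m * \<sigma>\<^sup>2\<bar> \<le> 1 * 2 * \<sigma>\<^sup>2"
      using abs_mult_std_normal_density_le[of a] H_bound[of t m]
      unfolding abs_mult by (intro mult_mono) (auto simp: abs_mult mult.commute)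
    moreover have "1 \<le> 4 * \<sigma>\<^sup>2"
      using False abs_le_square_iff[of "1/2" \<sigma>] by (simp add: power2_eq_square)
    then have "(4 * \<sigma>\<^sup>2) * 1 \<le> (4 * \<sigma>\<^sup>2) * (4 * \<sigma>\<^sup>2)" by (intro mult_left_mono) auto
    then have "4 * \<sigma>\<^sup>2 \<le> 16 * \<sigma> ^ 4" by (simp add: power2_eq_square power4_eq_xxxx)
    moreover have "0 \<le> 2 * (28 * a ^ 3 + 22 * a) * \<sigma> ^ 4" using a by simp
    ultimately show ?thesis using EX t \<open>1 \<le> 4 * \<sigma>\<^sup>2\<close> unfolding distrib_right[of _ 24] by linarith
  next
    case True
    define \<kappa> where "\<kappa> = sqrt (1 - \<sigma>\<^sup>2)"
    have "\<sigma>\<^sup>2 \<le> 1 / 4" using True abs_le_square_iff[of \<sigma> "1/2"] by (simp add: power2_eq_square)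
    then have kp: "1 - \<sigma>\<^sup>2 > 0" and k: "\<kappa> > 0" by (auto simp: \<kappa>_def)
    \<comment> \<open>The residual of the regression of \<open>Y\<close> on \<open>X\<close>; in
      this case its variance is positive, so its distribution function is a rescaled
      \<open>Phi\<close>.\<close>
    define W where "W \<omega> = Y \<omega> - \<sigma> * X \<omega>" for \<omega>
    have [measurable]: "W \<in> borel_measurable M" unfolding W_def by measurable
    have W: "normal_rv M W m (1 - \<sigma>\<^sup>2)"
      using pair[of "- \<sigma>" 1] by (simp add: W_def[abs_def] power2_eq_square algebra_simps)
    have XW: "normal_rv M (\<lambda>\<omega>. s * X \<omega> + u * W \<omega>) (u * m) (s\<^sup>2 + u\<^sup>2 * (1 - \<sigma>\<^sup>2))" for s u
      using pair[of "s - u * \<sigma>" u] by (simp add: W_def power2_eq_square algebra_simps)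
    have sX: "normal_rv M (\<lambda>\<omega>. s * X \<omega>) 0 (s\<^sup>2)" for s using XW[of s 0] by simp
    have uW: "normal_rv M (\<lambda>\<omega>. u * W \<omega>) (u * m) (u\<^sup>2 * (1 - \<sigma>\<^sup>2))" for u using XW[of 0 u] by simp
    have law: "distr M (borel \<Otimes>\<^sub>M borel) (\<lambda>\<omega>. (X \<omega>, W \<omega>)) = distr (M \<Otimes>\<^sub>M M) (borel \<Otimes>\<^sub>M borel) (\<lambda>z. (X (fst z), W (snd z)))"
    proof (rule pair_law_unique)
      fix s u \<theta> :: real
      have "(\<integral>z. cos (s * X (fst z) + u * W (snd z) + \<theta>) \<partial>(M \<Otimes>\<^sub>M M))
          = (\<integral>\<omega>. (\<integral>\<omega>'. cos (u * W \<omega>' + (s * X \<omega> + \<theta>)) \<partial>M) \<partial>M)"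
        by (subst PP.integral_fst'[symmetric])
          (auto simp: add_ac intro!: PP.P.integrable_const_bound[of _ 1])
      also have "\<dots> = (\<integral>\<omega>. exp (- (u\<^sup>2 * (1 - \<sigma>\<^sup>2)) / 2) * cos (s * X \<omega> + (\<theta> + u * m)) \<partial>M)"
        unfolding normal_rv_cos[OF assms(1) uW] by (simp add: add_ac)
      also have "\<dots> = exp (- (u\<^sup>2 * (1 - \<sigma>\<^sup>2)) / 2) * (exp (- s\<^sup>2 / 2) * cos (\<theta> + u * m))"
        using normal_rv_cos[OF assms(1) sX, of s "\<theta> + u * m"] by simp
      also have "\<dots> = exp (- (s\<^sup>2 + u\<^sup>2 * (1 - \<sigma>\<^sup>2)) / 2) * cos (u * m + \<theta>)"
      proof -
        have "exp (- (s\<^sup>2 + u\<^sup>2 * (1 - \<sigma>\<^sup>2)) / 2) = exp (- (u\<^sup>2 * (1 - \<sigma>\<^sup>2)) / 2) * exp (- s\<^sup>2 / 2)"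
          by (simp add: field_simps flip: exp_add)
        then show ?thesis by (simp add: add.commute)
      qed
      also have "\<dots> = (\<integral>\<omega>. cos (s * X \<omega> + u * W \<omega> + \<theta>) \<partial>M)"
        unfolding normal_rv_cos[OF assms(1) XW] ..
      finally show "(\<integral>\<omega>. cos (s * X \<omega> + u * W \<omega> + \<theta>) \<partial>M) = (\<integral>z. cos (s * X (fst z) + u * W (snd z) + \<theta>) \<partial>(M \<Otimes>\<^sub>M M))" ..
    qed (auto intro: assms(1) PP.P.prob_space_axioms)
    define f :: "real \<times> real \<Rightarrow> real" where "f z = indicator {-a..a} (fst z) * indicator {-a..a} (snd z + \<sigma> * fst z)" for z
    have [measurable]: "f \<in> borel_measurable (borel \<Otimes>\<^sub>M borel)" unfolding f_def by measurable
    have q: "(\<integral>\<omega>'. indicator {-a..a} (W \<omega>' + \<sigma> * x) \<partial>M) = Phi ((a - m - \<sigma> * x) / \<kappa>) - Phi ((- a - m - \<sigma> * x) / \<kappa>)" for x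
    proof -
      have "(\<integral>\<omega>'. indicator {-a..a} (W \<omega>' + \<sigma> * x) \<partial>M :: real)
        = (\<integral>\<omega>'. indicator {\<omega>'\<in>space M. W \<omega>' \<le> a - \<sigma> * x} \<omega>' - indicator {\<omega>'\<in>space M. W \<omega>' < - a - \<sigma> * x} \<omega>' \<partial>M)"
        using a by (intro Bochner_Integration.integral_cong) (auto simp: indicator_def)
      also have "\<dots> = measure M {\<omega>'\<in>space M. W \<omega>' \<le> a - \<sigma> * x} - measure M {\<omega>'\<in>space M. W \<omega>' < - a - \<sigma> * x}"
        by (subst Bochner_Integration.integral_diff) (simp_all add: Int_absorb2 integrable_indicator_iff emeasure_eq_measure)
      also have "\<dots> = Phi ((a - m - \<sigma> * x) / \<kappa>) - Phi ((- a - m - \<sigma> * x) / \<kappa>)"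
        unfolding normal_rv_cdf[OF assms(1) W kp] by (simp add: \<kappa>_def algebra_simps)
      finally show ?thesis .
    qed
    let ?q = "\<lambda>x. Phi ((a - m - \<sigma> * x) / \<kappa>) - Phi ((- a - m - \<sigma> * x) / \<kappa>)"
    \<comment> \<open>Joint acceptance is computed instead of joint rejection, because it is a
      single rectangle. Passing back costs only the two means, so the covariance is the
      same.\<close>
    have "(\<integral>\<omega>. (1 - test t (X \<omega>)) * (1 - test t (Y \<omega>)) \<partial>M) = (\<integral>\<omega>. f (X \<omega>, W \<omega>) \<partial>M)"
      by (intro Bochner_Integration.integral_cong)
        (auto simp: f_def W_def test_def indicator_def a_def[symmetric])
    also have "\<dots> = (\<integral>z. f z \<partial>distr M (borel \<Otimes>\<^sub>M borel) (\<lambda>\<omega>. (X \<omega>, W \<omega>)))"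
      by (subst integral_distr) auto
    also have "\<dots> = (\<integral>z. f (X (fst z), W (snd z)) \<partial>(M \<Otimes>\<^sub>M M))"
      unfolding law by (subst integral_distr) auto
    also have "\<dots> = (\<integral>\<omega>. (\<integral>\<omega>'. indicator {-a..a} (X \<omega>) * indicator {-a..a} (W \<omega>' + \<sigma> * X \<omega>) \<partial>M) \<partial>M)"
      by (subst PP.integral_fst'[symmetric])
        (auto simp: f_def indicator_def intro!: PP.P.integrable_const_bound[of _ 1])
    also have "\<dots> = (\<integral>\<omega>. indicator {-a..a} (X \<omega>) * ?q (X \<omega>) \<partial>M)"
      by (simp add: q)
    also have "\<dots> = (\<integral>x. indicator {-a..a} x * ?q x \<partial>distr M borel X)"
      by (subst integral_distr) auto
    also have "\<dots> = (\<integral>x. indicator {-a..a} x * ?q x \<partial>std_normal_distribution)"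
      unfolding normal_rv_distr[OF assms(1) X] by (subst integral_distr) auto
    also have "\<dots> = (\<integral>x. std_normal_density x * (indicator {-a..a} x * ?q x) \<partial>lborel)"
      by (subst integral_density) auto
    also have "\<dots> = set_lebesgue_integral lborel {-a..a} (\<lambda>x. std_normal_density x * ?q x)"
      unfolding set_lebesgue_integral_def by (simp add: mult_ac)
    also have "\<dots> = integral {-a..a} (\<lambda>x. std_normal_density x * ?q x)"
      using k by (intro set_borel_integral_eq_integral borel_integrable_atLeastAtMost' continuous_intros) auto
    also have "\<dots> = strip_prob a (a - m) \<sigma> - strip_prob a (- a - m) \<sigma>"
      unfolding strip_prob_def \<kappa>_def[symmetric] right_diff_distrib
      using k by (intro Henstock_Kurzweil_Integration.integral_diff integrable_continuous_interval continuous_intros) auto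
    finally have "(\<integral>\<omega>. (1 - test t (X \<omega>)) * (1 - test t (Y \<omega>)) \<partial>M) = strip_prob a (a - m) \<sigma> - strip_prob a (- a - m) \<sigma>" .
    moreover have "(\<integral>\<omega>. (1 - test t (X \<omega>)) * (1 - test t (Y \<omega>)) \<partial>M)
        = (\<integral>\<omega>. 1 - test t (X \<omega>) - test t (Y \<omega>) + test t (X \<omega>) * test t (Y \<omega>) \<partial>M)"
      by (simp add: algebra_simps)
    moreover have "\<dots> = 1 - t - xi t m + (\<integral>\<omega>. test t (X \<omega>) * test t (Y \<omega>) \<partial>M)"
      using int by (simp add: EX EY prob_space)
    ultimately have "(\<integral>\<omega>. test t (X \<omega>) * test t (Y \<omega>) \<partial>M) - t * xi t m
        = strip_prob a (a - m) \<sigma> - strip_prob a (- a - m) \<sigma> - (1 - t) * (1 - xi t m)"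
      by (simp add: algebra_simps)
    moreover have "0 \<le> 24 * \<sigma> ^ 4" by simp
    ultimately show ?thesis
      using strip_prob_expansion[OF t True, of m] unfolding a_def[symmetric] distrib_right[of _ 24] by linarith
  qed
qed

section \<open>Marginals of a multivariate normal vector\<close>

lemma multivariate_normal_pair:
  assumes "multivariate_normal M I Z \<mu> \<sigma>" "i \<in> I" "j \<in> I" "i \<noteq> j"
  shows "normal_rv M (\<lambda>\<omega>. s * Z i \<omega> + u * Z j \<omega>) (s * \<mu> i + u * \<mu> j)
     (s\<^sup>2 * \<sigma> i i + 2 * s * u * \<sigma> i j + u\<^sup>2 * \<sigma> j j)"
proof -
  define w where "w k = (if k = i then s else if k = j then u else 0)" for k
  have I: "finite I" "\<sigma> j i = \<sigma> i j" using assms unfolding multivariate_normal_def by auto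
  have *: "(\<Sum>k\<in>I. w k * g k) = s * g i + u * g j" for g :: "_ \<Rightarrow> real"
  proof -
    have "(\<Sum>k\<in>I. w k * g k) = (\<Sum>k\<in>{i, j}. w k * g k)"
      using assms(2,3) I by (intro sum.mono_neutral_right) (auto simp: w_def)
    then show ?thesis using assms(4) by (simp add: w_def)
  qed
  have "(\<Sum>k\<in>I. \<Sum>l\<in>I. w k * w l * \<sigma> k l) = (\<Sum>k\<in>I. w k * (\<Sum>l\<in>I. w l * \<sigma> k l))"
    by (simp add: sum_distrib_left mult.assoc)
  also have "\<dots> = s * (s * \<sigma> i i + u * \<sigma> i j) + u * (s * \<sigma> j i + u * \<sigma> j j)"
    unfolding * ..
  also have "\<dots> = s\<^sup>2 * \<sigma> i i + 2 * s * u * \<sigma> i j + u\<^sup>2 * \<sigma> j j"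
    unfolding I(2) by (simp add: power2_eq_square distrib_left)
  finally have "(\<Sum>k\<in>I. \<Sum>l\<in>I. w k * w l * \<sigma> k l) = s\<^sup>2 * \<sigma> i i + 2 * s * u * \<sigma> i j + u\<^sup>2 * \<sigma> j j" .
  moreover have "normal_rv M (\<lambda>\<omega>. \<Sum>k\<in>I. w k * Z k \<omega>) (\<Sum>k\<in>I. w k * \<mu> k) (\<Sum>k\<in>I. \<Sum>l\<in>I. w k * w l * \<sigma> k l)"
    using assms(1) unfolding multivariate_normal_def by blast
  ultimately show ?thesis unfolding * by simp
qed

lemma multivariate_normal_single:
  assumes "multivariate_normal M I Z \<mu> \<sigma>" "i \<in> I"
  shows "normal_rv M (Z i) (\<mu> i) (\<sigma> i i)"
proof -
  define w where "w k = (if k = i then 1 else 0 :: real)" for k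
  have "finite I" using assms(1) unfolding multivariate_normal_def by auto
  then have *: "(\<Sum>k\<in>I. w k * g k) = g i" for g :: "_ \<Rightarrow> real"
    using assms(2) by (simp add: w_def if_distribR sum.delta' if_distrib[of "\<lambda>x. x * _"] cong: if_cong)
  have "normal_rv M (\<lambda>\<omega>. \<Sum>k\<in>I. w k * Z k \<omega>) (\<Sum>k\<in>I. w k * \<mu> k) (\<Sum>k\<in>I. \<Sum>l\<in>I. w k * w l * \<sigma> k l)"
    using assms(1) unfolding multivariate_normal_def by blast
  then show ?thesis
    by (simp add: * mult.assoc flip: sum_distrib_left)
qed

section \<open>Gaussian concentration\<close>

text \<open>Jensen's inequality on the unit interval for \<open>f 1 - f 0\<close> written as the
  integral of \<open>f'\<close>. The extended nonnegative integral lets path integral and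
  expectation be exchanged later without an integrability condition.\<close>

lemma power_even_increment_le:
  fixes f f' :: "real \<Rightarrow> real"
  assumes deriv: "\<And>x. x \<in> {0..1} \<Longrightarrow> (f has_real_derivative f' x) (at x within {0..1})"
    and cont: "continuous_on {0..1} f'"
  shows "ennreal ((f 1 - f 0) ^ (2 * k)) \<le> (\<integral>\<^sup>+x. ennreal (indicator {0..1} x * f' x ^ (2 * k)) \<partial>lborel)"
proof -
  define U where "U = restrict_space lborel {0..1::real}"
  interpret U: prob_space U
    by (rule prob_spaceI) (simp add: U_def space_restrict_space emeasure_restrict_space)
  have int: "integrable U g" and eq: "(\<integral>x. g x \<partial>U) = integral {0..1} g" if "continuous_on {0..1} g" for g :: "real \<Rightarrow> real"
  proof -
    have *: "set_integrable lborel {0..1} g"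
      using that by (rule borel_integrable_atLeastAtMost')
    then show "integrable U g"
      unfolding U_def set_integrable_def by (subst integrable_restrict_space) auto
    have "(\<integral>x. g x \<partial>U) = set_lebesgue_integral lborel {0..1} g"
      unfolding U_def set_lebesgue_integral_def by (subst integral_restrict_space) auto
    then show "(\<integral>x. g x \<partial>U) = integral {0..1} g"
      using set_borel_integral_eq_integral(2)[OF *] by simp
  qed
  have ck: "continuous_on {0..1} (\<lambda>x. f' x ^ (2 * k))" by (intro continuous_intros cont)
  have "(f' has_integral (f 1 - f 0)) {0..1}"
    using deriv by (intro fundamental_theorem_of_calculus) (auto simp: has_real_derivative_iff_has_vector_derivative)
  then have "(f 1 - f 0) ^ (2 * k) = (\<integral>x. f' x \<partial>U) ^ (2 * k)"
    using eq[OF cont] by (simp add: integral_unique)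
  also have "\<dots> \<le> (\<integral>x. f' x ^ (2 * k) \<partial>U)"
    using int[OF cont] int[OF ck] by (intro U.jensens_inequality[where I=UNIV]) (auto intro: convex_power_even)
  finally have "ennreal ((f 1 - f 0) ^ (2 * k)) \<le> ennreal (\<integral>x. f' x ^ (2 * k) \<partial>U)"
    by (rule ennreal_leI)
  also have "\<dots> = (\<integral>\<^sup>+x. ennreal (f' x ^ (2 * k)) \<partial>U)"
    using int[OF ck] by (intro nn_integral_eq_integral[symmetric]) auto
  also have "\<dots> = (\<integral>\<^sup>+x. ennreal (f' x ^ (2 * k)) * indicator {0..1} x \<partial>lborel)"
    unfolding U_def by (subst nn_integral_restrict_space) auto
  also have "\<dots> = (\<integral>\<^sup>+x. ennreal (indicator {0..1} x * f' x ^ (2 * k)) \<partial>lborel)"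
    by (intro nn_integral_cong) (auto simp: indicator_def)
  finally show ?thesis .
qed

lemma normal_rv_shift:
  assumes "prob_space M" "normal_rv M X m v"
  shows "normal_rv M (\<lambda>\<omega>. c + X \<omega>) (c + m) v"
proof -
  interpret prob_space M by fact
  show ?thesis
  proof (cases "v = 0")
    case False
    then have "distributed M lborel X (normal_density m (sqrt v))" "v > 0"
      using assms(2) by (auto simp: normal_rv_def)
    from normal_density_affine[OF this(1), of 1 c] this(2) False assms(2)
    show ?thesis by (auto simp: normal_rv_def)
  qed (use assms(2) in \<open>auto simp: normal_rv_def\<close>)
qed

text \<open>Termwise, the mixed products cancel and
  \<open>(sin \<theta>)\<^sup>2 + (cos \<theta>)\<^sup>2 = 1\<close> collects the rest. It says that
  a rotated pair of independent copies has the characteristic function of the original pair.\<close>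

lemma quadratic_form_rotate:
  fixes s r :: "'i \<Rightarrow> real"
  shows "(\<Sum>i\<in>I. \<Sum>j\<in>I. (s i * sin \<theta> + r i * cos \<theta>) * (s j * sin \<theta> + r j * cos \<theta>) * \<sigma> i j)
     + (\<Sum>i\<in>I. \<Sum>j\<in>I. (s i * cos \<theta> - r i * sin \<theta>) * (s j * cos \<theta> - r j * sin \<theta>) * \<sigma> i j)
     = (\<Sum>i\<in>I. \<Sum>j\<in>I. s i * s j * \<sigma> i j) + (\<Sum>i\<in>I. \<Sum>j\<in>I. r i * r j * \<sigma> i j)"
proof -
  have "(x * S + y * C) * (x' * S + y' * C) * q + (x * C - y * S) * (x' * C - y' * S) * q = x * x' * q + y * y' * q"
    if "S\<^sup>2 + C\<^sup>2 = 1" for x y x' y' q S C :: real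
  proof -
    have "(x * S + y * C) * (x' * S + y' * C) * q + (x * C - y * S) * (x' * C - y' * S) * q
      = (x * x' * q + y * y' * q) * (S\<^sup>2 + C\<^sup>2)" by (simp add: algebra_simps power2_eq_square)
    then show ?thesis unfolding that by simp
  qed
  from this[OF sin_cos_squared_add] show ?thesis unfolding sum.distrib[symmetric] by simp
qed

text \<open>The Maurey--Pisier argument: rotating an independent copy into the original vector leaves the
  joint law invariant, and along the rotation the derivative of the functional is, conditionally, a
  centred normal variable.\<close>

lemma gaussian_concentration_moment:
  fixes Z :: "'i \<Rightarrow> 'a \<Rightarrow> real" and g g' :: "'i \<Rightarrow> real \<Rightarrow> real" and B L :: real and k :: nat
  assumes M: "prob_space M" and mvn: "multivariate_normal M I Z \<mu> \<sigma>"
    and deriv: "\<And>i x. i \<in> I \<Longrightarrow> (g i has_real_derivative g' i x) (at x)"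
    and cont: "\<And>i. i \<in> I \<Longrightarrow> continuous_on UNIV (g' i)"
    and bounded: "\<And>i x. i \<in> I \<Longrightarrow> \<bar>g i x\<bar> \<le> B"
    and lipschitz: "\<And>i x. i \<in> I \<Longrightarrow> \<bar>g' i x\<bar> \<le> L"
  defines "F \<equiv> \<lambda>\<omega>. \<Sum>i\<in>I. g i (Z i \<omega>)"
  shows "(\<integral>\<^sup>+\<omega>. ennreal ((F \<omega> - (\<integral>\<omega>'. F \<omega>' \<partial>M)) ^ (2 * k)) \<partial>M)
    \<le> ennreal ((pi / 2) ^ (2 * k) * (fact (2 * k) / (2 ^ k * fact k) * (L\<^sup>2 * (\<Sum>i\<in>I. \<Sum>j\<in>I. \<bar>\<sigma> i j\<bar>)) ^ k))"
proof -
  interpret prob_space M by fact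
  interpret PP: pair_prob_space M M by unfold_locales
  have I [simp]: "finite I" and Zm: "\<And>i. i \<in> I \<Longrightarrow> Z i \<in> borel_measurable M"
    using mvn unfolding multivariate_normal_def by auto
  define Y where "Y i \<omega> = Z i \<omega> - \<mu> i" for i \<omega>
  have Ym: "Y i \<in> borel_measurable M" if "i \<in> I" for i
    using Zm[OF that] unfolding Y_def[abs_def] by measurable
  have Ym1 [measurable (raw)]: "(\<lambda>x. Y i (f x)) \<in> borel_measurable N" if "i \<in> I" "f \<in> N \<rightarrow>\<^sub>M M" for i f and N :: "'z measure"
    using measurable_compose[OF that(2) Ym[OF that(1)]] .
  define h' where "h' i y = g' i (\<mu> i + y)" for i y
  have h'c: "continuous_on UNIV (h' i)" if "i \<in> I" for i
    unfolding h'_def by (rule continuous_on_compose2[OF cont[OF that]]) (auto intro: continuous_intros)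
  have h'm: "h' i \<in> borel_measurable borel" if "i \<in> I" for i
    using h'c[OF that] by (rule borel_measurable_continuous_onI)
  have h'm1 [measurable (raw)]: "(\<lambda>x. h' i (f x)) \<in> borel_measurable N" if "i \<in> I" "f \<in> borel_measurable N" for i f and N :: "'z measure"
    using measurable_compose[OF that(2) h'm[OF that(1)]] .
  define q where "q u = (\<Sum>i\<in>I. \<Sum>j\<in>I. u i * u j * \<sigma> i j)" for u
  have Yn: "normal_rv M (\<lambda>\<omega>. \<Sum>i\<in>I. u i * Y i \<omega>) 0 (q u)" for u
  proof -
    have "normal_rv M (\<lambda>\<omega>. \<Sum>i\<in>I. u i * Z i \<omega>) (\<Sum>i\<in>I. u i * \<mu> i) (q u)"
      using mvn unfolding multivariate_normal_def q_def by blast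
    from normal_rv_shift[OF M this, of "- (\<Sum>i\<in>I. u i * \<mu> i)"] show ?thesis
      by (simp add: Y_def right_diff_distrib sum_subtractf)
  qed
  have cosPP: "(\<integral>z. cos ((\<Sum>i\<in>I. u i * Y i (fst z)) + (\<Sum>i\<in>I. w i * Y i (snd z)) + \<theta>) \<partial>(M \<Otimes>\<^sub>M M))
      = exp (- (q u + q w) / 2) * cos \<theta>" for u w \<theta>
  proof -
    have "(\<integral>z. cos ((\<Sum>i\<in>I. u i * Y i (fst z)) + (\<Sum>i\<in>I. w i * Y i (snd z)) + \<theta>) \<partial>(M \<Otimes>\<^sub>M M))
        = (\<integral>\<omega>. (\<integral>\<omega>'. cos ((\<Sum>i\<in>I. w i * Y i \<omega>') + ((\<Sum>i\<in>I. u i * Y i \<omega>) + \<theta>)) \<partial>M) \<partial>M)"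
      by (subst PP.integral_fst'[symmetric])
        (auto simp: add_ac intro!: PP.P.integrable_const_bound[of _ 1])
    also have "\<dots> = exp (- q w / 2) * (\<integral>\<omega>. cos ((\<Sum>i\<in>I. u i * Y i \<omega>) + \<theta>) \<partial>M)"
      unfolding normal_rv_cos[OF M Yn[of w]] by simp
    also have "\<dots> = exp (- q w / 2) * (exp (- q u / 2) * cos \<theta>)"
      unfolding normal_rv_cos[OF M Yn[of u]] by simp
    also have "\<dots> = exp (- (q u + q w) / 2) * cos \<theta>"
    proof -
      have "exp (- (q u + q w) / 2) = exp (- q w / 2) * exp (- q u / 2)"
        by (simp add: field_simps flip: exp_add)
      then show ?thesis by simp
    qed
    finally show ?thesis .
  qed
  \<comment> \<open>Joint law of the rotation and its velocity: index \<open>(i, True)\<close>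
    carries the rotated coordinate, \<open>(i, False)\<close> its derivative in the angle.
    \<open>A0\<close> is the pair of independent copies to which both are reduced.\<close>
  define J where "J = I \<times> (UNIV :: bool set)"
  have J [simp]: "finite J" by (simp add: J_def)
  have sumJ: "(\<Sum>j\<in>J. f j) = (\<Sum>i\<in>I. f (i, True) + f (i, False))" for f :: "'i \<times> bool \<Rightarrow> real"
    unfolding J_def using sum.cartesian_product[of "\<lambda>i b. f (i, b)" UNIV I] by (simp add: UNIV_bool add.commute)
  define A where "A \<theta> j z = (if snd j then sin \<theta> * Y (fst j) (fst z) + cos \<theta> * Y (fst j) (snd z)
     else cos \<theta> * Y (fst j) (fst z) - sin \<theta> * Y (fst j) (snd z))" for \<theta> and j :: "'i \<times> bool" and z
  define A0 where "A0 j z = (if snd j then Y (fst j) (fst z) else Y (fst j) (snd z))" for j :: "'i \<times> bool" and z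
  have Am: "A \<theta> j \<in> borel_measurable (M \<Otimes>\<^sub>M M)" "A0 j \<in> borel_measurable (M \<Otimes>\<^sub>M M)" if "j \<in> J" for j \<theta>
  proof -
    have "fst j \<in> I" using that by (auto simp: J_def)
    then show "A \<theta> j \<in> borel_measurable (M \<Otimes>\<^sub>M M)" "A0 j \<in> borel_measurable (M \<Otimes>\<^sub>M M)"
      unfolding A_def A0_def by (cases "snd j"; simp; measurable)+
  qed
  have law: "distr (M \<Otimes>\<^sub>M M) (PiM J (\<lambda>_. borel)) (\<lambda>z. \<lambda>j\<in>J. A \<theta> j z)
      = distr (M \<Otimes>\<^sub>M M) (PiM J (\<lambda>_. borel)) (\<lambda>z. \<lambda>j\<in>J. A0 j z)" for \<theta>
  proof (rule cos_law_unique[OF PP.P.prob_space_axioms PP.P.prob_space_axioms J Am])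
    fix s :: "'i \<times> bool \<Rightarrow> real" and \<tau>
    let ?u = "\<lambda>i. s (i, True) * sin \<theta> + s (i, False) * cos \<theta>" and ?w = "\<lambda>i. s (i, True) * cos \<theta> - s (i, False) * sin \<theta>"
    have "(\<Sum>j\<in>J. s j * A \<theta> j z) = (\<Sum>i\<in>I. ?u i * Y i (fst z)) + (\<Sum>i\<in>I. ?w i * Y i (snd z))" for z
      unfolding sumJ sum.distrib[symmetric] by (intro sum.cong) (auto simp: A_def algebra_simps)
    then have "(\<integral>z. cos ((\<Sum>j\<in>J. s j * A \<theta> j z) + \<tau>) \<partial>(M \<Otimes>\<^sub>M M)) = exp (- (q ?u + q ?w) / 2) * cos \<tau>"
      using cosPP[of ?u ?w \<tau>] by simp
    also have "q ?u + q ?w = q (\<lambda>i. s (i, True)) + q (\<lambda>i. s (i, False))"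
      unfolding q_def by (rule quadratic_form_rotate)
    also have "exp (- (q (\<lambda>i. s (i, True)) + q (\<lambda>i. s (i, False))) / 2) * cos \<tau> = (\<integral>z. cos ((\<Sum>j\<in>J. s j * A0 j z) + \<tau>) \<partial>(M \<Otimes>\<^sub>M M))"
      unfolding cosPP[symmetric] sumJ sum.distrib by (simp add: A0_def)
    finally show "(\<integral>z. cos ((\<Sum>j\<in>J. s j * A \<theta> j z) + \<tau>) \<partial>(M \<Otimes>\<^sub>M M)) = (\<integral>z. cos ((\<Sum>j\<in>J. s j * A0 j z) + \<tau>) \<partial>(M \<Otimes>\<^sub>M M))" .
  qed
  \<comment> \<open>The moment of order \<open>2 * k\<close> of a centred normal variable with the
    largest variance that the Lipschitz constant allows.\<close>
  define c where "c = (fact (2 * k) / (2 ^ k * fact k) * (L\<^sup>2 * (\<Sum>i\<in>I. \<Sum>j\<in>I. \<bar>\<sigma> i j\<bar>)) ^ k :: real)"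
  have c0: "0 \<le> c" unfolding c_def by (intro mult_nonneg_nonneg zero_le_power[OF mult_nonneg_nonneg[OF zero_le_power2]] sum_nonneg) auto
  define \<Xi> where "\<Xi> f = (\<Sum>i\<in>I. h' i (f (i, True)) * f (i, False)) ^ (2 * k)" for f :: "'i \<times> bool \<Rightarrow> real"
  have \<Xi>m [measurable]: "\<Xi> \<in> borel_measurable (PiM J (\<lambda>_. borel))"
  proof -
    have *: "(\<lambda>f. f (i, b)) \<in> borel_measurable (PiM J (\<lambda>_. borel :: real measure))" if "i \<in> I" for i b
      using that by (intro measurable_component_singleton) (auto simp: J_def)
    show ?thesis unfolding \<Xi>_def
      by (intro borel_measurable_power borel_measurable_sum borel_measurable_times h'm1 *) 
  qed
  have rot: "(\<integral>\<^sup>+z. ennreal (\<Xi> (\<lambda>j\<in>J. A \<theta> j z)) \<partial>(M \<Otimes>\<^sub>M M)) \<le> ennreal c" for \<theta>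
  proof -
    have Arm: "(\<lambda>z. \<lambda>j\<in>J. A \<theta> j z) \<in> (M \<Otimes>\<^sub>M M) \<rightarrow>\<^sub>M PiM J (\<lambda>_. borel)" "(\<lambda>z. \<lambda>j\<in>J. A0 j z) \<in> (M \<Otimes>\<^sub>M M) \<rightarrow>\<^sub>M PiM J (\<lambda>_. borel)"
      by (intro measurable_restrict Am; assumption)+
    have "(\<integral>\<^sup>+z. ennreal (\<Xi> (\<lambda>j\<in>J. A \<theta> j z)) \<partial>(M \<Otimes>\<^sub>M M)) = (\<integral>\<^sup>+f. ennreal (\<Xi> f) \<partial>distr (M \<Otimes>\<^sub>M M) (PiM J (\<lambda>_. borel)) (\<lambda>z. \<lambda>j\<in>J. A \<theta> j z))"
      using Arm by (subst nn_integral_distr) auto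
    also have "\<dots> = (\<integral>\<^sup>+z. ennreal (\<Xi> (\<lambda>j\<in>J. A0 j z)) \<partial>(M \<Otimes>\<^sub>M M))"
      unfolding law using Arm by (subst nn_integral_distr) auto
    also have "\<dots> = (\<integral>\<^sup>+\<omega>. \<integral>\<^sup>+\<omega>'. ennreal (\<Xi> (\<lambda>j\<in>J. A0 j (\<omega>, \<omega>'))) \<partial>M \<partial>M)"
      using measurable_compose[OF Arm(2) \<Xi>m] by (intro nn_integral_fst[symmetric]) auto
    \<comment> \<open>With the first copy frozen the coefficients \<open>u i\<close> are constants,
      so the linear form in the second copy is exactly normal with variance \<open>q u\<close>.
      Absolute values of the covariances enter because the signs of the \<open>u i\<close> are
      unknown.\<close>
    also have "\<dots> \<le> (\<integral>\<^sup>+\<omega>. ennreal c \<partial>M)"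
    proof (rule nn_integral_mono)
      fix \<omega>
      define u where "u i = h' i (Y i \<omega>)" for i
      have uL: "\<bar>u i\<bar> \<le> L" if "i \<in> I" for i using lipschitz[OF that] by (simp add: u_def h'_def)
      have "\<Xi> (\<lambda>j\<in>J. A0 j (\<omega>, \<omega>')) = (\<Sum>i\<in>I. u i * Y i \<omega>') ^ (2 * k)" for \<omega>'
        unfolding \<Xi>_def u_def by (simp add: A0_def J_def cong: sum.cong)
      then have "(\<integral>\<^sup>+\<omega>'. ennreal (\<Xi> (\<lambda>j\<in>J. A0 j (\<omega>, \<omega>'))) \<partial>M) = ennreal (fact (2 * k) / (2 ^ k * fact k) * q u ^ k)"
        using normal_rv_even_moment[OF M Yn] by simp
      also have "\<dots> \<le> ennreal c"
        unfolding c_def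
      proof (intro ennreal_leI mult_left_mono power_mono)
        show "0 \<le> q u" using normal_rv_distr(1)[OF M Yn] .
        have "q u \<le> (\<Sum>i\<in>I. \<Sum>j\<in>I. L\<^sup>2 * \<bar>\<sigma> i j\<bar>)"
          unfolding q_def
        proof (intro sum_mono)
          fix i j assume ij: "i \<in> I" "j \<in> I"
          have "u i * u j * \<sigma> i j \<le> \<bar>u i\<bar> * \<bar>u j\<bar> * \<bar>\<sigma> i j\<bar>" by (simp flip: abs_mult)
          also have "\<dots> \<le> L * L * \<bar>\<sigma> i j\<bar>"
            using uL[OF ij(1)] uL[OF ij(2)] by (intro mult_mono) auto
          finally show "u i * u j * \<sigma> i j \<le> L\<^sup>2 * \<bar>\<sigma> i j\<bar>" by (simp add: power2_eq_square)
        qed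
        then show "q u \<le> L\<^sup>2 * (\<Sum>i\<in>I. \<Sum>j\<in>I. \<bar>\<sigma> i j\<bar>)" by (simp add: sum_distrib_left)
      qed auto
      finally show "(\<integral>\<^sup>+\<omega>'. ennreal (\<Xi> (\<lambda>j\<in>J. A0 j (\<omega>, \<omega>'))) \<partial>M) \<le> ennreal c" .
    qed
    also have "\<dots> = ennreal c" by (simp add: emeasure_space_1)
    finally show ?thesis .
  qed
  \<comment> \<open>A quarter circle from the second copy at \<open>x = 0\<close> to the first at
    \<open>x = 1\<close>; reparametrised to the unit interval, its speed is \<open>pi / 2\<close>,
    whence that factor in the bound.\<close>
  define G where "G x z = (\<Sum>i\<in>I. g i (\<mu> i + (sin (pi / 2 * x) * Y i (fst z) + cos (pi / 2 * x) * Y i (snd z))))" for x z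
  define G' where "G' x z = pi / 2 * (\<Sum>i\<in>I. h' i (sin (pi / 2 * x) * Y i (fst z) + cos (pi / 2 * x) * Y i (snd z))
      * (cos (pi / 2 * x) * Y i (fst z) - sin (pi / 2 * x) * Y i (snd z)))" for x z
  have G'm [measurable]: "(\<lambda>(z, x). G' x z) \<in> borel_measurable ((M \<Otimes>\<^sub>M M) \<Otimes>\<^sub>M lborel)"
    unfolding G'_def split_beta
    by (intro borel_measurable_times borel_measurable_sum borel_measurable_const h'm1; measurable)
  have G'\<Xi>: "G' x z ^ (2 * k) = (pi / 2) ^ (2 * k) * \<Xi> (\<lambda>j\<in>J. A (pi / 2 * x) j z)" for x z
    unfolding G'_def \<Xi>_def power_mult_distrib by (simp add: A_def J_def cong: sum.cong)
  have path: "ennreal ((F (fst z) - F (snd z)) ^ (2 * k)) \<le> (\<integral>\<^sup>+x. ennreal (indicator {0..1} x * G' x z ^ (2 * k)) \<partial>lborel)" for z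
  proof -
    have "F (fst z) = G 1 z" "F (snd z) = G 0 z" by (simp_all add: F_def G_def Y_def)
    moreover have "ennreal ((G 1 z - G 0 z) ^ (2 * k)) \<le> (\<integral>\<^sup>+x. ennreal (indicator {0..1} x * G' x z ^ (2 * k)) \<partial>lborel)"
    proof (rule power_even_increment_le)
      show "((\<lambda>x. G x z) has_real_derivative G' x z) (at x within {0..1})" for x
        unfolding G_def G'_def h'_def sum_distrib_left
        by (intro DERIV_sum DERIV_cong[OF DERIV_chain2[OF deriv]]; (assumption | (auto intro!: derivative_eq_intros)[1]))
          (auto simp: algebra_simps)
      show "continuous_on {0..1} (\<lambda>x. G' x z)"
        unfolding G'_def
        by (intro continuous_intros continuous_on_compose2[OF h'c]) auto
    qed
    ultimately show ?thesis by simp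
  qed
  have Fm [measurable]: "F \<in> borel_measurable M"
  proof -
    have "continuous_on UNIV (g i)" if "i \<in> I" for i
      using deriv[OF that] by (auto simp: continuous_on_eq_continuous_within intro: DERIV_isCont)
    then show ?thesis
      unfolding F_def using Zm by (intro borel_measurable_sum measurable_compose[OF Zm borel_measurable_continuous_onI]) auto
  qed
  have Fb: "\<bar>F \<omega>\<bar> \<le> card I * B" for \<omega>
    unfolding F_def by (intro order_trans[OF sum_abs sum_bounded_above] bounded)
  \<comment> \<open>Symmetrisation: by Jensen's inequality the mean may be replaced by an
    independent copy, which supplies the second endpoint of the path.\<close>
  have "(\<integral>\<^sup>+\<omega>. ennreal ((F \<omega> - (\<integral>\<omega>'. F \<omega>' \<partial>M)) ^ (2 * k)) \<partial>M)
      \<le> (\<integral>\<^sup>+\<omega>. (\<integral>\<^sup>+\<omega>'. ennreal ((F \<omega> - F \<omega>') ^ (2 * k)) \<partial>M) \<partial>M)"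
  proof (rule nn_integral_mono)
    fix \<omega>
    have iF: "integrable M F" by (rule integrable_const_bound[of _ "card I * B"]) (auto simp: Fb)
    have iD: "integrable M (\<lambda>\<omega>'. (F \<omega> - F \<omega>') ^ (2 * k))"
    proof (rule integrable_const_bound[of _ "(2 * (card I * B)) ^ (2 * k)"])
      have "\<bar>F \<omega> - F \<omega>'\<bar> \<le> 2 * (card I * B)" for \<omega>' using Fb[of \<omega>] Fb[of \<omega>'] by linarith
      then show "AE \<omega>' in M. norm ((F \<omega> - F \<omega>') ^ (2 * k)) \<le> (2 * (card I * B)) ^ (2 * k)"
        unfolding real_norm_def power_abs by (intro AE_I2 power_mono) auto
    qed measurable
    have "(F \<omega> - (\<integral>\<omega>'. F \<omega>' \<partial>M)) ^ (2 * k) = (\<integral>\<omega>'. F \<omega> - F \<omega>' \<partial>M) ^ (2 * k)"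
      using iF by (simp add: prob_space)
    also have "\<dots> \<le> (\<integral>\<omega>'. (F \<omega> - F \<omega>') ^ (2 * k) \<partial>M)"
      using iF iD by (intro jensens_inequality[where I=UNIV]) (auto intro: convex_power_even)
    finally have "ennreal ((F \<omega> - (\<integral>\<omega>'. F \<omega>' \<partial>M)) ^ (2 * k)) \<le> ennreal (\<integral>\<omega>'. (F \<omega> - F \<omega>') ^ (2 * k) \<partial>M)"
      by (rule ennreal_leI)
    also have "\<dots> = (\<integral>\<^sup>+\<omega>'. ennreal ((F \<omega> - F \<omega>') ^ (2 * k)) \<partial>M)"
      using iD by (intro nn_integral_eq_integral[symmetric]) auto
    finally show "ennreal ((F \<omega> - (\<integral>\<omega>'. F \<omega>' \<partial>M)) ^ (2 * k)) \<le> (\<integral>\<^sup>+\<omega>'. ennreal ((F \<omega> - F \<omega>') ^ (2 * k)) \<partial>M)" .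
  qed
  also have "\<dots> = (\<integral>\<^sup>+z. ennreal ((F (fst z) - F (snd z)) ^ (2 * k)) \<partial>(M \<Otimes>\<^sub>M M))"
    by (subst nn_integral_fst[symmetric]) auto
  also have "\<dots> \<le> (\<integral>\<^sup>+z. (\<integral>\<^sup>+x. ennreal (indicator {0..1} x * G' x z ^ (2 * k)) \<partial>lborel) \<partial>(M \<Otimes>\<^sub>M M))"
    by (intro nn_integral_mono path)
  also have "\<dots> = (\<integral>\<^sup>+x. (\<integral>\<^sup>+z. ennreal (indicator {0..1} x * G' x z ^ (2 * k)) \<partial>(M \<Otimes>\<^sub>M M)) \<partial>lborel)"
  proof -
    interpret Q: pair_sigma_finite "M \<Otimes>\<^sub>M M" lborel by unfold_locales
    show ?thesis
      by (rule Q.Fubini'[symmetric]) (unfold split_beta, use G'm[unfolded split_beta] in measurable)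
  qed
  also have "\<dots> \<le> (\<integral>\<^sup>+x. ennreal ((pi / 2) ^ (2 * k) * c) * indicator {0..1::real} x \<partial>lborel)"
  proof (rule nn_integral_mono)
    fix x :: real
    have Arm: "(\<lambda>z. \<lambda>j\<in>J. A \<theta> j z) \<in> (M \<Otimes>\<^sub>M M) \<rightarrow>\<^sub>M PiM J (\<lambda>_. borel)" for \<theta>
      by (intro measurable_restrict Am)
    have "(\<integral>\<^sup>+z. ennreal (G' x z ^ (2 * k)) \<partial>(M \<Otimes>\<^sub>M M))
        = ennreal ((pi / 2) ^ (2 * k)) * (\<integral>\<^sup>+z. ennreal (\<Xi> (\<lambda>j\<in>J. A (pi / 2 * x) j z)) \<partial>(M \<Otimes>\<^sub>M M))"
      unfolding G'\<Xi> using measurable_compose[OF Arm \<Xi>m]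
      by (subst nn_integral_cmult[symmetric]) (auto simp: ennreal_mult' intro!: nn_integral_cong)
    also have "\<dots> \<le> ennreal ((pi / 2) ^ (2 * k)) * ennreal c"
      by (intro mult_left_mono rot) auto
    finally show "(\<integral>\<^sup>+z. ennreal (indicator {0..1} x * G' x z ^ (2 * k)) \<partial>(M \<Otimes>\<^sub>M M)) \<le> ennreal ((pi / 2) ^ (2 * k) * c) * indicator {0..1} x"
      by (auto simp: indicator_def ennreal_mult' c0)
  qed
  also have "\<dots> = ennreal ((pi / 2) ^ (2 * k) * c)"
    by (subst nn_integral_cmult_indicator) auto
  finally show ?thesis unfolding c_def .
qed

section \<open>Smooth brackets for the indicator of a rejection\<close>

definition ramp :: "real \<Rightarrow> real" where
  "ramp u = 2 * (max 0 u)\<^sup>2 - 4 * (max 0 (u - 1/2))\<^sup>2 + 2 * (max 0 (u - 1))\<^sup>2"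

definition ramp' :: "real \<Rightarrow> real" where
  "ramp' u = 4 * max 0 u - 8 * max 0 (u - 1/2) + 4 * max 0 (u - 1)"

lemma DERIV_max_0_power2: "((\<lambda>u. (max 0 u)\<^sup>2) has_real_derivative 2 * max 0 x) (at x)" for x :: real
proof (cases x "0 :: real" rule: linorder_cases)
  case less
  have "((\<lambda>u. 0 :: real) has_real_derivative 2 * max 0 x) (at x)" using less by simp
  then show ?thesis
    by (rule has_field_derivative_transform_within_open[of _ _ _ "{..<0}"]) (use less in auto)
next
  case greater
  have "((\<lambda>u. u\<^sup>2) has_real_derivative 2 * max 0 x) (at x)"
    using greater by (auto intro!: derivative_eq_intros)
  then show ?thesis
    by (rule has_field_derivative_transform_within_open[of _ _ _ "{0<..}"]) (use greater in auto)
next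
  case equal
  have "((\<lambda>h::real. (max 0 h)\<^sup>2 / h) \<longlongrightarrow> 0) (at 0)"
  proof (rule Lim_null_comparison)
    show "\<forall>\<^sub>F h in at 0. norm ((max 0 h)\<^sup>2 / h) \<le> \<bar>h\<bar>" for h :: real
      by (auto simp: max_def power2_eq_square)
    show "((\<lambda>h::real. \<bar>h\<bar>) \<longlongrightarrow> 0) (at 0)" by (auto intro!: tendsto_eq_intros)
  qed
  then show ?thesis using equal by (simp add: DERIV_def)
qed

text \<open>Truncated squares are continuously differentiable, so the knots 0, 1/2 and 1 require no
  matching. The coefficients let the slope rise to 2 at 1/2 and return to 0 at 1; one continuous
  derivative is what the concentration bound asks for.\<close>

lemma DERIV_ramp: "(ramp has_real_derivative ramp' x) (at x)"
proof -
  have "((\<lambda>u. (max 0 (u - c))\<^sup>2) has_real_derivative 2 * max 0 (x - c)) (at x)" for c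
  proof -
    have "((\<lambda>u. u - c) has_real_derivative 1) (at x)" by (auto intro!: derivative_eq_intros)
    from DERIV_chain2[OF DERIV_max_0_power2 this] show ?thesis by simp
  qed
  note d = this
  have "(ramp has_real_derivative 2 * (2 * max 0 x) - 4 * (2 * max 0 (x - 1/2)) + 2 * (2 * max 0 (x - 1))) (at x)"
    unfolding ramp_def by (intro DERIV_add DERIV_diff DERIV_cmult d DERIV_max_0_power2)
  then show ?thesis by (simp add: ramp'_def)
qed

lemma ramp'_continuous: "continuous_on S ramp'"
  unfolding ramp'_def by (intro continuous_intros)

lemma ramp'_bound: "\<bar>ramp' u\<bar> \<le> 2"
  by (auto simp: ramp'_def max_def)

lemma ramp_0: "u \<le> 0 \<Longrightarrow> ramp u = 0"
  by (simp add: ramp_def)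

lemma ramp_1: "1 \<le> u \<Longrightarrow> ramp u = 1"
  by (simp add: ramp_def max_def power2_eq_square algebra_simps)

lemma ramp_range: "0 \<le> ramp u" "ramp u \<le> 1"
proof -
  consider "u \<le> 0" | "0 < u" "u \<le> 1/2" | "1/2 < u" "u < 1" | "1 \<le> u" by linarith
  then have "0 \<le> ramp u \<and> ramp u \<le> 1"
  proof cases
    case 2
    then have "u\<^sup>2 \<le> (1/2)\<^sup>2" by (intro power_mono) auto
    with 2 show ?thesis by (auto simp: ramp_def power2_eq_square)
  next
    case 3
    then have "ramp u = 1 - 2 * (1 - u)\<^sup>2" by (simp add: ramp_def power2_eq_square algebra_simps)
    moreover have "(1 - u)\<^sup>2 \<le> (1/2)\<^sup>2" using 3 by (intro power_mono) auto
    ultimately show ?thesis by (auto simp: power2_eq_square)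
  qed (auto simp: ramp_0 ramp_1)
  then show "0 \<le> ramp u" "ramp u \<le> 1" by auto
qed

definition two_sided_ramp :: "real \<Rightarrow> real \<Rightarrow> real \<Rightarrow> real" where
  "two_sided_ramp \<eta> b x = ramp ((x - b) / \<eta>) + ramp ((- x - b) / \<eta>)"

definition two_sided_ramp' :: "real \<Rightarrow> real \<Rightarrow> real \<Rightarrow> real" where
  "two_sided_ramp' \<eta> b x = (ramp' ((x - b) / \<eta>) - ramp' ((- x - b) / \<eta>)) / \<eta>"

lemma DERIV_two_sided_ramp:
  "\<eta> > 0 \<Longrightarrow> (two_sided_ramp \<eta> b has_real_derivative two_sided_ramp' \<eta> b x) (at x)"
  unfolding two_sided_ramp_def two_sided_ramp'_def
  by (auto intro!: derivative_eq_intros DERIV_chain2[OF DERIV_ramp] simp: field_simps)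

lemma two_sided_ramp'_continuous: "\<eta> > 0 \<Longrightarrow> continuous_on UNIV (two_sided_ramp' \<eta> b)"
  unfolding two_sided_ramp'_def
  by (intro continuous_intros continuous_on_compose2[OF ramp'_continuous[of UNIV]]) auto

lemma two_sided_ramp'_bound: "\<eta> > 0 \<Longrightarrow> \<bar>two_sided_ramp' \<eta> b x\<bar> \<le> 4 / \<eta>"
  using ramp'_bound[of "(x - b) / \<eta>"] ramp'_bound[of "(- x - b) / \<eta>"]
  unfolding two_sided_ramp'_def by (simp add: divide_right_mono)

lemma two_sided_ramp_bound: "\<bar>two_sided_ramp \<eta> b x\<bar> \<le> 2"
  using ramp_range[of "(x - b) / \<eta>"] ramp_range[of "(- x - b) / \<eta>"] by (simp add: two_sided_ramp_def)

lemma two_sided_ramp_measurable [measurable]: "\<eta> > 0 \<Longrightarrow> two_sided_ramp \<eta> b \<in> borel_measurable borel"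
  using DERIV_two_sided_ramp[of \<eta> b]
  by (intro borel_measurable_continuous_onI) (auto simp: continuous_on_eq_continuous_within intro: DERIV_isCont)

lemma two_sided_ramp_ge:
  assumes "\<eta> > 0"
  shows "of_bool (\<bar>x\<bar> > b + \<eta>) \<le> two_sided_ramp \<eta> b x"
proof (cases "\<bar>x\<bar> > b + \<eta>")
  case True
  then have "1 \<le> (x - b) / \<eta> \<or> 1 \<le> (- x - b) / \<eta>" using assms by (auto simp: field_simps abs_if split: if_splits)
  then show ?thesis
    using ramp_1[of "(x - b) / \<eta>"] ramp_1[of "(- x - b) / \<eta>"] ramp_range[of "(x - b) / \<eta>"] ramp_range[of "(- x - b) / \<eta>"]
    unfolding two_sided_ramp_def by auto
qed (simp add: two_sided_ramp_def ramp_range)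

text \<open>The bound is a sum of two indicators, not the indicator of
  \<open>\<bar>x\<bar> > b\<close>, because \<open>b = a - \<eta>\<close> may be negative; the two
  events then overlap and both ramps can be active.\<close>

lemma two_sided_ramp_le:
  assumes "\<eta> > 0"
  shows "two_sided_ramp \<eta> b x \<le> of_bool (x > b) + of_bool (x < - b)"
proof -
  have "ramp ((y - b) / \<eta>) \<le> of_bool (y > b)" for y
    using assms ramp_0[of "(y - b) / \<eta>"] ramp_range[of "(y - b) / \<eta>"]
    by (auto simp: divide_le_0_iff)
  from this[of x] this[of "- x"] show ?thesis
    unfolding two_sided_ramp_def by (smt (verit) of_bool_eq_iff)
qed

lemma Phi_Lipschitz: "\<bar>Phi x - Phi y\<bar> \<le> \<bar>x - y\<bar>"
proof -
  have "std_normal_density z \<le> 1" for z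
  proof -
    have "1 / sqrt (2 * pi) * exp (- z\<^sup>2 / 2) \<le> 1 * 1"
      using pi_ge_two by (intro mult_mono) (auto simp: real_le_rsqrt)
    then show ?thesis by (simp add: std_normal_density_def)
  qed
  then show ?thesis
    using field_differentiable_bound[of UNIV Phi std_normal_density 1 x y] DERIV_Phi by auto
qed

lemma two_sided_tail_expectation:
  assumes "prob_space M" "normal_rv M X m 1"
  shows "(\<integral>\<omega>. of_bool (X \<omega> > b) + of_bool (X \<omega> < - b) \<partial>M) = 1 - Phi (b - m) + Phi (- b - m)"
    "integrable M (\<lambda>\<omega>. of_bool (X \<omega> > b) + of_bool (X \<omega> < - b) :: real)"
proof -
  interpret prob_space M by fact
  note [measurable] = normal_rv_measurable[OF assms(2)]
  show "integrable M (\<lambda>\<omega>. of_bool (X \<omega> > b) + of_bool (X \<omega> < - b) :: real)"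
    by (rule integrable_const_bound[of _ 2]) auto
  have "(\<integral>\<omega>. of_bool (X \<omega> > b) + of_bool (X \<omega> < - b) \<partial>M :: real) =
      (\<integral>\<omega>. (1 - indicator {\<omega>\<in>space M. X \<omega> \<le> b} \<omega>) + indicator {\<omega>\<in>space M. X \<omega> < - b} \<omega> \<partial>M)"
    by (intro Bochner_Integration.integral_cong) (auto simp: indicator_def)
  also have "\<dots> = (1 - measure M {\<omega>\<in>space M. X \<omega> \<le> b}) + measure M {\<omega>\<in>space M. X \<omega> < - b}"
    by (subst Bochner_Integration.integral_add Bochner_Integration.integral_diff; (simp add: prob_space Int_absorb2 integrable_indicator_iff emeasure_eq_measure)?)+
  also have "\<dots> = 1 - Phi (b - m) + Phi (- b - m)"
    using normal_rv_cdf[OF assms(1,2)] by simp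
  finally show "(\<integral>\<omega>. of_bool (X \<omega> > b) + of_bool (X \<omega> < - b) \<partial>M) = 1 - Phi (b - m) + Phi (- b - m)" .
qed

lemma xi_tail: "xi t m = 1 - Phi (\<bar>zq (t / 2)\<bar> - m) + Phi (- \<bar>zq (t / 2)\<bar> - m)" if "0 < t" "t < 1"
proof -
  have z: "zq (t / 2) = - \<bar>zq (t / 2)\<bar>" using zq_half_cutoff[OF that] by simp
  show ?thesis unfolding xi_def
    using Phi_uminus[of "\<bar>zq (t / 2)\<bar> - m"] by (subst (1 2) z) simp
qed

text \<open>\<open>Phi\<close> is 1-Lipschitz, so shifting both cutoffs by \<eta> changes the
  rejection probability by at most \<open>2 * \<eta>\<close>, whatever the mean is. This uniformity
  admits arbitrary alternatives.\<close>

lemma ramp_brackets_test: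
  fixes t \<eta> m :: real and X :: "'a \<Rightarrow> real"
  assumes t: "0 < t" "t < 1" and \<eta>: "\<eta> > 0" and M: "prob_space M" "normal_rv M X m 1"
  defines "a \<equiv> \<bar>zq (t / 2)\<bar>"
  shows "two_sided_ramp \<eta> a x \<le> test t x" "test t x \<le> two_sided_ramp \<eta> (a - \<eta>) x"
    "(\<integral>\<omega>. two_sided_ramp \<eta> (a - \<eta>) (X \<omega>) \<partial>M) \<le> xi t m + 2 * \<eta>"
    "(\<integral>\<omega>. two_sided_ramp \<eta> a (X \<omega>) \<partial>M) \<ge> xi t m - 2 * \<eta>"
proof -
  interpret prob_space M by fact
  note [measurable] = normal_rv_measurable[OF M(2)]
  have a: "a > 0" using zq_half_cutoff[OF t] by (simp add: a_def)
  show "test t x \<le> two_sided_ramp \<eta> (a - \<eta>) x"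
    using two_sided_ramp_ge[OF \<eta>, of "a - \<eta>" x] by (simp add: test_def a_def)
  show "two_sided_ramp \<eta> a x \<le> test t x"
    using two_sided_ramp_le[OF \<eta>, of a x] a by (auto simp: test_def a_def[symmetric] of_bool_def split: if_splits)
  have int: "integrable M (\<lambda>\<omega>. two_sided_ramp \<eta> b (X \<omega>))" for b
    by (rule integrable_const_bound[of _ 2]) (use \<eta> two_sided_ramp_bound in auto)
  have xi: "xi t m = 1 - Phi (a - m) + Phi (- a - m)" using xi_tail[OF t] by (simp add: a_def)
  have "(\<integral>\<omega>. two_sided_ramp \<eta> (a - \<eta>) (X \<omega>) \<partial>M) \<le> 1 - Phi (a - \<eta> - m) + Phi (- (a - \<eta>) - m)"
    unfolding two_sided_tail_expectation(1)[OF M, symmetric]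
    by (intro integral_mono int two_sided_tail_expectation(2)[OF M] two_sided_ramp_le[OF \<eta>])
  then show "(\<integral>\<omega>. two_sided_ramp \<eta> (a - \<eta>) (X \<omega>) \<partial>M) \<le> xi t m + 2 * \<eta>"
    using Phi_Lipschitz[of "a - \<eta> - m" "a - m"] Phi_Lipschitz[of "- (a - \<eta>) - m" "- a - m"] \<eta> unfolding xi by simp
  have "1 - Phi (a + \<eta> - m) + Phi (- (a + \<eta>) - m) \<le> (\<integral>\<omega>. two_sided_ramp \<eta> a (X \<omega>) \<partial>M)"
    unfolding two_sided_tail_expectation(1)[OF M, symmetric]
  proof (intro integral_mono int two_sided_tail_expectation(2)[OF M])
    fix \<omega>
    have "of_bool (X \<omega> > a + \<eta>) + of_bool (X \<omega> < - (a + \<eta>)) = (of_bool (\<bar>X \<omega>\<bar> > a + \<eta>) :: real)"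
      using a \<eta> by auto
    then show "of_bool (X \<omega> > a + \<eta>) + of_bool (X \<omega> < - (a + \<eta>)) \<le> two_sided_ramp \<eta> a (X \<omega>)"
      using two_sided_ramp_ge[OF \<eta>, of a "X \<omega>"] by simp
  qed
  then show "(\<integral>\<omega>. two_sided_ramp \<eta> a (X \<omega>) \<partial>M) \<ge> xi t m - 2 * \<eta>"
    using Phi_Lipschitz[of "a + \<eta> - m" "a - m"] Phi_Lipschitz[of "- (a + \<eta>) - m" "- a - m"] \<eta> unfolding xi by simp
qed

lemma markov_even_moment:
  assumes "prob_space M" and [measurable]: "f \<in> borel_measurable M" and "s > 0" "0 \<le> B"
    and moment: "(\<integral>\<^sup>+\<omega>. ennreal (f \<omega> ^ (2 * k)) \<partial>M) \<le> ennreal B"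
  shows "measure M {\<omega>\<in>space M. s \<le> \<bar>f \<omega>\<bar>} \<le> B / s ^ (2 * k)"
proof -
  interpret prob_space M by fact
  have "emeasure M {\<omega>\<in>space M. s \<le> \<bar>f \<omega>\<bar>} * ennreal (s ^ (2 * k))
      = (\<integral>\<^sup>+\<omega>. ennreal (s ^ (2 * k)) * indicator {\<omega>\<in>space M. s \<le> \<bar>f \<omega>\<bar>} \<omega> \<partial>M)"
    by (subst nn_integral_cmult_indicator) (auto simp: mult.commute)
  also have "\<dots> \<le> (\<integral>\<^sup>+\<omega>. ennreal (f \<omega> ^ (2 * k)) \<partial>M)"
  proof (rule nn_integral_mono)
    fix \<omega>
    have "s ^ (2 * k) \<le> \<bar>f \<omega>\<bar> ^ (2 * k)" if "s \<le> \<bar>f \<omega>\<bar>"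
      using that \<open>s > 0\<close> by (intro power_mono) auto
    then show "ennreal (s ^ (2 * k)) * indicator {\<omega>\<in>space M. s \<le> \<bar>f \<omega>\<bar>} \<omega> \<le> ennreal (f \<omega> ^ (2 * k))"
      by (auto simp: indicator_def power_even_abs intro!: ennreal_leI)
  qed
  also note moment
  finally have "ennreal (measure M {\<omega>\<in>space M. s \<le> \<bar>f \<omega>\<bar>} * s ^ (2 * k)) \<le> ennreal B"
    by (simp add: emeasure_eq_measure ennreal_mult')
  then have "measure M {\<omega>\<in>space M. s \<le> \<bar>f \<omega>\<bar>} * s ^ (2 * k) \<le> B"
    using \<open>0 \<le> B\<close> by simp
  then show ?thesis using \<open>s > 0\<close> by (simp add: field_simps)
qed

text \<open>The count lies pointwise between two ramp sums whose means are within
  \<open>2 * \<eta> * card I\<close> of its own mean on the relevant side. A deviation of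
  \<open>4 * \<eta> * card I\<close> thus forces one ramp sum to deviate from its mean by half of
  that, and the moment bound applies; \<open>16 / \<eta>\<^sup>2\<close> is the squared Lipschitz
  constant of a two-sided ramp.\<close>

lemma rejection_proportion_concentration:
  fixes t \<eta> :: real and k :: nat and Z :: "'i \<Rightarrow> 'a \<Rightarrow> real"
  assumes t: "0 < t" "t < 1" and \<eta>: "\<eta> > 0"
    and M: "prob_space M" and mvn: "multivariate_normal M I Z \<mu> \<sigma>"
    and unit: "\<And>i. i \<in> I \<Longrightarrow> \<sigma> i i = 1" and "I \<noteq> {}"
  shows "measure M {\<omega>\<in>space M. 4 * \<eta> * card I \<le> \<bar>(\<Sum>i\<in>I. test t (Z i \<omega>)) - (\<Sum>i\<in>I. xi t (\<mu> i))\<bar>}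
    \<le> 2 * ((pi / 2) ^ (2 * k) * (fact (2 * k) / (2 ^ k * fact k)) * (16 / \<eta>\<^sup>2) ^ k / (2 * \<eta>) ^ (2 * k))
       * ((\<Sum>i\<in>I. \<Sum>j\<in>I. \<bar>\<sigma> i j\<bar>) / (real (card I))\<^sup>2) ^ k"
proof -
  interpret prob_space M by fact
  define a where "a = \<bar>zq (t / 2)\<bar>"
  have I: "finite I" and Zm: "\<And>i. i \<in> I \<Longrightarrow> Z i \<in> borel_measurable M"
    using mvn unfolding multivariate_normal_def by auto
  have Zn: "normal_rv M (Z i) (\<mu> i) 1" if "i \<in> I" for i
    using multivariate_normal_single[OF mvn that] unit[OF that] by simp
  define F where "F b \<omega> = (\<Sum>i\<in>I. two_sided_ramp \<eta> b (Z i \<omega>))" for b \<omega>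
  have gm: "(\<lambda>\<omega>. two_sided_ramp \<eta> b (Z i \<omega>)) \<in> borel_measurable M" if "i \<in> I" for b i
    using measurable_compose[OF Zm[OF that] two_sided_ramp_measurable[OF \<eta>]] .
  have Fm [measurable]: "F b \<in> borel_measurable M" for b
    unfolding F_def using gm by (intro borel_measurable_sum)
  have gi: "integrable M (\<lambda>\<omega>. two_sided_ramp \<eta> b (Z i \<omega>))" if "i \<in> I" for b i
    by (rule integrable_const_bound[of _ 2]) (use gm[OF that] two_sided_ramp_bound in auto)
  have EF: "(\<integral>\<omega>. F b \<omega> \<partial>M) = (\<Sum>i\<in>I. \<integral>\<omega>. two_sided_ramp \<eta> b (Z i \<omega>) \<partial>M)" for b
    unfolding F_def using gi by (intro Bochner_Integration.integral_sum)
  define S where "S = (\<Sum>i\<in>I. \<Sum>j\<in>I. \<bar>\<sigma> i j\<bar>)"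
  have S0: "0 \<le> S" unfolding S_def by (intro sum_nonneg) auto
  define N where "N = real (card I)"
  have N: "N > 0" using I \<open>I \<noteq> {}\<close> by (simp add: N_def card_gt_0_iff)
  define c where "c = (pi / 2) ^ (2 * k) * (fact (2 * k) / (2 ^ k * fact k) * ((4 / \<eta>)\<^sup>2 * S) ^ k)"
  have c0: "0 \<le> c" unfolding c_def using S0 by simp
  define T where "T b = measure M {\<omega>\<in>space M. 2 * \<eta> * N \<le> \<bar>F b \<omega> - (\<integral>\<omega>. F b \<omega> \<partial>M)\<bar>}" for b
  have tail: "T b \<le> c / (2 * \<eta> * N) ^ (2 * k)" for b
    unfolding T_def
  proof (rule markov_even_moment[OF M _ _ c0])
    show "(\<integral>\<^sup>+\<omega>. ennreal ((F b \<omega> - (\<integral>\<omega>. F b \<omega> \<partial>M)) ^ (2 * k)) \<partial>M) \<le> ennreal c"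
      unfolding F_def c_def S_def
      by (rule gaussian_concentration_moment[OF M mvn, where B=2 and g'="\<lambda>_. two_sided_ramp' \<eta> b"])
        (auto intro: \<eta> DERIV_two_sided_ramp two_sided_ramp'_continuous two_sided_ramp'_bound two_sided_ramp_bound)
  qed (use \<eta> N in auto)
  let ?R = "\<lambda>\<omega>. \<Sum>i\<in>I. test t (Z i \<omega>)" and ?r = "\<Sum>i\<in>I. xi t (\<mu> i)"
  let ?E = "\<lambda>b. {\<omega>\<in>space M. 2 * \<eta> * N \<le> \<bar>F b \<omega> - (\<integral>\<omega>. F b \<omega> \<partial>M)\<bar>}"
  note bracket = ramp_brackets_test[OF t \<eta> M Zn, folded a_def]
  have up: "(\<integral>\<omega>. F (a - \<eta>) \<omega> \<partial>M) \<le> ?r + 2 * \<eta> * N"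
  proof -
    have "(\<integral>\<omega>. F (a - \<eta>) \<omega> \<partial>M) \<le> (\<Sum>i\<in>I. xi t (\<mu> i) + 2 * \<eta>)"
      unfolding EF by (intro sum_mono bracket(3))
    then show ?thesis by (simp add: sum.distrib N_def mult_ac)
  qed
  have low: "(\<integral>\<omega>. F a \<omega> \<partial>M) \<ge> ?r - 2 * \<eta> * N"
  proof -
    have "(\<integral>\<omega>. F a \<omega> \<partial>M) \<ge> (\<Sum>i\<in>I. xi t (\<mu> i) - 2 * \<eta>)"
      unfolding EF by (intro sum_mono bracket(4))
    then show ?thesis by (simp add: sum_subtractf N_def mult_ac)
  qed
  have "{\<omega>\<in>space M. 4 * \<eta> * N \<le> \<bar>?R \<omega> - ?r\<bar>} \<subseteq> ?E (a - \<eta>) \<union> ?E a"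
  proof
    fix \<omega> assume w: "\<omega> \<in> {\<omega>\<in>space M. 4 * \<eta> * N \<le> \<bar>?R \<omega> - ?r\<bar>}"
    have "F a \<omega> \<le> ?R \<omega>" "?R \<omega> \<le> F (a - \<eta>) \<omega>"
      unfolding F_def by (intro sum_mono bracket(1,2); assumption)+
    with up low w show "\<omega> \<in> ?E (a - \<eta>) \<union> ?E a"
      by auto
  qed
  then have "measure M {\<omega>\<in>space M. 4 * \<eta> * N \<le> \<bar>?R \<omega> - ?r\<bar>} \<le> measure M (?E (a - \<eta>) \<union> ?E a)"
    by (intro finite_measure_mono) auto
  also have "\<dots> \<le> T (a - \<eta>) + T a"
    unfolding T_def by (intro measure_Un_le) auto
  also have "\<dots> \<le> 2 * (c / (2 * \<eta> * N) ^ (2 * k))" using tail[of a] tail[of "a - \<eta>"] by simp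
  also have "\<dots> = 2 * ((pi / 2) ^ (2 * k) * (fact (2 * k) / (2 ^ k * fact k)) * (16 / \<eta>\<^sup>2) ^ k / (2 * \<eta>) ^ (2 * k)) * (S / N\<^sup>2) ^ k"
    unfolding c_def by (simp add: power_mult_distrib power_divide power_mult)
  finally show ?thesis unfolding N_def S_def .
qed

section \<open>The linear part and the remainder\<close>

lemma test_covariance_expansion:
  fixes t :: real and Z :: "'i \<Rightarrow> 'a \<Rightarrow> real"
  assumes t: "0 < t" "t < 1" and M: "prob_space M" and mvn: "multivariate_normal M I Z \<mu> \<sigma>"
    and unit: "\<And>i. i \<in> I \<Longrightarrow> \<sigma> i i = 1" and ij: "i \<in> I" "j \<in> I" "i \<noteq> j" and null: "\<mu> j = 0"
  defines "a \<equiv> \<bar>zq (t / 2)\<bar>"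
  shows "\<bar>(\<integral>\<omega>. (test t (Z i \<omega>) - xi t (\<mu> i)) * (test t (Z j \<omega>) - xi t (\<mu> j)) \<partial>M)
     - a * std_normal_density a * H t (\<mu> i) * (\<sigma> i j)\<^sup>2\<bar> \<le> (2 * (28 * a ^ 3 + 22 * a) + 24) * (\<sigma> i j) ^ 4"
proof -
  interpret prob_space M by fact
  have Z: "Z i \<in> borel_measurable M" "Z j \<in> borel_measurable M" and sym: "\<sigma> j i = \<sigma> i j"
    using mvn ij unfolding multivariate_normal_def by auto
  note [measurable] = Z
  have n: "normal_rv M (Z i) (\<mu> i) 1" "normal_rv M (Z j) (\<mu> j) 1"
    using multivariate_normal_single[OF mvn] ij unit by auto
  have pair: "normal_rv M (\<lambda>\<omega>. s * Z j \<omega> + u * Z i \<omega>) (u * \<mu> i) (s\<^sup>2 + 2 * s * u * \<sigma> i j + u\<^sup>2)" for s u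
    using multivariate_normal_pair[OF mvn ij(2,1), of s u] ij unit null sym by simp
  have int: "integrable M (\<lambda>\<omega>. test t (Z i \<omega>))" "integrable M (\<lambda>\<omega>. test t (Z j \<omega>))"
    "integrable M (\<lambda>\<omega>. test t (Z i \<omega>) * test t (Z j \<omega>))"
    by (rule integrable_const_bound[of _ 1]; simp add: test_def)+
  have "(\<integral>\<omega>. (test t (Z i \<omega>) - xi t (\<mu> i)) * (test t (Z j \<omega>) - xi t (\<mu> j)) \<partial>M)
      = (\<integral>\<omega>. test t (Z i \<omega>) * test t (Z j \<omega>) - xi t (\<mu> j) * test t (Z i \<omega>) - xi t (\<mu> i) * test t (Z j \<omega>) + xi t (\<mu> i) * xi t (\<mu> j) \<partial>M)"
    by (simp add: algebra_simps)
  also have "\<dots> = (\<integral>\<omega>. test t (Z i \<omega>) * test t (Z j \<omega>) \<partial>M) - xi t (\<mu> i) * xi t (\<mu> j)"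
    using int expectation_test[OF t M n(1)] expectation_test[OF t M n(2)] by (simp add: prob_space)
  also have "\<dots> = (\<integral>\<omega>. test t (Z j \<omega>) * test t (Z i \<omega>) \<partial>M) - t * xi t (\<mu> i)"
    using null xi_zero[OF t] by (simp add: mult.commute)
  finally show ?thesis
    using normal_pair_test_covariance[OF M t pair] unfolding a_def by simp
qed

section \<open>Second moment of the linear part\<close>

lemma sum_off_diagonal:
  fixes f :: "'i \<Rightarrow> 'i \<Rightarrow> real"
  assumes "finite A"
  shows "(\<Sum>i\<in>A. \<Sum>j\<in>A. f i j) = (\<Sum>i\<in>A. f i i) + (\<Sum>i\<in>A. \<Sum>j\<in>A - {i}. f i j)"
  using assms by (simp add: sum.remove sum.distrib cong: sum.cong)

text \<open>The form is \<open>(1 - q) * U N0 - q * U N1\<close>. With \<beta> for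
  \<open>a * std_normal_density a\<close>, null pairs contribute at least
  \<open>2 * \<beta>\<^sup>2 * S0\<close> and cross pairs at most
  \<open>\<beta>\<^sup>2 * S0\<close>, up to \<open>S4\<close>; the combination
  \<open>2 * (1 - q)\<^sup>2 - 2 * q * (1 - q)\<close> equals
  \<open>2 * (1 - q) * (1 - 2 * q)\<close>. The pairs within \<open>N1\<close> enter as a square and
  are bounded below by zero.\<close>

lemma linear_part_second_moment_lower_bound:
  fixes t q :: real and Z :: "'i \<Rightarrow> 'a \<Rightarrow> real" and I N0 N1 :: "'i set"
  assumes t: "0 < t" "t < 1" and M: "prob_space M" and mvn: "multivariate_normal M I Z \<mu> \<sigma>"
    and unit: "\<And>i. i \<in> I \<Longrightarrow> \<sigma> i i = 1"
    and N0: "N0 = {i\<in>I. \<mu> i = 0}" and N1: "N1 = {i\<in>I. \<mu> i \<noteq> 0}"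
    and q: "0 \<le> q" "q \<le> 1 / 2"
  defines "a \<equiv> \<bar>zq (t / 2)\<bar>"
  defines "K \<equiv> 2 * (28 * a ^ 3 + 22 * a) + 24"
    and "S0 \<equiv> \<Sum>i\<in>N0. \<Sum>j\<in>N0 - {i}. (\<sigma> i j)\<^sup>2"
    and "S4 \<equiv> \<Sum>i\<in>I. \<Sum>j\<in>I - {i}. (\<sigma> i j) ^ 4"
    and "X \<equiv> \<lambda>i \<omega>. test t (Z i \<omega>) - xi t (\<mu> i)"
  assumes cross: "C_max t / (std_normal_density a * a)
      * (\<Sum>i\<in>{i\<in>N1. \<mu> i \<in> {- mu_root t..mu_root t}}. \<Sum>j\<in>N0. (\<sigma> i j)\<^sup>2) \<le> S0"
  shows "(1 - q)\<^sup>2 * (card N0 * (t * (1 - t))) + 2 * (1 - q) * (1 - 2 * q) * (a * std_normal_density a)\<^sup>2 * S0 - 2 * K * S4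
     \<le> (\<integral>\<omega>. ((\<Sum>i\<in>N0. X i \<omega>) - q * (\<Sum>i\<in>I. X i \<omega>))\<^sup>2 \<partial>M)"
proof -
  interpret prob_space M by fact
  have I: "finite I" and Zm: "\<And>i. i \<in> I \<Longrightarrow> Z i \<in> borel_measurable M"
    using mvn unfolding multivariate_normal_def by auto
  have sub: "N0 \<subseteq> I" "N1 \<subseteq> I" "N0 \<inter> N1 = {}" "N0 \<union> N1 = I" using N0 N1 by auto
  have fin: "finite N0" "finite N1" using I sub finite_subset by blast+
  have a: "a > 0" using zq_half_cutoff[OF t] by (simp add: a_def)
  have K: "K \<ge> 0" unfolding K_def using a by simp
  define \<beta> where "\<beta> = a * std_normal_density a"
  have \<beta>: "\<beta> > 0" unfolding \<beta>_def using a normal_density_pos[of 1] by simp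
  have xib: "0 \<le> xi t (\<mu> i)" "xi t (\<mu> i) \<le> 2" for i
    using xi_lower[OF t, of "\<mu> i"] t Phi_bounds(2)[of "zq (t / 2) + \<mu> i"] Phi_bounds(2)[of "zq (t / 2) - \<mu> i"]
    by (auto simp: xi_def)
  have Xb: "\<bar>X i \<omega>\<bar> \<le> 2" for i \<omega>
    using xib[of i] test_bounds(1,2)[of t "Z i \<omega>"] unfolding X_def by linarith
  have Xm: "X i \<in> borel_measurable M" if "i \<in> I" for i
    using Zm[OF that] unfolding X_def by measurable
  have XX: "integrable M (\<lambda>\<omega>. X i \<omega> * X j \<omega>)" if "i \<in> I" "j \<in> I" for i j
  proof (rule integrable_const_bound[of _ "2 * 2"])
    show "AE \<omega> in M. norm (X i \<omega> * X j \<omega>) \<le> 2 * 2"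
      unfolding real_norm_def abs_mult by (intro AE_I2 mult_mono Xb) auto
  qed (use Xm that in measurable)
  define c where "c i j = (\<integral>\<omega>. X i \<omega> * X j \<omega> \<partial>M)" for i j
  define U where "U A \<omega> = (\<Sum>i\<in>A. X i \<omega>)" for A \<omega>
  have UU: "(\<integral>\<omega>. U A \<omega> * U B \<omega> \<partial>M) = (\<Sum>i\<in>A. \<Sum>j\<in>B. c i j)" "integrable M (\<lambda>\<omega>. U A \<omega> * U B \<omega>)"
    if "A \<subseteq> I" "B \<subseteq> I" for A B
  proof -
    have *: "(\<lambda>\<omega>. U A \<omega> * U B \<omega>) = (\<lambda>\<omega>. \<Sum>i\<in>A. \<Sum>j\<in>B. X i \<omega> * X j \<omega>)"
      by (simp add: U_def sum_product)
    have XX': "integrable M (\<lambda>\<omega>. X i \<omega> * X j \<omega>)" if "i \<in> A" "j \<in> B" for i j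
      using that \<open>A \<subseteq> I\<close> \<open>B \<subseteq> I\<close> by (intro XX) auto
    show "integrable M (\<lambda>\<omega>. U A \<omega> * U B \<omega>)"
      unfolding * by (intro Bochner_Integration.integrable_sum XX')
    show "(\<integral>\<omega>. U A \<omega> * U B \<omega> \<partial>M) = (\<Sum>i\<in>A. \<Sum>j\<in>B. c i j)"
      unfolding * c_def
      by (subst Bochner_Integration.integral_sum, intro Bochner_Integration.integrable_sum XX', assumption+)
        (intro sum.cong refl Bochner_Integration.integral_sum XX'; assumption)
  qed
  have expansion: "\<bar>c i j - \<beta> * H t (\<mu> i) * (\<sigma> i j)\<^sup>2\<bar> \<le> K * (\<sigma> i j) ^ 4" if "i \<in> I" "j \<in> N0" "i \<noteq> j" for i j
    using test_covariance_expansion[OF t M mvn unit, of i j] that N0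
    unfolding c_def X_def \<beta>_def K_def a_def by auto
  \<comment> \<open>\<open>H\<close> at zero is \<open>2 * \<beta>\<close>, twice the normalising
    constant of \<open>cross\<close>: this factor 2 gives the null pairs their lead over the cross
    pairs.\<close>
  have H0: "H t 0 = 2 * std_normal_density a * a" by (simp add: H_def Let_def a_def[symmetric])
  have diag: "c i i = t * (1 - t)" if "i \<in> N0" for i
  proof -
    have i: "i \<in> I" "\<mu> i = 0" using that N0 by auto
    note [measurable] = Zm[OF i(1)]
    have n: "normal_rv M (Z i) 0 1" using multivariate_normal_single[OF mvn i(1)] unit i by simp
    have int: "integrable M (\<lambda>\<omega>. test t (Z i \<omega>))"
      by (rule integrable_const_bound[of _ 1]) (auto simp: test_def)
    have "c i i = (\<integral>\<omega>. (1 - 2 * t) * test t (Z i \<omega>) + t\<^sup>2 \<partial>M)"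
      unfolding c_def X_def i(2) xi_zero[OF t] using test_bounds(3)
      by (intro Bochner_Integration.integral_cong) (auto simp: power2_eq_square algebra_simps)
    also have "\<dots> = (1 - 2 * t) * t + t\<^sup>2"
      using int expectation_test[OF t M n] xi_zero[OF t] by (simp add: prob_space)
    finally show ?thesis by (simp add: power2_eq_square algebra_simps)
  qed
  have D0: "(\<Sum>i\<in>N0. \<Sum>j\<in>N0. c i j) \<ge> card N0 * (t * (1 - t)) + 2 * \<beta>\<^sup>2 * S0 - K * S4"
  proof -
    have "(\<Sum>i\<in>N0. \<Sum>j\<in>N0 - {i}. 2 * \<beta>\<^sup>2 * (\<sigma> i j)\<^sup>2 - K * (\<sigma> i j) ^ 4) \<le> (\<Sum>i\<in>N0. \<Sum>j\<in>N0 - {i}. c i j)"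
    proof (intro sum_mono)
      fix i j assume ij: "i \<in> N0" "j \<in> N0 - {i}"
      have "\<beta> * H t (\<mu> i) = 2 * \<beta>\<^sup>2"
        using ij N0 by (simp add: H0 \<beta>_def power2_eq_square)
      then show "2 * \<beta>\<^sup>2 * (\<sigma> i j)\<^sup>2 - K * (\<sigma> i j) ^ 4 \<le> c i j"
        using expansion[of i j] ij sub by auto
    qed
    moreover have "(\<Sum>i\<in>N0. \<Sum>j\<in>N0 - {i}. (\<sigma> i j) ^ 4) \<le> S4"
      unfolding S4_def using sub I
      by (intro order_trans[OF sum_mono sum_mono2[of I N0]] sum_mono2) (auto intro!: sum_nonneg)
    then have "K * (\<Sum>i\<in>N0. \<Sum>j\<in>N0 - {i}. (\<sigma> i j) ^ 4) \<le> K * S4" using K by (intro mult_left_mono)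
    ultimately show ?thesis
      unfolding sum_off_diagonal[OF fin(1)] S0_def
      by (simp add: diag sum_subtractf sum_distrib_left)
  qed
  have D10: "(\<Sum>i\<in>N1. \<Sum>j\<in>N0. c i j) \<le> \<beta>\<^sup>2 * S0 + K * S4"
  proof -
    let ?P = "{i\<in>N1. \<mu> i \<in> {- mu_root t..mu_root t}}"
    have "(\<Sum>i\<in>N1. \<Sum>j\<in>N0. c i j) \<le> (\<Sum>i\<in>N1. \<Sum>j\<in>N0. \<beta> * (H t (\<mu> i) * (\<sigma> i j)\<^sup>2) + K * (\<sigma> i j) ^ 4)"
    proof (intro sum_mono)
      fix i j assume ij: "i \<in> N1" "j \<in> N0"
      then have "i \<noteq> j" "i \<in> I" using sub by auto
      then show "c i j \<le> \<beta> * (H t (\<mu> i) * (\<sigma> i j)\<^sup>2) + K * (\<sigma> i j) ^ 4"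
        using expansion[of i j] ij by (simp add: mult.assoc abs_le_iff)
    qed
    also have "\<dots> = \<beta> * (\<Sum>i\<in>N1. \<Sum>j\<in>N0. H t (\<mu> i) * (\<sigma> i j)\<^sup>2) + K * (\<Sum>i\<in>N1. \<Sum>j\<in>N0. (\<sigma> i j) ^ 4)"
      by (simp add: sum.distrib sum_distrib_left)
    \<comment> \<open>Only an upper bound on cross covariances is needed, so means outside the
      interval, where \<open>H\<close> is nonpositive, are discarded, and inside \<open>H\<close> is
      at most \<open>C_max t\<close>.\<close>
    also have "(\<Sum>i\<in>N1. \<Sum>j\<in>N0. H t (\<mu> i) * (\<sigma> i j)\<^sup>2) \<le> (\<Sum>i\<in>N1. of_bool (i \<in> ?P) * (C_max t * (\<Sum>j\<in>N0. (\<sigma> i j)\<^sup>2)))"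
    proof (intro sum_mono)
      fix i assume i: "i \<in> N1"
      have s: "0 \<le> (\<Sum>j\<in>N0. (\<sigma> i j)\<^sup>2)" by (intro sum_nonneg) auto
      have "H t (\<mu> i) * (\<Sum>j\<in>N0. (\<sigma> i j)\<^sup>2) \<le> of_bool (i \<in> ?P) * (C_max t * (\<Sum>j\<in>N0. (\<sigma> i j)\<^sup>2))"
      proof (cases "\<mu> i \<in> {- mu_root t..mu_root t}")
        case True
        then show ?thesis using H_inside[OF t True] s i by (auto intro: mult_right_mono)
      next
        case False
        then show ?thesis using H_outside[OF t False] s i by (auto simp: mult_le_0_iff)
      qed
      then show "(\<Sum>j\<in>N0. H t (\<mu> i) * (\<sigma> i j)\<^sup>2) \<le> of_bool (i \<in> ?P) * (C_max t * (\<Sum>j\<in>N0. (\<sigma> i j)\<^sup>2))"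
        by (simp add: sum_distrib_left)
    qed
    also have "(\<Sum>i\<in>N1. of_bool (i \<in> ?P) * (C_max t * (\<Sum>j\<in>N0. (\<sigma> i j)\<^sup>2))) = C_max t * (\<Sum>i\<in>?P. \<Sum>j\<in>N0. (\<sigma> i j)\<^sup>2)"
      using fin(2) unfolding sum_distrib_left[of "C_max t"]
      by (intro sum.mono_neutral_cong_right) auto
    also have "(\<Sum>i\<in>N1. \<Sum>j\<in>N0. (\<sigma> i j) ^ 4) \<le> S4"
    proof -
      have "(\<Sum>i\<in>N1. \<Sum>j\<in>N0. (\<sigma> i j) ^ 4) \<le> (\<Sum>i\<in>N1. \<Sum>j\<in>I - {i}. (\<sigma> i j) ^ 4)"
        using sub I by (intro sum_mono sum_mono2) auto
      also have "\<dots> \<le> S4"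
        unfolding S4_def using sub I by (intro sum_mono2) (auto intro!: sum_nonneg)
      finally show ?thesis .
    qed
    finally have "(\<Sum>i\<in>N1. \<Sum>j\<in>N0. c i j) \<le> \<beta> * (C_max t * (\<Sum>i\<in>?P. \<Sum>j\<in>N0. (\<sigma> i j)\<^sup>2)) + K * S4"
      using \<beta> K by (simp add: mult_left_mono)
    moreover have "\<beta> * (C_max t * (\<Sum>i\<in>?P. \<Sum>j\<in>N0. (\<sigma> i j)\<^sup>2)) \<le> \<beta>\<^sup>2 * S0"
    proof -
      have "\<beta>\<^sup>2 * (C_max t / (std_normal_density a * a) * (\<Sum>i\<in>?P. \<Sum>j\<in>N0. (\<sigma> i j)\<^sup>2)) \<le> \<beta>\<^sup>2 * S0"
        using cross by (intro mult_left_mono) auto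
      moreover have "std_normal_density a * a = \<beta>" by (simp add: \<beta>_def)
      ultimately show ?thesis using \<beta> by (simp add: power2_eq_square)
    qed
    ultimately show ?thesis by linarith
  qed
  have S0: "0 \<le> S0" and S4: "0 \<le> S4" unfolding S0_def S4_def by (auto intro!: sum_nonneg)
  have split: "U I \<omega> = U N0 \<omega> + U N1 \<omega>" for \<omega>
    unfolding U_def sub(4)[symmetric] by (rule sum.union_disjoint) (use fin sub in auto)
  have "(\<integral>\<omega>. (U N0 \<omega> - q * U I \<omega>)\<^sup>2 \<partial>M)
      = (\<integral>\<omega>. (1 - q)\<^sup>2 * (U N0 \<omega> * U N0 \<omega>) + q\<^sup>2 * (U N1 \<omega> * U N1 \<omega>) - 2 * q * (1 - q) * (U N1 \<omega> * U N0 \<omega>) \<partial>M)"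
    unfolding split by (intro Bochner_Integration.integral_cong) (auto simp: power2_eq_square algebra_simps)
  also have "\<dots> = (1 - q)\<^sup>2 * (\<integral>\<omega>. U N0 \<omega> * U N0 \<omega> \<partial>M) + q\<^sup>2 * (\<integral>\<omega>. U N1 \<omega> * U N1 \<omega> \<partial>M)
      - 2 * q * (1 - q) * (\<integral>\<omega>. U N1 \<omega> * U N0 \<omega> \<partial>M)"
    using UU(2) sub by simp
  also have "\<dots> \<ge> (1 - q)\<^sup>2 * (card N0 * (t * (1 - t)) + 2 * \<beta>\<^sup>2 * S0 - K * S4) + q\<^sup>2 * 0
      - 2 * q * (1 - q) * (\<beta>\<^sup>2 * S0 + K * S4)"
  proof -
    have "0 \<le> (\<integral>\<omega>. U N1 \<omega> * U N1 \<omega> \<partial>M)" by (intro Bochner_Integration.integral_nonneg) simp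
    then show ?thesis
      using q UU(1)[OF sub(1) sub(1)] UU(1)[OF sub(2) sub(1)] D0 D10
      by (intro diff_mono add_mono mult_left_mono) simp_all
  qed
  finally have "(1 - q)\<^sup>2 * (card N0 * (t * (1 - t)) + 2 * \<beta>\<^sup>2 * S0 - K * S4) + q\<^sup>2 * 0
      - 2 * q * (1 - q) * (\<beta>\<^sup>2 * S0 + K * S4) \<le> (\<integral>\<omega>. (U N0 \<omega> - q * U I \<omega>)\<^sup>2 \<partial>M)" .
  moreover have "(1 - q)\<^sup>2 * (K * S4) + 2 * q * (1 - q) * (K * S4) \<le> 2 * K * S4"
  proof -
    have "(1 - q)\<^sup>2 + 2 * q * (1 - q) = 1 - q\<^sup>2" by (simp add: power2_eq_square algebra_simps)
    then have "(1 - q)\<^sup>2 * (K * S4) + 2 * q * (1 - q) * (K * S4) = (1 - q\<^sup>2) * (K * S4)"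
      by (simp flip: distrib_right)
    also have "\<dots> \<le> 2 * (K * S4)"
      using K S4 zero_le_power2[of q] by (intro mult_right_mono mult_nonneg_nonneg) linarith+
    finally show ?thesis by simp
  qed
  moreover have "(1 - q)\<^sup>2 * (card N0 * (t * (1 - t)) + 2 * \<beta>\<^sup>2 * S0 - K * S4) + q\<^sup>2 * 0
      - 2 * q * (1 - q) * (\<beta>\<^sup>2 * S0 + K * S4)
    = (1 - q)\<^sup>2 * (card N0 * (t * (1 - t))) + 2 * (1 - q) * (1 - 2 * q) * \<beta>\<^sup>2 * S0
      - ((1 - q)\<^sup>2 * (K * S4) + 2 * q * (1 - q) * (K * S4))"
    by (simp add: power2_eq_square algebra_simps)
  ultimately show ?thesis unfolding U_def \<beta>_def by linarith
qed

text \<open>With \<open>fdp\<close> and \<open>m\<close> as below, the remainder factors as \<open>(1 - R / \<rho>) * (fdp - v / \<rho>)\<close>,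
  also when \<open>R = 0\<close>, and \<open>fdp - v / \<rho> = m * \<rho> / R\<close> otherwise.\<close>

lemma ratio_remainder_bound:
  fixes x R v \<rho> \<tau> \<epsilon> :: real
  assumes x: "0 \<le> x" "x \<le> R" "R \<le> 1" and v: "0 \<le> v" "v \<le> \<rho>" and \<rho>: "\<tau> \<le> \<rho>" "\<rho> \<le> 1" "0 < \<tau>"
    and \<epsilon>: "0 < \<epsilon>" "\<epsilon> \<le> 1 / 2"
  defines "m \<equiv> x / \<rho> - v / \<rho>\<^sup>2 * R" and "fdp \<equiv> if R = 0 then 0 else x / R"
  shows "(fdp - v / \<rho> - m)\<^sup>2 \<le> 4 * \<epsilon>\<^sup>2 * m\<^sup>2 + 1 / \<tau>\<^sup>2 * of_bool (\<epsilon> * \<tau> \<le> \<bar>R - \<rho>\<bar>)"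
proof -
  have \<rho>0: "\<rho> > 0" using \<rho> by linarith
  have factor: "fdp - v / \<rho> - m = (1 - R / \<rho>) * (fdp - v / \<rho>)"
  proof (cases "R = 0")
    case True
    then have "x = 0" using x by simp
    then show ?thesis using True by (simp add: m_def fdp_def)
  next
    case False
    then show ?thesis using \<rho>0 by (simp add: m_def fdp_def field_simps power2_eq_square)
  qed
  show ?thesis
  proof (cases "\<epsilon> * \<tau> \<le> \<bar>R - \<rho>\<bar>")
    case True
    have "0 \<le> fdp" "fdp \<le> 1" using x by (auto simp: fdp_def divide_le_eq)
    moreover have "0 \<le> v / \<rho>" "v / \<rho> \<le> 1" using v \<rho>0 by auto
    ultimately have f: "\<bar>fdp - v / \<rho>\<bar> \<le> 1" by linarith
    have "\<bar>1 - R / \<rho>\<bar> \<le> 1 / \<tau>"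
    proof -
      have "\<bar>1 - R / \<rho>\<bar> = \<bar>\<rho> - R\<bar> / \<rho>" using \<rho>0 by (simp add: field_simps abs_divide[symmetric])
      also have "\<dots> \<le> 1 / \<tau>" using x \<rho> \<rho>0 by (intro frac_le) auto
      finally show ?thesis .
    qed
    then have "\<bar>(1 - R / \<rho>) * (fdp - v / \<rho>)\<bar> \<le> 1 / \<tau> * 1"
      using f unfolding abs_mult by (intro mult_mono) (use \<rho> in auto)
    then have "\<bar>(1 - R / \<rho>) * (fdp - v / \<rho>)\<bar>\<^sup>2 \<le> (1 / \<tau>)\<^sup>2"
      by (intro power_mono) auto
    then have "(fdp - v / \<rho> - m)\<^sup>2 \<le> 1 / \<tau>\<^sup>2"
      unfolding factor power2_abs by (simp add: power_divide)
    then show ?thesis using True by (simp add: add_increasing)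
  next
    case False
    then have close: "\<bar>R - \<rho>\<bar> \<le> \<epsilon> * \<rho>" using \<rho> \<epsilon> by (smt (verit) mult_left_mono)
    have "\<epsilon> * \<rho> \<le> 1 / 2 * \<rho>" using \<epsilon> \<rho>0 by (intro mult_right_mono) auto
    then have R: "\<rho> / 2 \<le> R" using close by linarith
    then have R0: "R > 0" using \<rho>0 by linarith
    have "fdp - v / \<rho> = m * (\<rho> / R)"
      using R0 \<rho>0 by (simp add: m_def fdp_def field_simps power2_eq_square)
    then have e: "fdp - v / \<rho> - m = ((1 - R / \<rho>) * (\<rho> / R)) * m" unfolding factor by simp
    have "\<bar>1 - R / \<rho>\<bar> \<le> \<epsilon>"
    proof -
      have "\<bar>1 - R / \<rho>\<bar> = \<bar>R - \<rho>\<bar> / \<rho>" using \<rho>0 by (simp add: field_simps abs_minus_commute abs_divide[symmetric])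
      also have "\<dots> \<le> \<epsilon>" using close \<rho>0 by (simp add: divide_le_eq)
      finally show ?thesis .
    qed
    moreover have "\<bar>\<rho> / R\<bar> \<le> 2" using R R0 \<rho>0 by (simp add: divide_le_eq)
    ultimately have "\<bar>(1 - R / \<rho>) * (\<rho> / R)\<bar> \<le> \<epsilon> * 2"
      unfolding abs_mult using \<epsilon> by (intro mult_mono) auto
    then have "\<bar>(1 - R / \<rho>) * (\<rho> / R)\<bar>\<^sup>2 \<le> (\<epsilon> * 2)\<^sup>2" by (intro power_mono) auto
    then have "((1 - R / \<rho>) * (\<rho> / R))\<^sup>2 * m\<^sup>2 \<le> (\<epsilon> * 2)\<^sup>2 * m\<^sup>2"
      unfolding power2_abs by (intro mult_right_mono) auto
    then show ?thesis using False unfolding e power_mult_distrib by (simp add: mult.commute)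
  qed
qed

section \<open>Means of the proportions and size of the remainder\<close>

lemma rejection_proportion_moments:
  fixes t :: real and Z :: "nat \<Rightarrow> 'a \<Rightarrow> real"
  assumes t: "0 < t" "t < 1" and M: "prob_space M" and mvn: "multivariate_normal M {1..p} Z \<mu> \<sigma>"
    and unit: "\<And>i. i \<in> {1..p} \<Longrightarrow> \<sigma> i i = 1" and p: "p \<ge> 1"
  defines "v \<equiv> prob_space.expectation M (Vbar t p \<mu> Z)" and "\<rho> \<equiv> prob_space.expectation M (Rbar t p Z)"
    and "X \<equiv> \<lambda>i \<omega>. test t (Z i \<omega>) - xi t (\<mu> i)"
  shows "v = card (true_nulls p \<mu>) * t / p" "\<rho> = (\<Sum>i\<in>{1..p}. xi t (\<mu> i)) / p"
    and "t / 2 \<le> \<rho>" "\<rho> \<le> 1" "0 \<le> v" "v \<le> \<rho>"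
    and "Vbar t p \<mu> Z \<in> borel_measurable M" "Rbar t p Z \<in> borel_measurable M"
    and "0 \<le> Vbar t p \<mu> Z \<omega>" "Vbar t p \<mu> Z \<omega> \<le> Rbar t p Z \<omega>" "Rbar t p Z \<omega> \<le> 1"
    and "lin_part M (Vbar t p \<mu> Z) (Rbar t p Z) \<omega>
      = ((\<Sum>i\<in>true_nulls p \<mu>. X i \<omega>) - v / \<rho> * (\<Sum>i\<in>{1..p}. X i \<omega>)) / (p * \<rho>)"
    and "prob_space.variance M (lin_part M (Vbar t p \<mu> Z) (Rbar t p Z))
      = (\<integral>\<omega>. (lin_part M (Vbar t p \<mu> Z) (Rbar t p Z) \<omega>)\<^sup>2 \<partial>M)"
proof -
  interpret prob_space M by fact
  have Zm: "Z i \<in> borel_measurable M" if "i \<in> {1..p}" for i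
    using mvn that unfolding multivariate_normal_def by auto
  have tm: "(\<lambda>\<omega>. test t (Z i \<omega>)) \<in> borel_measurable M" if "i \<in> {1..p}" for i
    using measurable_compose[OF Zm[OF that] measurable_test] .
  have sub: "true_nulls p \<mu> \<subseteq> {1..p}" by (auto simp: true_nulls_def)
  have Et: "(\<integral>\<omega>. test t (Z i \<omega>) \<partial>M) = xi t (\<mu> i)" and it: "integrable M (\<lambda>\<omega>. test t (Z i \<omega>))" if "i \<in> {1..p}" for i
  proof -
    have "normal_rv M (Z i) (\<mu> i) 1" using multivariate_normal_single[OF mvn that] unit[OF that] by simp
    then show "(\<integral>\<omega>. test t (Z i \<omega>) \<partial>M) = xi t (\<mu> i)" by (rule expectation_test[OF t M])
    show "integrable M (\<lambda>\<omega>. test t (Z i \<omega>))"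
      by (rule integrable_const_bound[of _ 1]) (use tm[OF that] in \<open>auto simp: test_def\<close>)
  qed
  have p0: "real p > 0" using p by simp
  show Vm: "Vbar t p \<mu> Z \<in> borel_measurable M" and Rm: "Rbar t p Z \<in> borel_measurable M"
    unfolding Vbar_def Rbar_def V_def R_def using tm sub
    by (intro borel_measurable_divide borel_measurable_sum borel_measurable_const; blast)+
  have V0: "0 \<le> Vbar t p \<mu> Z \<omega>" and VR: "Vbar t p \<mu> Z \<omega> \<le> Rbar t p Z \<omega>" and R1: "Rbar t p Z \<omega> \<le> 1" for \<omega>
  proof -
    show "0 \<le> Vbar t p \<mu> Z \<omega>"
      unfolding Vbar_def V_def by (intro divide_nonneg_nonneg sum_nonneg test_bounds) auto
    show "Vbar t p \<mu> Z \<omega> \<le> Rbar t p Z \<omega>"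
      unfolding Vbar_def V_def Rbar_def R_def
      by (intro divide_right_mono sum_mono2 sub test_bounds) auto
    have "R t p Z \<omega> \<le> of_nat (card {1..p}) * 1"
      unfolding R_def by (intro sum_bounded_above test_bounds)
    then show "Rbar t p Z \<omega> \<le> 1" using p0 by (simp add: Rbar_def)
  qed
  then show "0 \<le> Vbar t p \<mu> Z \<omega>" "Vbar t p \<mu> Z \<omega> \<le> Rbar t p Z \<omega>" "Rbar t p Z \<omega> \<le> 1" by auto
  have iV: "integrable M (Vbar t p \<mu> Z)" and iR: "integrable M (Rbar t p Z)"
    using V0 VR R1 Vm Rm order_trans[OF V0 VR] order_trans[OF VR R1]
    by (auto intro!: integrable_const_bound[of _ 1])
  show v: "v = card (true_nulls p \<mu>) * t / p"
  proof -
    have "v = (\<Sum>i\<in>true_nulls p \<mu>. \<integral>\<omega>. test t (Z i \<omega>) \<partial>M) / p"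
      unfolding v_def Vbar_def V_def using it sub by (subst integral_divide_zero, subst Bochner_Integration.integral_sum) auto
    also have "(\<Sum>i\<in>true_nulls p \<mu>. \<integral>\<omega>. test t (Z i \<omega>) \<partial>M) = (\<Sum>i\<in>true_nulls p \<mu>. t)"
      using Et sub xi_zero[OF t] by (intro sum.cong) (auto simp: true_nulls_def)
    finally show ?thesis by simp
  qed
  show \<rho>: "\<rho> = (\<Sum>i\<in>{1..p}. xi t (\<mu> i)) / p"
    unfolding \<rho>_def Rbar_def R_def using it by (subst integral_divide_zero, subst Bochner_Integration.integral_sum) (auto simp: Et)
  show "0 \<le> v" unfolding v using t by simp
  show "v \<le> \<rho>" unfolding v_def \<rho>_def using iV iR VR by (intro integral_mono) auto
  show "\<rho> \<le> 1"
    using integral_mono[OF iR, of "\<lambda>_. 1"] R1 unfolding \<rho>_def by (simp add: prob_space)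
  have "(\<Sum>i\<in>{1..p}. t / 2) \<le> (\<Sum>i\<in>{1..p}. xi t (\<mu> i))" by (intro sum_mono xi_lower[OF t])
  then show \<rho>t: "t / 2 \<le> \<rho>" unfolding \<rho> using p0 by (simp add: field_simps)
  have \<rho>0: "\<rho> > 0" using \<rho>t t by linarith
  \<comment> \<open>Centring is free, as the constants add up to
    \<open>v / \<rho> - v / \<rho>\<^sup>2 * \<rho> = 0\<close>. The right side is the form of the
    second moment bound with \<open>q = v / \<rho>\<close>, divided by
    \<open>p * \<rho>\<close>.\<close>
  show "lin_part M (Vbar t p \<mu> Z) (Rbar t p Z) \<omega>
      = ((\<Sum>i\<in>true_nulls p \<mu>. X i \<omega>) - v / \<rho> * (\<Sum>i\<in>{1..p}. X i \<omega>)) / (p * \<rho>)"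
  proof -
    have sV: "(\<Sum>i\<in>true_nulls p \<mu>. X i \<omega>) = p * (Vbar t p \<mu> Z \<omega> - v)"
    proof -
      have "(\<Sum>i\<in>true_nulls p \<mu>. X i \<omega>) = V t p \<mu> Z \<omega> - (\<Sum>i\<in>true_nulls p \<mu>. t)"
        unfolding X_def sum_subtractf V_def using xi_zero[OF t]
        by (intro arg_cong2[where f="(-)"] sum.cong) (auto simp: true_nulls_def)
      then show ?thesis using p0 by (simp add: Vbar_def v algebra_simps)
    qed
    have sR: "(\<Sum>i\<in>{1..p}. X i \<omega>) = p * (Rbar t p Z \<omega> - \<rho>)"
      unfolding X_def sum_subtractf using p0 by (simp add: Rbar_def R_def \<rho> algebra_simps)
    show ?thesis
      unfolding sV sR lin_part_def v_def[symmetric] \<rho>_def[symmetric] using p0 \<rho>0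
      by (simp add: field_simps power2_eq_square)
  qed
  have "(\<integral>\<omega>. lin_part M (Vbar t p \<mu> Z) (Rbar t p Z) \<omega> \<partial>M) = v / \<rho> - v / \<rho>\<^sup>2 * \<rho>"
    unfolding lin_part_def v_def[symmetric] \<rho>_def[symmetric] using iV iR
    by (simp add: v_def[symmetric] \<rho>_def[symmetric])
  also have "\<dots> = 0" using \<rho>0 by (simp add: power2_eq_square)
  finally show "variance (lin_part M (Vbar t p \<mu> Z) (Rbar t p Z))
      = (\<integral>\<omega>. (lin_part M (Vbar t p \<mu> Z) (Rbar t p Z) \<omega>)\<^sup>2 \<partial>M)" by simp
qed

text \<open>\<open>ratio_remainder_bound\<close> with \<open>\<tau> = t / 2\<close>, the lower bound
  for the mean of \<open>Rbar\<close>. The threshold \<open>\<epsilon> * t / 2\<close> is written as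
  \<open>4 * (\<epsilon> * t / 8)\<close> to meet the concentration bound at
  \<open>\<eta> = \<epsilon> * t / 8\<close>.\<close>

lemma remainder_second_moment_bound:
  fixes t \<epsilon> :: real and Z :: "nat \<Rightarrow> 'a \<Rightarrow> real"
  assumes t: "0 < t" "t < 1" and M: "prob_space M" and mvn: "multivariate_normal M {1..p} Z \<mu> \<sigma>"
    and unit: "\<And>i. i \<in> {1..p} \<Longrightarrow> \<sigma> i i = 1" and p: "p \<ge> 1"
  defines "v \<equiv> prob_space.expectation M (Vbar t p \<mu> Z)" and "\<rho> \<equiv> prob_space.expectation M (Rbar t p Z)"
    and "m \<equiv> lin_part M (Vbar t p \<mu> Z) (Rbar t p Z)"
  defines "r \<equiv> \<lambda>\<omega>. FDP t p \<mu> Z \<omega> - v / \<rho> - m \<omega>"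
  shows "integrable M (\<lambda>\<omega>. (r \<omega>)\<^sup>2)"
    and "\<epsilon> > 0 \<Longrightarrow> \<epsilon> \<le> 1 / 2 \<Longrightarrow> (\<integral>\<omega>. (r \<omega>)\<^sup>2 \<partial>M) \<le> 4 * \<epsilon>\<^sup>2 * prob_space.variance M m
      + 4 / t\<^sup>2 * measure M {\<omega>\<in>space M. 4 * (\<epsilon> * t / 8) * card {1..p} \<le> \<bar>(\<Sum>i\<in>{1..p}. test t (Z i \<omega>)) - (\<Sum>i\<in>{1..p}. xi t (\<mu> i))\<bar>}"
proof -
  interpret prob_space M by fact
  have p0: "real p > 0" using p by simp
  note mom = rejection_proportion_moments[OF t M mvn unit p, folded v_def \<rho>_def, folded m_def]
  note [measurable] = mom(7,8)
  have mdef: "m \<omega> = Vbar t p \<mu> Z \<omega> / \<rho> - v / \<rho>\<^sup>2 * Rbar t p Z \<omega>" for \<omega>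
    by (simp add: m_def lin_part_def v_def \<rho>_def)
  have fdp: "FDP t p \<mu> Z \<omega> = (if Rbar t p Z \<omega> = 0 then 0 else Vbar t p \<mu> Z \<omega> / Rbar t p Z \<omega>)" for \<omega>
    using p0 by (simp add: FDP_def Rbar_def Vbar_def)
  have mm [measurable]: "m \<in> borel_measurable M" unfolding mdef[abs_def] by measurable
  have rm [measurable]: "r \<in> borel_measurable M" unfolding r_def fdp by measurable
  have bound: "(r \<omega>)\<^sup>2 \<le> 4 * e\<^sup>2 * (m \<omega>)\<^sup>2 + 1 / (t / 2)\<^sup>2 * of_bool (e * (t / 2) \<le> \<bar>Rbar t p Z \<omega> - \<rho>\<bar>)"
    if "0 < e" "e \<le> 1 / 2" for e \<omega>
    unfolding r_def fdp mdef using that t mom(3-6) mom(9-11)[of \<omega>] by (intro ratio_remainder_bound) auto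
  have mb: "\<bar>m \<omega>\<bar> \<le> 1 / \<rho> + 1 / \<rho>" for \<omega>
  proof -
    have \<rho>0: "\<rho> > 0" using mom(3) t by linarith
    have "\<bar>Vbar t p \<mu> Z \<omega> / \<rho>\<bar> \<le> 1 / \<rho>"
      using mom(9-11)[of \<omega>] \<rho>0 by (simp add: divide_right_mono)
    moreover have "\<bar>v / \<rho>\<^sup>2 * Rbar t p Z \<omega>\<bar> \<le> 1 / \<rho> * 1"
      unfolding abs_mult
    proof (intro mult_mono)
      have "v / \<rho>\<^sup>2 \<le> \<rho> / \<rho>\<^sup>2" using mom(6) by (intro divide_right_mono) auto
      then show "\<bar>v / \<rho>\<^sup>2\<bar> \<le> 1 / \<rho>" using mom(5) \<rho>0 by (simp add: power2_eq_square)
    qed (use mom(9-11)[of \<omega>] \<rho>0 in auto)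
    ultimately show ?thesis
      unfolding mdef mult_1_right by (intro order_trans[OF abs_triangle_ineq4] add_mono)
  qed
  have im: "integrable M (\<lambda>\<omega>. (m \<omega>)\<^sup>2)"
  proof (rule integrable_const_bound[of _ "(1 / \<rho> + 1 / \<rho>)\<^sup>2"])
    have "(m \<omega>)\<^sup>2 \<le> (1 / \<rho> + 1 / \<rho>)\<^sup>2" for \<omega>
      using power_mono[OF mb[of \<omega>] abs_ge_zero, where n=2] unfolding power2_abs .
    then show "AE \<omega> in M. norm ((m \<omega>)\<^sup>2) \<le> (1 / \<rho> + 1 / \<rho>)\<^sup>2" by (intro AE_I2) simp
  qed measurable
  have ii: "integrable M (\<lambda>\<omega>. of_bool (e \<le> \<bar>Rbar t p Z \<omega> - \<rho>\<bar>) :: real)" for e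
    by (rule integrable_const_bound[of _ 1]) auto
  show ir: "integrable M (\<lambda>\<omega>. (r \<omega>)\<^sup>2)"
  proof (rule Bochner_Integration.integrable_bound)
    show "integrable M (\<lambda>\<omega>. 4 * (1/2)\<^sup>2 * (m \<omega>)\<^sup>2 + 1 / (t / 2)\<^sup>2 * of_bool (1/2 * (t / 2) \<le> \<bar>Rbar t p Z \<omega> - \<rho>\<bar>))"
      by (intro Bochner_Integration.integrable_add integrable_mult_right im ii)
    show "AE \<omega> in M. norm ((r \<omega>)\<^sup>2) \<le> norm (4 * (1/2)\<^sup>2 * (m \<omega>)\<^sup>2 + 1 / (t / 2)\<^sup>2 * of_bool (1/2 * (t / 2) \<le> \<bar>Rbar t p Z \<omega> - \<rho>\<bar>))"
      using bound[of "1/2"] by (intro AE_I2) (auto intro: order_trans[OF _ abs_ge_self])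
  qed measurable
  assume \<epsilon>: "\<epsilon> > 0" "\<epsilon> \<le> 1 / 2"
  have "(\<integral>\<omega>. (r \<omega>)\<^sup>2 \<partial>M) \<le> (\<integral>\<omega>. 4 * \<epsilon>\<^sup>2 * (m \<omega>)\<^sup>2 + 1 / (t / 2)\<^sup>2 * of_bool (\<epsilon> * (t / 2) \<le> \<bar>Rbar t p Z \<omega> - \<rho>\<bar>) \<partial>M)"
    by (intro integral_mono ir Bochner_Integration.integrable_add integrable_mult_right im ii bound \<epsilon>)
  also have "\<dots> = 4 * \<epsilon>\<^sup>2 * (\<integral>\<omega>. (m \<omega>)\<^sup>2 \<partial>M) + 1 / (t / 2)\<^sup>2 * (\<integral>\<omega>. of_bool (\<epsilon> * (t / 2) \<le> \<bar>Rbar t p Z \<omega> - \<rho>\<bar>) \<partial>M)"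
    by (subst Bochner_Integration.integral_add) (intro integrable_mult_right im ii | simp)+
  also have "(\<integral>\<omega>. (m \<omega>)\<^sup>2 \<partial>M) = variance m" using mom(13) by simp
  also have "(\<integral>\<omega>. of_bool (\<epsilon> * (t / 2) \<le> \<bar>Rbar t p Z \<omega> - \<rho>\<bar>) \<partial>M)
     = (\<integral>\<omega>. indicator {\<omega>\<in>space M. 4 * (\<epsilon> * t / 8) * card {1..p} \<le> \<bar>(\<Sum>i\<in>{1..p}. test t (Z i \<omega>)) - (\<Sum>i\<in>{1..p}. xi t (\<mu> i))\<bar>} \<omega> \<partial>M :: real)"
  proof (intro Bochner_Integration.integral_cong refl)
    fix \<omega> assume "\<omega> \<in> space M"
    have "Rbar t p Z \<omega> - \<rho> = ((\<Sum>i\<in>{1..p}. test t (Z i \<omega>)) - (\<Sum>i\<in>{1..p}. xi t (\<mu> i))) / p"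
      using mom(2) by (simp add: Rbar_def R_def diff_divide_distrib)
    then have "\<epsilon> * (t / 2) \<le> \<bar>Rbar t p Z \<omega> - \<rho>\<bar> \<longleftrightarrow> 4 * (\<epsilon> * t / 8) * card {1..p} \<le> \<bar>(\<Sum>i\<in>{1..p}. test t (Z i \<omega>)) - (\<Sum>i\<in>{1..p}. xi t (\<mu> i))\<bar>"
      using p0 by (simp add: le_divide_eq)
    with \<open>\<omega> \<in> space M\<close> show "of_bool (\<epsilon> * (t / 2) \<le> \<bar>Rbar t p Z \<omega> - \<rho>\<bar>)
      = (indicator {\<omega>\<in>space M. 4 * (\<epsilon> * t / 8) * card {1..p} \<le> \<bar>(\<Sum>i\<in>{1..p}. test t (Z i \<omega>)) - (\<Sum>i\<in>{1..p}. xi t (\<mu> i))\<bar>} \<omega> :: real)"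
      by (simp add: indicator_def)
  qed
  finally show "(\<integral>\<omega>. (r \<omega>)\<^sup>2 \<partial>M) \<le> 4 * \<epsilon>\<^sup>2 * variance m
      + 4 / t\<^sup>2 * measure M {\<omega>\<in>space M. 4 * (\<epsilon> * t / 8) * card {1..p} \<le> \<bar>(\<Sum>i\<in>{1..p}. test t (Z i \<omega>)) - (\<Sum>i\<in>{1..p}. xi t (\<mu> i))\<bar>}"
    by (simp add: power_divide Int_absorb2)
qed

section \<open>Variance of the linear part\<close>

lemma std_normal_density_abs: "std_normal_density \<bar>x\<bar> = std_normal_density x"
  by (simp add: std_normal_density_def)

text \<open>The constant \<open>b\<close> collects the two worst coefficients:
  \<open>(1 - q)\<^sup>2 \<ge> 1 / 4\<close> on the diagonal, and \<open>2 * (1 - q) \<ge> 1\<close>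
  together with \<open>1 - 2 * q \<ge> (1 - c) / 2\<close> for the squared correlations. The bound
  \<open>fourth\<close> is scaled so that the error \<open>2 * K * S4\<close> uses up at most half
  of the main term.\<close>

lemma variance_lin_part_lower_bound:
  fixes t c a K S0 S4 b :: real and Z :: "nat \<Rightarrow> 'a \<Rightarrow> real"
  assumes t: "0 < t" "t < 1" and M: "prob_space M" and mvn: "multivariate_normal M {1..p} Z \<mu> \<sigma>"
    and unit: "\<And>i. i \<in> {1..p} \<Longrightarrow> \<sigma> i i = 1" and p: "p \<ge> 1" and p1: "card (false_nulls p \<mu>) \<ge> 1"
  defines "N0 \<equiv> true_nulls p \<mu>" and "N1 \<equiv> false_nulls p \<mu>" and "a \<equiv> \<bar>zq (t / 2)\<bar>"
  defines "K \<equiv> 2 * (28 * a ^ 3 + 22 * a) + 24"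
    and "S0 \<equiv> \<Sum>i\<in>N0. \<Sum>j\<in>N0 - {i}. (\<sigma> i j)\<^sup>2"
    and "S4 \<equiv> \<Sum>i\<in>{1..p}. \<Sum>j\<in>{1..p} - {i}. (\<sigma> i j) ^ 4"
    and "b \<equiv> min (t * (1 - t) / 4) ((1 - c) / 2 * (a * std_normal_density a)\<^sup>2)"
  assumes ratio: "card N0 * t / (card N1 * xi_bar t p \<mu>) < c" "c < 1"
    and cross: "C_max t / (std_normal_density (zq (t / 2)) * \<bar>zq (t / 2)\<bar>)
      * (\<Sum>i\<in>{i\<in>N1. \<mu> i \<in> {- mu_root t..mu_root t}}. \<Sum>j\<in>N0. (\<sigma> i j)\<^sup>2) \<le> S0"
    and fourth: "S4 \<le> b / (4 * K) * (S0 + card N0)"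
  shows "b / 2 * (S0 + card N0) / (real p)\<^sup>2 \<le> prob_space.variance M (lin_part M (Vbar t p \<mu> Z) (Rbar t p Z))"
proof -
  interpret prob_space M by fact
  define v where "v = expectation (Vbar t p \<mu> Z)"
  define \<rho> where "\<rho> = expectation (Rbar t p Z)"
  define q where "q = v / \<rho>"
  note mom = rejection_proportion_moments[OF t M mvn unit p, folded v_def \<rho>_def]
  have p0: "real p > 0" using p by simp
  have a: "a > 0" using zq_half_cutoff[OF t] by (simp add: a_def)
  have K: "K > 0" unfolding K_def using a by (simp add: add_pos_pos)
  have sub: "N0 = {i\<in>{1..p}. \<mu> i = 0}" "N1 = {i\<in>{1..p}. \<mu> i \<noteq> 0}"
    by (auto simp: N0_def N1_def true_nulls_def false_nulls_def)
  define s where "s = (\<Sum>i\<in>N1. xi t (\<mu> i))"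
  have "N1 \<noteq> {}" using p1 unfolding N1_def[symmetric] by auto
  then have N1ne: "N1 \<noteq> {}" "finite N1" "finite N0" using sub by auto
  have s_eq: "card N1 * xi_bar t p \<mu> = s"
    using N1ne by (simp add: xi_bar_def s_def flip: N1_def)
  have s: "s > 0"
    unfolding s_def using N1ne xi_lower[OF t] t by (intro sum_pos) (auto intro: less_le_trans[of 0 "t / 2"])
  have tot: "(\<Sum>i\<in>{1..p}. xi t (\<mu> i)) = card N0 * t + s"
  proof -
    have "{1..p} = N0 \<union> N1" "N0 \<inter> N1 = {}" using sub by auto
    then have "(\<Sum>i\<in>{1..p}. xi t (\<mu> i)) = (\<Sum>i\<in>N0. xi t (\<mu> i)) + s"
      using N1ne by (simp add: sum.union_disjoint s_def)
    also have "(\<Sum>i\<in>N0. xi t (\<mu> i)) = (\<Sum>i\<in>N0. t)"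
      using sub xi_zero[OF t] by (intro sum.cong) auto
    finally show ?thesis by simp
  qed
  have N0t: "0 \<le> card N0 * t" using t by simp
  have r: "card N0 * t < c * s" using ratio s unfolding s_eq by (simp add: divide_less_eq)
  have cs: "c * s < s" using s ratio by simp
  have q_eq: "q = card N0 * t / (card N0 * t + s)"
  proof -
    have "v = card N0 * t / p" "\<rho> = (card N0 * t + s) / p"
      using mom(1) mom(2)[unfolded tot] by (simp_all add: N0_def)
    then show ?thesis using p0 by (simp add: q_def)
  qed
  have q0: "0 \<le> q" unfolding q_eq using N0t s by simp
  \<comment> \<open>With \<open>s\<close> the expected number of rejected false nulls,
    \<open>1 - 2 * q\<close> is \<open>(s - card N0 * t) / (s + card N0 * t)\<close>. Since
    \<open>card N0 * t < c * s\<close>, the numerator exceeds \<open>(1 - c) * s\<close> and the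
    denominator is below \<open>2 * s\<close>.\<close>
  have q2: "(1 - c) / 2 \<le> 1 - 2 * q"
  proof -
    have "1 - 2 * q = (s - card N0 * t) / (card N0 * t + s)"
      unfolding q_eq using N0t s by (simp add: field_simps)
    moreover have "(1 - c) / 2 * (card N0 * t + s) \<le> s - card N0 * t"
    proof -
      have "(1 - c) / 2 * (card N0 * t + s) \<le> (1 - c) / 2 * (2 * s)"
        using r cs ratio by (intro mult_left_mono) auto
      also have "(1 - c) / 2 * (2 * s) = s - c * s" by (simp add: left_diff_distrib)
      also have "\<dots> \<le> s - card N0 * t" using r by simp
      finally show ?thesis .
    qed
    ultimately show ?thesis using N0t s by (simp add: le_divide_eq)
  qed
  have qh: "q \<le> 1 / 2" using q2 ratio by simp
  have S0: "0 \<le> S0" unfolding S0_def by (auto intro!: sum_nonneg)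
  define E where "E = (\<integral>\<omega>. ((\<Sum>i\<in>N0. test t (Z i \<omega>) - xi t (\<mu> i)) - q * (\<Sum>i\<in>{1..p}. test t (Z i \<omega>) - xi t (\<mu> i)))\<^sup>2 \<partial>M)"
  have lower: "(1 - q)\<^sup>2 * (card N0 * (t * (1 - t))) + 2 * (1 - q) * (1 - 2 * q) * (a * std_normal_density a)\<^sup>2 * S0 - 2 * K * S4 \<le> E"
    unfolding E_def S0_def S4_def K_def a_def
    by (rule linear_part_second_moment_lower_bound[OF t M mvn unit sub q0 qh])
      (use cross in \<open>auto simp: S0_def std_normal_density_abs\<close>)
  have "t * (1 - t) / 4 * card N0 \<le> (1 - q)\<^sup>2 * (card N0 * (t * (1 - t)))"
  proof -
    have "(1 / 2)\<^sup>2 \<le> (1 - q)\<^sup>2" using qh by (intro power_mono) auto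
    then have "(1 / 2)\<^sup>2 * (card N0 * (t * (1 - t))) \<le> (1 - q)\<^sup>2 * (card N0 * (t * (1 - t)))"
      using t by (intro mult_right_mono) auto
    then show ?thesis by (simp add: power2_eq_square mult_ac)
  qed
  moreover have "b * card N0 \<le> t * (1 - t) / 4 * card N0" unfolding b_def by (intro mult_right_mono) auto
  moreover have "(1 - c) / 2 * (a * std_normal_density a)\<^sup>2 * S0 \<le> 2 * (1 - q) * (1 - 2 * q) * (a * std_normal_density a)\<^sup>2 * S0"
  proof -
    have "1 * ((1 - c) / 2) \<le> 2 * (1 - q) * (1 - 2 * q)"
      using q2 qh ratio by (intro mult_mono) auto
    then show ?thesis using S0 by (intro mult_right_mono) auto
  qed
  moreover have "b * S0 \<le> (1 - c) / 2 * (a * std_normal_density a)\<^sup>2 * S0"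
    unfolding b_def using S0 by (intro mult_right_mono) auto
  moreover have "2 * K * S4 \<le> b / 2 * (S0 + card N0)"
    using mult_left_mono[OF fourth, of "2 * K"] K by simp
  moreover have "y / 2 * (S + n) \<le> E" if "A0 \<le> A1" "y * n \<le> A0" "B0 \<le> B1" "y * S \<le> B0" "D \<le> y / 2 * (S + n)" "A1 + B1 - D \<le> E"
    for y n S A0 A1 B0 B1 D :: real
  proof -
    define w where "w = y / 2 * (S + n)"
    have "2 * w = y * S + y * n" by (simp add: w_def distrib_left)
    then show ?thesis using that unfolding w_def[symmetric] by linarith
  qed
  ultimately have E: "b / 2 * (S0 + card N0) \<le> E" using lower by blast
  have "variance (lin_part M (Vbar t p \<mu> Z) (Rbar t p Z)) = E / (p * \<rho>)\<^sup>2"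
  proof -
    have "variance (lin_part M (Vbar t p \<mu> Z) (Rbar t p Z)) = (\<integral>\<omega>. (lin_part M (Vbar t p \<mu> Z) (Rbar t p Z) \<omega>)\<^sup>2 \<partial>M)"
      by (rule mom(13))
    also have "\<dots> = (\<integral>\<omega>. ((\<Sum>i\<in>N0. test t (Z i \<omega>) - xi t (\<mu> i)) - q * (\<Sum>i\<in>{1..p}. test t (Z i \<omega>) - xi t (\<mu> i)))\<^sup>2 / (p * \<rho>)\<^sup>2 \<partial>M)"
      unfolding N0_def q_def power_divide[symmetric] by (intro Bochner_Integration.integral_cong refl arg_cong[where f="\<lambda>x. x\<^sup>2"] mom(12))
    also have "\<dots> = E / (p * \<rho>)\<^sup>2"
      unfolding E_def by (rule integral_divide_zero)
    finally show ?thesis .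
  qed
  \<comment> \<open>The mean \<rho> is at most 1, so dropping it from the denominator only lowers
    the value.\<close>
  also have "\<dots> \<ge> E / (real p)\<^sup>2"
  proof (intro divide_left_mono)
    have \<rho>0: "0 < \<rho>" using mom(3) t by linarith
    show "(p * \<rho>)\<^sup>2 \<le> (real p)\<^sup>2"
      using mom(4) \<rho>0 p0 by (intro power_mono) (auto simp: mult_left_le)
    show "0 \<le> E" unfolding E_def by (intro Bochner_Integration.integral_nonneg) auto
    show "0 < (real p)\<^sup>2 * (p * \<rho>)\<^sup>2" using \<rho>0 p0 by simp
  qed
  also have "E / (real p)\<^sup>2 \<ge> b / 2 * (S0 + card N0) / (real p)\<^sup>2"
    using E by (intro divide_right_mono) auto
  finally show ?thesis .
qed

section \<open>Comparison of the orders in p\<close>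

theorem theorem1:
  fixes t :: real
    and M :: "nat \<Rightarrow> 'a measure"
    and Z :: "nat \<Rightarrow> nat \<Rightarrow> 'a \<Rightarrow> real"
    and \<mu> :: "nat \<Rightarrow> nat \<Rightarrow> real"
    and \<sigma> :: "nat \<Rightarrow> nat \<Rightarrow> nat \<Rightarrow> real"
    and \<delta> C :: real
    and H0 H1 :: "nat \<Rightarrow> nat set"
  defines "H0 \<equiv> \<lambda>p. true_nulls p (\<mu> p)"
    and "H1 \<equiv> \<lambda>p. false_nulls p (\<mu> p)"
  assumes t: "0 < t" "t < 1"
    and prob: "\<And>p. p \<ge> 1 \<Longrightarrow> prob_space (M p)"
    and normal: "\<And>p. p \<ge> 1 \<Longrightarrow> multivariate_normal (M p) {1..p} (Z p) (\<mu> p) (\<sigma> p)"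
    and unit_variance: "\<And>p j. j \<in> {1..p} \<Longrightarrow> \<sigma> p j j = 1"
    and p1: "\<And>p. p \<ge> 1 \<Longrightarrow> card (H1 p) \<ge> 1"
    and delta: "\<delta> > 0"
    and weak_dep:
      "(\<lambda>p. \<Sum>i\<in>{1..p}. \<Sum>j\<in>{1..p}. \<bar>\<sigma> p i j\<bar>) \<in> O(\<lambda>p. real p powr (2 - \<delta>))"
    and limsup_cond:
      "limsup (\<lambda>p. ereal (real (card (H0 p)) * t
                     / (real (card (H1 p)) * xi_bar t p (\<mu> p)))) < 1"
    and C: "C > 0"
    and cond_cross:
      "\<forall>\<^sub>F p in sequentially.
         (\<Sum>i\<in>H0 p. \<Sum>j\<in>H0 p - {i}. (\<sigma> p i j)\<^sup>2)
         \<ge> C_max t / (std_normal_density (zq (t / 2)) * \<bar>zq (t / 2)\<bar>)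
           * (\<Sum>i\<in>{i\<in>H1 p. \<mu> p i \<in> {- mu_root t..mu_root t}}. \<Sum>j\<in>H0 p. (\<sigma> p i j)\<^sup>2)"
    and cond_false_nulls:
      "\<forall>\<^sub>F p in sequentially.
         (\<Sum>i\<in>H0 p. \<Sum>j\<in>H0 p - {i}. (\<sigma> p i j)\<^sup>2) + real p
         \<ge> C * (\<Sum>i\<in>H1 p. \<Sum>j\<in>H1 p - {i}. (\<sigma> p i j)\<^sup>2)"
    and fourth_powers:
      "(\<lambda>p. \<Sum>i\<in>{1..p}. \<Sum>j\<in>{1..p} - {i}. (\<sigma> p i j) ^ 4)
       \<in> o(\<lambda>p. (\<Sum>i\<in>H0 p. \<Sum>j\<in>H0 p - {i}. (\<sigma> p i j)\<^sup>2) + real (card (H0 p)))"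
  shows
    "\<exists>r :: nat \<Rightarrow> 'a \<Rightarrow> real.
       (\<forall>p\<ge>1. \<forall>\<omega>\<in>space (M p).
          FDP t p (\<mu> p) (Z p) \<omega> =
            prob_space.expectation (M p) (Vbar t p (\<mu> p) (Z p))
              / prob_space.expectation (M p) (Rbar t p (Z p))
            + lin_part (M p) (Vbar t p (\<mu> p) (Z p)) (Rbar t p (Z p)) \<omega>
            + r p \<omega>) \<and>
       (\<forall>p\<ge>1. integrable (M p) (\<lambda>\<omega>. (r p \<omega>)\<^sup>2)) \<and>
       (\<lambda>p. prob_space.expectation (M p) (\<lambda>\<omega>. (r p \<omega>)\<^sup>2))
         \<in> o(\<lambda>p. prob_space.variance (M p)
                  (lin_part (M p) (Vbar t p (\<mu> p) (Z p)) (Rbar t p (Z p))))"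
proof -
  define a where "a = \<bar>zq (t / 2)\<bar>"
  have a: "a > 0" using zq_half_cutoff[OF t] by (simp add: a_def)
  define K where "K = 2 * (28 * a ^ 3 + 22 * a) + 24"
  have K: "K > 0" unfolding K_def using a by (simp add: add_pos_pos)
  define S0 where "S0 p = (\<Sum>i\<in>H0 p. \<Sum>j\<in>H0 p - {i}. (\<sigma> p i j)\<^sup>2)" for p
  define S4 where "S4 p = (\<Sum>i\<in>{1..p}. \<Sum>j\<in>{1..p} - {i}. (\<sigma> p i j) ^ 4)" for p
  define A where "A p = (\<Sum>i\<in>{1..p}. \<Sum>j\<in>{1..p}. \<bar>\<sigma> p i j\<bar>)" for p
  have S0: "0 \<le> S0 p" and S4: "0 \<le> S4 p" and A0: "0 \<le> A p" for p
    unfolding S0_def S4_def A_def by (auto intro!: sum_nonneg)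
  define m where "m p = lin_part (M p) (Vbar t p (\<mu> p) (Z p)) (Rbar t p (Z p))" for p
  define q where "q p = prob_space.expectation (M p) (Vbar t p (\<mu> p) (Z p)) / prob_space.expectation (M p) (Rbar t p (Z p))" for p
  \<comment> \<open>The remainder is defined by the decomposition, which is thus an identity; the
    content lies in its second moment.\<close>
  define r where "r p \<omega> = FDP t p (\<mu> p) (Z p) \<omega> - q p - m p \<omega>" for p \<omega>
  define Vr where "Vr p = prob_space.variance (M p) (m p)" for p

  \<comment> \<open>A number strictly between the limsup and 1 turns the strict inequality into a
    gap that is uniform in \<open>p\<close>.\<close>
  obtain c where c: "c < 1" "\<forall>\<^sub>F p in sequentially. real (card (H0 p)) * t / (real (card (H1 p)) * xi_bar t p (\<mu> p)) < c"
  proof -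
    obtain c where "limsup (\<lambda>p. ereal (real (card (H0 p)) * t / (real (card (H1 p)) * xi_bar t p (\<mu> p)))) < ereal c" "ereal c < 1"
      using ereal_dense2[OF limsup_cond] by auto
    from that[OF _ eventually_mono[OF Limsup_lessD[OF this(1)]]] this(2) show ?thesis by simp
  qed
  define b where "b = min (t * (1 - t) / 4) ((1 - c) / 2 * (a * std_normal_density a)\<^sup>2)"
  have b: "b > 0" using t c a normal_density_pos[of 1 0 a] by (simp add: b_def)

  have variance_lower: "\<forall>\<^sub>F p in sequentially. b / 2 * (S0 p + card (H0 p)) / (real p)\<^sup>2 \<le> Vr p"
  proof -
    have "\<forall>\<^sub>F p in sequentially. norm (S4 p) \<le> b / (4 * K) * norm (S0 p + card (H0 p))"
      using landau_o.smallD[OF fourth_powers, of "b / (4 * K)"] b K unfolding S4_def S0_def by simp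
    with cond_cross c(2) eventually_ge_at_top[of 1] show ?thesis
    proof eventually_elim
      case (elim p)
      have "b / 2 * ((\<Sum>i\<in>true_nulls p (\<mu> p). \<Sum>j\<in>true_nulls p (\<mu> p) - {i}. (\<sigma> p i j)\<^sup>2) + card (true_nulls p (\<mu> p))) / (real p)\<^sup>2
          \<le> prob_space.variance (M p) (lin_part (M p) (Vbar t p (\<mu> p) (Z p)) (Rbar t p (Z p)))"
        unfolding b_def a_def
      proof (rule variance_lin_part_lower_bound[OF t prob[OF elim(3)] normal[OF elim(3)] unit_variance elim(3)])
        show "1 \<le> card (false_nulls p (\<mu> p))" using p1[OF elim(3)] by (simp add: H1_def)
        have "S4 p \<le> b / (4 * K) * (S0 p + card (H0 p))"
          using elim(4) S0[of p] S4[of p] by simp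
        then show "(\<Sum>i\<in>{1..p}. \<Sum>j\<in>{1..p} - {i}. (\<sigma> p i j) ^ 4)
          \<le> min (t * (1 - t) / 4) ((1 - c) / 2 * (\<bar>zq (t / 2)\<bar> * std_normal_density \<bar>zq (t / 2)\<bar>)\<^sup>2)
            / (4 * (2 * (28 * \<bar>zq (t / 2)\<bar> ^ 3 + 22 * \<bar>zq (t / 2)\<bar>) + 24))
            * ((\<Sum>i\<in>true_nulls p (\<mu> p). \<Sum>j\<in>true_nulls p (\<mu> p) - {i}. (\<sigma> p i j)\<^sup>2) + card (true_nulls p (\<mu> p)))"
          unfolding S4_def S0_def b_def K_def a_def H0_def .
      qed (use elim(1,2) c(1) in \<open>simp_all add: H0_def H1_def\<close>)
      then show ?case by (simp only: Vr_def m_def S0_def H0_def)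
    qed
  qed

  obtain B where B: "B > 0" "\<forall>\<^sub>F p in sequentially. norm (A p) \<le> B * norm (real p powr (2 - \<delta>))"
    by (rule landau_o.bigE[OF weak_dep]) (use that in \<open>simp add: A_def\<close>)
  \<comment> \<open>Concentration yields the order \<open>p\<close> to the power
    \<open>- \<delta> * k\<close>. The variance may be of order \<open>p\<^sup>-\<^sup>2\<close>, so
    the exponent 3 leaves one factor \<open>p\<close> to beat constants depending on the prescribed
    accuracy.\<close>
  define k where "k = nat \<lceil>3 / \<delta>\<rceil>"
  have k: "3 \<le> \<delta> * k"
  proof -
    have "3 / \<delta> \<le> k" unfolding k_def by linarith
    then show ?thesis using delta by (simp add: field_simps)
  qed
  have A_decay: "\<forall>\<^sub>F p in sequentially. (A p / (real p)\<^sup>2) ^ k \<le> B ^ k / (real p) ^ 3"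
    using B(2) eventually_ge_at_top[of 1]
  proof eventually_elim
    case (elim p)
    have p: "real p \<ge> 1" using elim(2) by simp
    have "A p \<le> B * real p powr (2 - \<delta>)" using elim(1) A0[of p] by simp
    also have "real p powr (2 - \<delta>) = (real p)\<^sup>2 * real p powr (- \<delta>)"
      using p powr_add[of "real p" 2 "- \<delta>"] by simp
    finally have "A p / (real p)\<^sup>2 \<le> B * real p powr (- \<delta>)"
      using p by (simp add: field_simps)
    then have "(A p / (real p)\<^sup>2) ^ k \<le> (B * real p powr (- \<delta>)) ^ k"
      using A0[of p] by (intro power_mono) auto
    also have "\<dots> = B ^ k * real p powr (- (\<delta> * k))"
      using p by (simp add: power_mult_distrib powr_power mult.commute)
    also have "\<dots> \<le> B ^ k * real p powr (- 3)"
      using B(1) p k by (intro mult_left_mono powr_mono) auto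
    also have "real p powr (- 3) = 1 / (real p) ^ 3"
      using p by (simp add: powr_minus powr_numeral divide_inverse)
    finally show ?case by simp
  qed

  \<comment> \<open>Without true nulls the lower bound for the variance is zero and gives no
    comparison, but then \<open>V\<close>, the ratio of means and the linear part all vanish, and so
    does the remainder.\<close>
  have no_nulls: "r p \<omega> = 0" if "p \<ge> 1" "H0 p = {}" for p \<omega>
    using that by (simp add: r_def q_def m_def H0_def FDP_def Vbar_def[abs_def] V_def[abs_def] lin_part_def)

  have "(\<lambda>p. prob_space.expectation (M p) (\<lambda>\<omega>. (r p \<omega>)\<^sup>2)) \<in> o(Vr)"
  proof (rule landau_o.smallI)
    fix e :: real assume e: "e > 0"
    \<comment> \<open>Half of \<open>e\<close> goes to each term of the remainder bound:
      \<open>sqrt (e / 8)\<close> makes \<open>4 * \<epsilon>\<^sup>2 \<le> e / 2\<close>, and the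
      cap \<open>1 / 2\<close> is the range in which that bound holds.\<close>
    define \<epsilon> where "\<epsilon> = min (1 / 2) (sqrt (e / 8))"
    have \<epsilon>: "\<epsilon> > 0" "\<epsilon> \<le> 1 / 2" using e by (auto simp: \<epsilon>_def)
    have "\<epsilon>\<^sup>2 \<le> (sqrt (e / 8))\<^sup>2" using \<epsilon> by (intro power_mono) (auto simp: \<epsilon>_def)
    then have \<epsilon>2: "4 * \<epsilon>\<^sup>2 \<le> e / 2" using e by simp
    define \<eta> where "\<eta> = \<epsilon> * t / 8"
    have \<eta>: "\<eta> > 0" using \<epsilon> t by (simp add: \<eta>_def)
    define D where "D = 2 * ((pi / 2) ^ (2 * k) * (fact (2 * k) / (2 ^ k * fact k)) * (16 / \<eta>\<^sup>2) ^ k / (2 * \<eta>) ^ (2 * k))"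
    have D: "D > 0" unfolding D_def using \<eta> by simp
    \<comment> \<open>\<open>D\<close> depends on \<open>e\<close> through \<eta> but not on
      \<open>p\<close>, so the spare factor \<open>p\<close> eventually exceeds this ratio of
      constants.\<close>
    have large: "\<forall>\<^sub>F p in sequentially. 4 / t\<^sup>2 * (D * B ^ k) / (e / 2 * (b / 2)) \<le> real p"
      using filterlim_real_sequentially unfolding filterlim_at_top by blast
    show "\<forall>\<^sub>F p in sequentially. norm (prob_space.expectation (M p) (\<lambda>\<omega>. (r p \<omega>)\<^sup>2)) \<le> e * norm (Vr p)"
      using variance_lower A_decay large eventually_ge_at_top[of 1]
    proof eventually_elim
      case (elim p)
      interpret prob_space "M p" by (rule prob[OF elim(4)])
      have p: "real p > 0" using elim(4) by simp
      have V0: "Vr p \<ge> 0" unfolding Vr_def by (intro Bochner_Integration.integral_nonneg) simp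
      have r0: "0 \<le> expectation (\<lambda>\<omega>. (r p \<omega>)\<^sup>2)" by (intro Bochner_Integration.integral_nonneg) simp
      show ?case
      proof (cases "H0 p = {}")
        case True
        then show ?thesis using no_nulls[OF elim(4)] e V0 by simp
      next
        case False
        have "finite (H0 p)" by (simp add: H0_def true_nulls_def)
        with False have "card (H0 p) \<ge> 1" by (simp add: Suc_leI card_gt_0_iff)
        \<comment> \<open>A single true null already puts the variance above
          \<open>b / 2 / p\<^sup>2\<close>, the level with which the tail of order
          \<open>p\<^sup>-\<^sup>3\<close> is compared.\<close>
        then have n: "1 \<le> S0 p + card (H0 p)" using S0[of p] by linarith
        let ?P = "measure (M p) {\<omega>\<in>space (M p). 4 * \<eta> * card {1..p} \<le> \<bar>(\<Sum>i\<in>{1..p}. test t (Z p i \<omega>)) - (\<Sum>i\<in>{1..p}. xi t (\<mu> p i))\<bar>}"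
        have "?P \<le> D * (A p / (real (card {1..p}))\<^sup>2) ^ k"
          unfolding D_def A_def
          by (rule rejection_proportion_concentration[OF t \<eta> prob[OF elim(4)] normal[OF elim(4)] unit_variance])
            (use elim(4) in auto)
        also have "\<dots> \<le> D * (B ^ k / (real p) ^ 3)"
          using elim(2) D by (intro mult_left_mono) auto
        finally have P: "?P \<le> D * (B ^ k / (real p) ^ 3)" .
        have "4 / t\<^sup>2 * ?P \<le> 4 / t\<^sup>2 * (D * (B ^ k / (real p) ^ 3))"
          by (intro mult_left_mono P) simp
        also have "\<dots> = (4 / t\<^sup>2 * (D * B ^ k)) / (real p) ^ 3" by simp
        also have "\<dots> \<le> (real p * (e / 2 * (b / 2))) / (real p) ^ 3"
          using elim(3) e b p by (intro divide_right_mono) (auto simp: divide_le_eq mult_ac)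
        also have "\<dots> = e / 2 * (b / 2 * 1 / (real p)\<^sup>2)"
          using p by (simp add: power2_eq_square power3_eq_cube)
        also have "\<dots> \<le> e / 2 * (b / 2 * (S0 p + card (H0 p)) / (real p)\<^sup>2)"
          using n e b by (intro mult_left_mono divide_right_mono) auto
        also have "\<dots> \<le> e / 2 * Vr p"
          using elim(1) e by (intro mult_left_mono) auto
        finally have tail: "4 / t\<^sup>2 * ?P \<le> e / 2 * Vr p" .
        have "expectation (\<lambda>\<omega>. (r p \<omega>)\<^sup>2) \<le> 4 * \<epsilon>\<^sup>2 * Vr p + 4 / t\<^sup>2 * ?P"
          unfolding r_def q_def m_def Vr_def \<eta>_def
          by (rule remainder_second_moment_bound(2)[OF t prob[OF elim(4)] normal[OF elim(4)] unit_variance elim(4) \<epsilon>])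
        also have "\<dots> \<le> e / 2 * Vr p + e / 2 * Vr p"
          using tail \<epsilon>2 V0 by (intro add_mono mult_right_mono)
        finally show ?thesis using r0 V0 by simp
      qed
    qed
  qed
  moreover have "integrable (M p) (\<lambda>\<omega>. (r p \<omega>)\<^sup>2)" if "p \<ge> 1" for p
    unfolding r_def q_def m_def
    by (rule remainder_second_moment_bound(1)[OF t prob[OF that] normal[OF that] unit_variance that])
  ultimately show ?thesis
    unfolding Vr_def[abs_def] m_def
    by (intro exI[of _ r]) (auto simp: r_def q_def m_def)
qed

end
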